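(* For every $d\in\{2,3,\ldots\}$ and every $k\in\{2,\ldots,d+1\}$ there is a constant $c(k,d)>0$ such that for every integer $n>k+1$: $$c^1_2(n)=2n-4,$$ $$\left\lfloor\frac{n-2}{2}\right\rfloor\le c^2_2(n)\le 2n-4,$$ $$\frac{n^2-2n-3}{8}\le c^2_3(n)\le n^2-n,$$ $$c(k,d)\,\frac{n^{\lfloor (k+1)/2\rfloor}}{(\log n)^{\lfloor(2d-1-k)/2\rfloor}}\le c^d_k(n)\le 2\binom{n}{k-1}.$$
   Context: A set of points in $\mathbb R^d$ is in general position if no $d+1$ of its points lie on a $(d-1)$-dimensional affine subspace (for $d=1$: the points are distinct). For a set $X$ and $k\le|X|-1$, a set $F$ containment-separates two $k$-element subsets $A,B$ of $X$ if $F$ contains one of $A,B$ and does not contain the other; a family is a containment-separator of the $k$-subsets of $X$ if every pair of distinct $k$-subsets of $X$ is containment-separated by some member. $c^d_k(n)$ denotes the minimum number $c$ such that for every set $X$ of $n$ points in general position in $\mathbb R^d$ there is a containment-separator of the $k$-subsets of $X$ consisting of $c$ convex subsets of $\mathbb R^d$.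
   Formalization: For n ≤ d, points in general position are additionally required to be affinely independent; with the literal definition (vacuous there) collinear points are allowed and c^d_k(n) does not exist for k ≥ 3, e.g. d=5, k=3, n=5. *)

theory Defs
  imports "HOL-Analysis.Analysis"
begin

(* The first conjunct is the usual condition. It is vacuous for sets of at most d points, where
   it would admit e.g. five collinear points in dimension 5; no family of convex sets
   containment-separates all of their 3-subsets. The second conjunct adds the standard
   convention that such small sets are affinely independent. It is void as soon as
   the set has more than d points. *)
definition general_position :: "'a::euclidean_space set \<Rightarrow> bool" where
  "general_position X \<longleftrightarrow>
     (\<forall>S\<subseteq>X. card S = DIM('a) + 1 \<longrightarrow>
        \<not> (\<exists>H. affine H \<and> aff_dim H = int DIM('a) - 1 \<and> S \<subseteq> H)) \<and>
     (finite X \<and> card X \<le> DIM('a) \<longrightarrow> \<not> affine_dependent X)"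

definition containment_separates :: "'a set \<Rightarrow> 'a set \<Rightarrow> 'a set \<Rightarrow> bool" where
  "containment_separates F A B \<longleftrightarrow> (A \<subseteq> F \<and> \<not> B \<subseteq> F) \<or> (B \<subseteq> F \<and> \<not> A \<subseteq> F)"

definition containment_separator :: "nat \<Rightarrow> 'a set \<Rightarrow> 'a set set \<Rightarrow> bool" where
  "containment_separator k X \<F> \<longleftrightarrow>
     (\<forall>A B. A \<subseteq> X \<and> card A = k \<and> B \<subseteq> X \<and> card B = k \<and> A \<noteq> B \<longrightarrow>
        (\<exists>F\<in>\<F>. containment_separates F A B))"

(* The number c^d_k(n); the ambient space R^d is passed as a type. *)
definition convex_separation_number :: "'a::euclidean_space itself \<Rightarrow> nat \<Rightarrow> nat \<Rightarrow> nat" where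
  "convex_separation_number _ k n =
     (LEAST c. \<forall>X :: 'a set. finite X \<and> card X = n \<and> general_position X \<longrightarrow>
        (\<exists>\<F>. finite \<F> \<and> card \<F> = c \<and> (\<forall>F\<in>\<F>. convex F) \<and> containment_separator k X \<F>))"

end

theory Submission
  imports Defs
begin

text \<open>
  Upper bounds: for \<open>k = 2\<close> order the points by a functional that is injective on them and use the
  halfspaces it defines. In general, look at the points along a generic linear subspace of dimension
  \<open>d + 1 - k\<close>, so that the \<open>k\<close>-subsets become simplices; two distinct simplices are separated by a
  facet halfspace of one of them, as otherwise they contain each other's vertices.

  Lower bounds: exhibit many pairs \<open>(A, B)\<close> of \<open>k\<close>-subsets of which a single convex set separates only
  few. Each pair is made of twin points \<open>x, x'\<close>, infinitely close to each other, from a set \<open>M\<close>, together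
  with the same antipodal pairs \<open>\<plusminus>g\<close> far away in each of \<open>A\<close> and \<open>B\<close>. A functional exposing a point of \<open>M\<close> with
  respect to a convex set that contains \<open>\<plusminus>g\<close> is nearly orthogonal to \<open>g\<close>, so the separated points
  are in convex position after a projection along all the \<open>g\<close> involved. Following Karolyi and Valtr, \<open>M\<close> is built by
  repeatedly doubling every point in a generic direction on ever smaller scales; its projections to
  \<open>r\<close> dimensions then have only \<open>O((log |M|)\<^sup>r\<^sup>-\<^sup>1)\<close> points in convex position. For even \<open>k\<close> one
  more point at infinity is added after lifting everything to a paraboloid. All \<open>infinitely close\<close>
  and \<open>far away\<close> choices are limits of finite configurations, and they are justified because containment in a
  closed halfspace through the origin is a closed condition on finitely many vectors.
\<close>

section \<open>Supporting functionals and linear general position\<close>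

text \<open>The lower bounds come from double counting: if a convex set separates at most s of the
  pairs in E, a separator has at least |E| / s members. With j = (k - 1) div 2 antipodal pairs in
  each k-set, |E| has order n^(j+1), and j + 1 is the required exponent. A separating set that
  contains q of the pairs \<plusminus>g leaves a nonzero functional orthogonal to q generic vectors,
  so q < d, and choosing j of these q pairs costs only the constant 2^d. The obstacle is parity: a
  pair \<plusminus>g takes two elements and makes a functional vanish on g, whereas a single far
  point only prescribes a sign. On a paraboloid the sign is enough, since the curvature term then
  acts in the same direction; so for even k one extra element removes one more dimension. The
  exponent of the logarithm is d - 1 - j for odd k and d - 2 - j for even k, in both cases (2d - 1 -
  k) div 2. The explicit bounds on the line and in the plane need s = 1 or s = 2; there a chain of
  collinear points takes the place of M.\<close>

definition in_halfspace :: "'a::euclidean_space set \<Rightarrow> 'a set \<Rightarrow> bool" where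
  "in_halfspace I V \<longleftrightarrow> (\<exists>a. a \<noteq> 0 \<and> (\<forall>w\<in>I. a \<bullet> w = 0) \<and> (\<forall>v\<in>V. a \<bullet> v \<le> 0))"

lemma in_halfspaceI:
  "a \<noteq> 0 \<Longrightarrow> (\<And>w. w \<in> I \<Longrightarrow> a \<bullet> w = 0) \<Longrightarrow> (\<And>v. v \<in> V \<Longrightarrow> a \<bullet> v \<le> 0) \<Longrightarrow> in_halfspace I V"
  by (auto simp: in_halfspace_def)

lemma in_halfspaceE:
  assumes "in_halfspace I V"
  obtains a where "a \<noteq> 0" "\<And>w. w \<in> I \<Longrightarrow> a \<bullet> w = 0" "\<And>v. v \<in> V \<Longrightarrow> a \<bullet> v \<le> 0"
  using assms by (auto simp: in_halfspace_def)

text \<open>On the compact set \<open>K\<close> of unit functionals vanishing on \<open>I\<close>,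
  the total positive part \<open>\<phi>\<close> is continuous and positive, hence bounded below by
  some \<open>\<phi> a0\<close> > 0. Vectors that move by less than this in total cannot become
  nonpositive under any such functional. Every limit argument below rests on this openness.\<close>

lemma eventually_not_in_halfspace:
  fixes v :: "'p \<Rightarrow> 'j \<Rightarrow> 'a::euclidean_space"
  assumes J: "finite J" and lim: "\<And>j. j \<in> J \<Longrightarrow> ((\<lambda>p. v p j) \<longlongrightarrow> w j) F"
    and not: "\<not> in_halfspace I (w ` J)"
  shows "\<forall>\<^sub>F p in F. \<not> in_halfspace I (v p ` J)"
proof (cases "\<exists>a::'a. a \<noteq> 0 \<and> (\<forall>w\<in>I. a \<bullet> w = 0)")
  case False
  then have "\<not> in_halfspace I V" for V unfolding in_halfspace_def by blast
  then show ?thesis by simp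
next
  case True
  then obtain e :: 'a where e: "e \<noteq> 0" "\<And>w. w \<in> I \<Longrightarrow> e \<bullet> w = 0" by blast
  define \<phi> where "\<phi> a = (\<Sum>j\<in>J. max 0 (a \<bullet> w j))" for a
  define K where "K = sphere (0::'a) 1 \<inter> (\<Inter>w\<in>I. {a. a \<bullet> w = 0})"
  have pos: "\<phi> a > 0" if "a \<in> K" for a
  proof -
    have "a \<noteq> 0" "\<forall>w\<in>I. a \<bullet> w = 0" using that by (auto simp: K_def)
    with not obtain j where j: "j \<in> J" "a \<bullet> w j > 0"
      unfolding in_halfspace_def by (metis imageE not_less)
    then have "0 < max 0 (a \<bullet> w j)" by simp
    also have "\<dots> \<le> \<phi> a" unfolding \<phi>_def
      by (rule member_le_sum) (use J j in auto)
    finally show ?thesis .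
  qed
  have cont: "continuous_on K \<phi>"
    unfolding \<phi>_def by (intro continuous_intros)
  have "closed (\<Inter>w\<in>I. {a::'a. a \<bullet> w = 0})"
    by (intro closed_INT ballI closed_Collect_eq continuous_intros)
  then have "compact K" unfolding K_def by (intro compact_Int_closed) auto
  moreover have "e /\<^sub>R norm e \<in> K" using e by (auto simp: K_def)
  ultimately obtain a0 where a0: "a0 \<in> K" "\<And>a. a \<in> K \<Longrightarrow> \<phi> a0 \<le> \<phi> a"
    using continuous_attains_inf[OF _ _ cont] by blast
  have "((\<lambda>p. \<Sum>j\<in>J. norm (v p j - w j)) \<longlongrightarrow> (\<Sum>j\<in>J. norm (w j - w j))) F"
    by (intro tendsto_intros lim)
  then have "\<forall>\<^sub>F p in F. (\<Sum>j\<in>J. norm (v p j - w j)) < \<phi> a0"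
    using pos[OF a0(1)] by (auto dest: order_tendstoD(2))
  then show ?thesis
  proof eventually_elim
    case (elim p)
    show ?case
    proof
      assume "in_halfspace I (v p ` J)"
      then obtain a where a: "a \<noteq> 0" "\<And>w. w \<in> I \<Longrightarrow> a \<bullet> w = 0" "\<And>j. j \<in> J \<Longrightarrow> a \<bullet> v p j \<le> 0"
        unfolding in_halfspace_def by blast
      define b where "b = a /\<^sub>R norm a"
      have b: "b \<in> K" "norm b = 1" "\<And>j. j \<in> J \<Longrightarrow> b \<bullet> v p j \<le> 0"
        using a by (auto simp: b_def K_def divide_le_0_iff mult_le_0_iff)
      have "max 0 (b \<bullet> w j) \<le> norm (v p j - w j)" if "j \<in> J" for j
      proof -
        have "b \<bullet> w j \<le> b \<bullet> (w j - v p j)" using b(3)[OF that] by (simp add: inner_diff_right)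
        also have "\<dots> \<le> norm b * norm (w j - v p j)" by (rule norm_cauchy_schwarz)
        finally show ?thesis using b(2) by (simp add: norm_minus_commute)
      qed
      then have "\<phi> b \<le> (\<Sum>j\<in>J. norm (v p j - w j))"
        unfolding \<phi>_def by (intro sum_mono) auto
      with elim a0(2)[of b] b(1) show False by simp
    qed
  qed
qed

lemma orthogonal_to_independent_eq_0:
  fixes a :: "'a::euclidean_space"
  assumes "independent I" "card I \<ge> DIM('a)" "\<And>w. w \<in> I \<Longrightarrow> a \<bullet> w = 0"
  shows "a = 0"
proof -
  have "span I = UNIV"
    using assms(1,2) by (metis basis_card_eq_dim dim_UNIV dim_span dim_subset_UNIV order_antisym span_UNIV dim_eq_full independent_card_le dim_eq_card_independent)
  then have "a \<in> span I" by simp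
  then have "orthogonal a a"
    using orthogonal_to_span[of a I a] assms(3) by (simp add: orthogonal_def)
  then show ?thesis by (simp add: orthogonal_def)
qed

text \<open>Finitely many proper affine subspaces form a null set, and a nonempty open set is not
  null. All generic choices below are made here; a small open set yields perturbations, the whole
  space yields directions.\<close>

lemma ex_not_in_Union_lowdim:
  fixes \<A> :: "'a::euclidean_space set set"
  assumes "finite \<A>" "\<And>A. A \<in> \<A> \<Longrightarrow> aff_dim A < int DIM('a)" "open O'" "O' \<noteq> {}"
  shows "\<exists>x\<in>O'. \<forall>A\<in>\<A>. x \<notin> affine hull A"
proof (rule ccontr)
  assume "\<not> ?thesis"
  then have sub: "O' \<subseteq> (\<Union>A\<in>\<A>. affine hull A)" by blast
  have "negligible (\<Union>A\<in>\<A>. affine hull A)"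
  proof (rule negligible_Union)
    show "finite ((hull) affine ` \<A>)" using assms(1) by simp
    fix B assume "B \<in> (hull) affine ` \<A>"
    then obtain A where B: "B = affine hull A" and A: "A \<in> \<A>" by blast
    have "aff_dim A < int DIM('a)" using A by (rule assms(2))
    then obtain a b where "a \<noteq> 0" "A \<subseteq> {x. a \<bullet> x = b}"
      using aff_lowdim_subset_hyperplane by blast
    then have "affine hull A \<subseteq> {x. a \<bullet> x = b}"
      by (intro hull_minimal) (auto simp: affine_hyperplane)
    then show "negligible B"
      unfolding B using negligible_hyperplane \<open>a \<noteq> 0\<close> negligible_subset by blast
  qed
  then have "negligible O'" using sub negligible_subset by blast
  then show False using open_not_negligible assms(3,4) by blast
qed

definition linear_general_position :: "'a::euclidean_space set \<Rightarrow> bool" where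
  "linear_general_position D \<longleftrightarrow> (\<forall>I\<subseteq>D. finite I \<and> card I \<le> DIM('a) \<longrightarrow> independent I)"

lemma linear_general_positionD:
  "linear_general_position (D :: 'a::euclidean_space set) \<Longrightarrow> I \<subseteq> D \<Longrightarrow> finite I \<Longrightarrow> card I \<le> DIM('a) \<Longrightarrow> independent I"
  by (auto simp: linear_general_position_def)

lemma linear_general_position_insert:
  fixes D :: "'a::euclidean_space set"
  assumes fin: "finite D" and D: "linear_general_position D"
  shows "\<exists>v. v \<notin> D \<and> linear_general_position (insert v D)"
proof -
  \<comment> \<open>Inserting 0 turns the affine hulls into spans. The singletons keep
    \<open>v\<close> out of \<open>D\<close> in dimension 1 too, where the only span to be avoided
    is {0}.\<close>
  let ?\<A> = "(\<lambda>I. insert 0 I) ` {I. I \<subseteq> D \<and> card I < DIM('a)} \<union> (\<lambda>x. {x}) ` D"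
  have low: "aff_dim A < int DIM('a)" if "A \<in> ?\<A>" for A
    using that
  proof
    assume "A \<in> (\<lambda>I. insert 0 I) ` {I. I \<subseteq> D \<and> card I < DIM('a)}"
    then obtain I where I: "A = insert 0 I" "I \<subseteq> D" "card I < DIM('a)" by blast
    have "finite I" using I(2) fin finite_subset by blast
    then have "dim I < DIM('a)"
      using dim_le_card[of I I] I(3) span_superset by (meson le_less_trans)
    moreover have "aff_dim (insert 0 I) = int (dim (insert 0 I))"
      by (rule aff_dim_zero) (simp add: hull_inc)
    ultimately show ?thesis using I by (metis dim_span of_nat_less_iff span_insert_0)
  qed auto
  obtain v where v: "\<And>A. A \<in> ?\<A> \<Longrightarrow> v \<notin> affine hull A"
    using ex_not_in_Union_lowdim[of ?\<A> UNIV, OF _ low] fin by auto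
  have "v \<notin> D"
  proof
    assume "v \<in> D"
    then have "v \<notin> affine hull {v}" by (intro v) blast
    then show False by (simp add: hull_inc)
  qed
  moreover have "linear_general_position (insert v D)"
    unfolding linear_general_position_def
  proof (intro allI impI)
    fix I assume I: "I \<subseteq> insert v D" "finite I \<and> card I \<le> DIM('a)"
    show "independent I"
    proof (cases "v \<in> I")
      case True
      let ?I = "I - {v}"
      have "independent ?I"
        using D I by (intro linear_general_positionD[OF D]) (auto intro: order.trans[OF card_Diff1_le])
      moreover have "v \<notin> affine hull (insert 0 ?I)"
      proof (rule v)
        have "card ?I < DIM('a)" using I True by (metis card_Diff1_less le_less_trans not_le)
        then show "insert 0 ?I \<in> ?\<A>" using I(1) by blast
      qed
      then have "v \<notin> span ?I" by (simp add: affine_hull_insert_span_gen)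
      ultimately have "independent (insert v ?I)"
        by (intro independent_insertI)
      then show ?thesis using True by (simp add: insert_absorb)
    next
      case False
      then show ?thesis using I D by (auto simp: linear_general_position_def)
    qed
  qed
  ultimately show ?thesis by blast
qed

lemma linear_general_position_extend:
  fixes D :: "'a::euclidean_space set"
  assumes "finite D" "linear_general_position D"
  shows "\<exists>G. finite G \<and> card G = m \<and> G \<inter> D = {} \<and> linear_general_position (D \<union> G)"
proof (induction m)
  case 0
  then show ?case using assms by (intro exI[of _ "{}"]) auto
next
  case (Suc m)
  then obtain G where G: "finite G" "card G = m" "G \<inter> D = {}" "linear_general_position (D \<union> G)" by blast
  then obtain v where "v \<notin> D \<union> G" "linear_general_position (insert v (D \<union> G))"
    using linear_general_position_insert[of "D \<union> G"] assms by blast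
  then show ?case using G by (intro exI[of _ "insert v G"]) auto
qed

lemma linear_general_position_empty: "linear_general_position {}"
  by (simp add: linear_general_position_def independent_empty)

section \<open>Sets with few exposed points\<close>

text \<open>The image of \<open>S\<close> in the quotient by the span of \<open>I\<close> lies in a
  hyperplane of that quotient.\<close>

definition flat_mod :: "'a::euclidean_space set \<Rightarrow> 'a set \<Rightarrow> bool" where
  "flat_mod I S \<longleftrightarrow> (\<exists>a. a \<noteq> 0 \<and> (\<forall>w\<in>I. a \<bullet> w = 0) \<and> (\<forall>s\<in>S. \<forall>x\<in>S. a \<bullet> s = a \<bullet> x))"

lemma flat_modI:
  "a \<noteq> 0 \<Longrightarrow> (\<And>w. w \<in> I \<Longrightarrow> a \<bullet> w = 0) \<Longrightarrow> (\<And>s x. s \<in> S \<Longrightarrow> x \<in> S \<Longrightarrow> a \<bullet> s = a \<bullet> x) \<Longrightarrow> flat_mod I S"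
  by (auto simp: flat_mod_def)

lemma flat_modE:
  assumes "flat_mod I S"
  obtains a where "a \<noteq> 0" "\<And>w. w \<in> I \<Longrightarrow> a \<bullet> w = 0" "\<And>s x. s \<in> S \<Longrightarrow> x \<in> S \<Longrightarrow> a \<bullet> s = a \<bullet> x"
  using assms by (auto simp: flat_mod_def)

text \<open>Weak convex position in the quotient by the span of \<open>I\<close>: a support may
  touch several points, even all of \<open>S\<close>. In particular every flat set is exposed, which
  is why bounds on flat sets accompany those on exposed sets throughout.\<close>

definition exposed_mod :: "'a::euclidean_space set \<Rightarrow> 'a set \<Rightarrow> bool" where
  "exposed_mod I S \<longleftrightarrow> (\<forall>x\<in>S. in_halfspace I ((\<lambda>s. s - x) ` S))"

text \<open>The set of differences is symmetric, so weak inequalities on it are equalities. This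
  carries the openness of not lying in a halfspace over to non-flatness.\<close>

lemma flat_mod_iff_in_halfspace:
  "flat_mod I S \<longleftrightarrow> in_halfspace I ((\<lambda>(s, x). s - x) ` (S \<times> S))"
proof
  assume "flat_mod I S"
  then show "in_halfspace I ((\<lambda>(s, x). s - x) ` (S \<times> S))"
    unfolding flat_mod_def in_halfspace_def by (fastforce simp: inner_diff_right)
next
  assume "in_halfspace I ((\<lambda>(s, x). s - x) ` (S \<times> S))"
  then obtain a where a: "a \<noteq> 0" "\<And>w. w \<in> I \<Longrightarrow> a \<bullet> w = 0"
    "\<And>v. v \<in> (\<lambda>(s, x). s - x) ` (S \<times> S) \<Longrightarrow> a \<bullet> v \<le> 0"
    by (erule in_halfspaceE)
  have "a \<bullet> s \<le> a \<bullet> x" if "s \<in> S" "x \<in> S" for s x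
    using a(3)[of "s - x"] that by (force simp: inner_diff_right)
  with a(1,2) show "flat_mod I S" unfolding flat_mod_def by (blast intro: order_antisym)
qed

lemma eventually_not_flat_mod:
  fixes v :: "'p \<Rightarrow> 'j \<Rightarrow> 'a::euclidean_space"
  assumes J: "finite J" and lim: "\<And>j. j \<in> J \<Longrightarrow> ((\<lambda>p. v p j) \<longlongrightarrow> w j) F"
    and not: "\<not> flat_mod I (w ` J)"
  shows "\<forall>\<^sub>F p in F. \<not> flat_mod I (v p ` J)"
proof -
  have eq: "(\<lambda>(s, x). s - x) ` (f ` J \<times> f ` J) = (\<lambda>(i, j). f i - f j) ` (J \<times> J)" for f :: "'j \<Rightarrow> 'a"
    by force
  have "\<forall>\<^sub>F p in F. \<not> in_halfspace I ((\<lambda>(i, j). v p i - v p j) ` (J \<times> J))"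
    by (rule eventually_not_in_halfspace[where w="\<lambda>(i, j). w i - w j"])
      (use assms in \<open>auto simp: flat_mod_iff_in_halfspace eq intro!: tendsto_intros\<close>)
  then show ?thesis by (simp add: flat_mod_iff_in_halfspace eq)
qed

lemma orthogonal_to_codim1_unique:
  fixes a b :: "'a::euclidean_space"
  assumes I: "independent I" "card I + 1 = DIM('a)" and a: "a \<noteq> 0" "\<And>w. w \<in> I \<Longrightarrow> a \<bullet> w = 0"
    and b: "\<And>w. w \<in> I \<Longrightarrow> b \<bullet> w = 0"
  shows "\<exists>c. b = c *\<^sub>R a"
proof -
  let ?c = "(b \<bullet> a) / (a \<bullet> a)"
  have "a \<notin> span I"
  proof
    assume "a \<in> span I"
    then have "orthogonal a a" using orthogonal_to_span[of a I a] a(2) by (simp add: orthogonal_def)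
    then show False using a(1) by (simp add: orthogonal_def)
  qed
  then have ind: "independent (insert a I)" using I(1) by (simp add: independent_insert)
  have "a \<notin> I" using \<open>a \<notin> span I\<close> span_base by blast
  moreover have "finite I" using I(1) by (rule independent_imp_finite)
  ultimately have card: "card (insert a I) \<ge> DIM('a)" using I(2) by simp
  have "(b - ?c *\<^sub>R a) \<bullet> w = 0" if "w \<in> insert a I" for w
    using that a b by (auto simp: inner_diff_left)
  then have "b - ?c *\<^sub>R a = 0" by (rule orthogonal_to_independent_eq_0[OF ind card])
  then show ?thesis by (intro exI[of _ ?c]) simp
qed

text \<open>The quotient is a line with one functional up to scaling, so an exposed point is a
  minimum or a maximum of it. The points attaining either extreme form a flat set, hence there is at
  most one of each.\<close>

lemma exposed_mod_codim1_card_le: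
  fixes S :: "'a::euclidean_space set"
  assumes S: "finite S" and I: "independent I" "card I + 1 = DIM('a)"
    and exp: "exposed_mod I S" and flat: "\<And>T. T \<subseteq> S \<Longrightarrow> flat_mod I T \<Longrightarrow> card T \<le> 1"
  shows "card S \<le> 2"
proof (cases "S = {}")
  case False
  then obtain a where a: "a \<noteq> 0" "\<And>w. w \<in> I \<Longrightarrow> a \<bullet> w = 0"
    using exp unfolding exposed_mod_def in_halfspace_def by blast
  define P where "P = {x\<in>S. \<forall>s\<in>S. a \<bullet> s \<le> a \<bullet> x}"
  define N where "N = {x\<in>S. \<forall>s\<in>S. a \<bullet> x \<le> a \<bullet> s}"
  have "flat_mod I P" "flat_mod I N"
    unfolding flat_mod_def using a by (auto simp: P_def N_def intro!: exI[of _ a] order_antisym)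
  then have "card P \<le> 1" "card N \<le> 1" using flat[of P] flat[of N] by (auto simp: P_def N_def)
  moreover have "S \<subseteq> P \<union> N"
  proof
    fix x assume x: "x \<in> S"
    then obtain b where b: "b \<noteq> 0" "\<And>w. w \<in> I \<Longrightarrow> b \<bullet> w = 0" "\<And>s. s \<in> S \<Longrightarrow> b \<bullet> (s - x) \<le> 0"
      using exp unfolding exposed_mod_def in_halfspace_def by blast
    obtain c where c: "b = c *\<^sub>R a"
      using orthogonal_to_codim1_unique[OF I a b(2)] by blast
    then have "c \<noteq> 0" using b(1) by auto
    then have "c > 0 \<or> c < 0" by linarith
    then show "x \<in> P \<union> N"
      using b(3) x unfolding c P_def N_def
      by (auto simp: inner_diff_right mult_le_0_iff algebra_simps)
  qed
  ultimately show ?thesis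
    using card_mono[of "P \<union> N" S] card_Un_le[of P N] S by (simp add: P_def N_def)
qed auto

section \<open>Doubling a point set in a generic direction\<close>

definition twin :: "'a::euclidean_space \<Rightarrow> real \<Rightarrow> 'a \<times> bool \<Rightarrow> 'a" where
  "twin v \<epsilon> j = (if snd j then fst j + \<epsilon> *\<^sub>R v else fst j)"

lemma twin_tendsto: "((\<lambda>\<epsilon>. twin v \<epsilon> j) \<longlongrightarrow> fst j) (at_right 0)"
proof -
  have "((\<lambda>\<epsilon>. fst j + \<epsilon> *\<^sub>R v) \<longlongrightarrow> fst j + 0 *\<^sub>R v) (at_right 0)"
    by (intro tendsto_intros)
  then show ?thesis by (cases j; cases "snd j") (auto simp: twin_def)
qed

lemma card_le_twice_card_fst:
  fixes \<sigma> :: "('a \<times> bool) set"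
  assumes "finite \<sigma>"
  shows "card \<sigma> \<le> 2 * card (fst ` \<sigma>)"
proof -
  have "\<sigma> \<subseteq> fst ` \<sigma> \<times> UNIV" by force
  then have "card \<sigma> \<le> card (fst ` \<sigma> \<times> (UNIV :: bool set))"
    using assms by (intro card_mono) auto
  then show ?thesis by (simp add: card_cartesian_product)
qed

text \<open>If \<sigma> contains at most one twin of each point, its limit has the same size and
  flatness passes to the limit. If both twins of some point occur, a functional constant on them is
  orthogonal to \<open>v\<close>, so the limit is flat modulo one more direction; its bound is half
  as large, which pays for the doubling.\<close>

lemma flat_mod_twin:
  fixes v :: "'a::euclidean_space"
  assumes M: "finite M" and \<sigma>: "\<sigma> \<subseteq> M \<times> UNIV"
    and bd: "\<And>S. S \<subseteq> M \<Longrightarrow> flat_mod I S \<Longrightarrow> card S \<le> N"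
    and bd': "\<And>S. S \<subseteq> M \<Longrightarrow> flat_mod (insert v I) S \<Longrightarrow> 2 * card S \<le> N"
  shows "\<forall>\<^sub>F \<epsilon> in at_right 0. flat_mod I (twin v \<epsilon> ` \<sigma>) \<longrightarrow> card \<sigma> \<le> N"
proof -
  have fin: "finite \<sigma>" using M \<sigma> by (rule_tac finite_subset) auto
  have sub: "fst ` \<sigma> \<subseteq> M" using \<sigma> by auto
  show ?thesis
  proof (cases "inj_on fst \<sigma>")
    case True
    then have card: "card (fst ` \<sigma>) = card \<sigma>" by (rule card_image)
    show ?thesis
    proof (cases "flat_mod I (fst ` \<sigma>)")
      case True
      then show ?thesis using bd[OF sub] card by simp
    next
      case False
      then have "\<forall>\<^sub>F \<epsilon> in at_right 0. \<not> flat_mod I (twin v \<epsilon> ` \<sigma>)"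
        by (intro eventually_not_flat_mod[OF fin twin_tendsto])
      then show ?thesis by eventually_elim simp
    qed
  next
    case False
    then obtain x where x: "(x, False) \<in> \<sigma>" "(x, True) \<in> \<sigma>"
      unfolding inj_on_def by (metis (full_types) prod.collapse)
    show ?thesis
    proof (cases "flat_mod (insert v I) (fst ` \<sigma>)")
      case True
      then show ?thesis
        using bd'[OF sub] card_le_twice_card_fst[OF fin] by simp
    next
      case False
      then have "\<forall>\<^sub>F \<epsilon> in at_right 0. \<not> flat_mod (insert v I) (twin v \<epsilon> ` \<sigma>)"
        by (intro eventually_not_flat_mod[OF fin twin_tendsto])
      moreover have "\<forall>\<^sub>F \<epsilon> in at_right 0. \<epsilon> > (0::real)" by (rule eventually_at_right_less)
      ultimately show ?thesis
      proof eventually_elim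
        case (elim \<epsilon>)
        have "flat_mod (insert v I) (twin v \<epsilon> ` \<sigma>)" if flat: "flat_mod I (twin v \<epsilon> ` \<sigma>)"
        proof -
          from flat obtain a where a: "a \<noteq> 0" "\<forall>w\<in>I. a \<bullet> w = 0"
            "\<forall>i\<in>\<sigma>. \<forall>j\<in>\<sigma>. a \<bullet> twin v \<epsilon> i = a \<bullet> twin v \<epsilon> j"
            by (auto simp: flat_mod_def)
          have "a \<bullet> twin v \<epsilon> (x, True) = a \<bullet> twin v \<epsilon> (x, False)" using a(3) x by blast
          then have "a \<bullet> v = 0" using elim(2) by (simp add: twin_def inner_add_right)
          then show ?thesis using a by (intro flat_modI[of a]) auto
        qed
        then show ?case using elim(1) by blast
      qed
    qed
  qed
qed

text \<open>Fourier-Motzkin elimination of \<open>v\<close>: two functionals with opposite signs on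
  \<open>v\<close> have a positive combination vanishing on it. This combination is zero only if
  they are negative multiples of each other; then both vanish on all \<open>s - x\<close>, and
  \<open>S\<close> is flat.\<close>

lemma in_halfspace_combine:
  assumes p: "in_halfspace I (insert v ((\<lambda>s. s - x) ` S))"
    and n: "in_halfspace I (insert (-v) ((\<lambda>s. s - x) ` S))"
    and flat: "\<not> flat_mod I S"
  shows "in_halfspace (insert v I) ((\<lambda>s. s - x) ` S)"
proof -
  obtain a where a: "a \<noteq> 0" "\<And>w. w \<in> I \<Longrightarrow> a \<bullet> w = 0" "a \<bullet> v \<le> 0" "\<And>s. s \<in> S \<Longrightarrow> a \<bullet> (s - x) \<le> 0"
    using p unfolding in_halfspace_def by auto
  obtain b where b: "b \<noteq> 0" "\<And>w. w \<in> I \<Longrightarrow> b \<bullet> w = 0" "b \<bullet> v \<ge> 0" "\<And>s. s \<in> S \<Longrightarrow> b \<bullet> (s - x) \<le> 0"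
    using n unfolding in_halfspace_def by auto
  define e where "e = (b \<bullet> v) *\<^sub>R a - (a \<bullet> v) *\<^sub>R b"
  consider "a \<bullet> v = 0" | "b \<bullet> v = 0" | "a \<bullet> v < 0" "b \<bullet> v > 0" using a(3) b(3) by linarith
  then show ?thesis
  proof cases
    case 1
    then show ?thesis using a by (intro in_halfspaceI[of a]) auto
  next
    case 2
    then show ?thesis using b by (intro in_halfspaceI[of b]) auto
  next
    case 3
    have "e \<noteq> 0"
    proof
      assume "e = 0"
      then have "(b \<bullet> v) *\<^sub>R a = (a \<bullet> v) *\<^sub>R b" by (simp add: e_def)
      then have "(1 / (b \<bullet> v) * (b \<bullet> v)) *\<^sub>R a = (1 / (b \<bullet> v) * (a \<bullet> v)) *\<^sub>R b"
        by (simp only: scaleR_scaleR [symmetric])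
      then have "a = ((a \<bullet> v) / (b \<bullet> v)) *\<^sub>R b" using 3 by simp
      then obtain c where c: "a = c *\<^sub>R b" "c < 0" using 3 by (auto intro: divide_neg_pos)
      have "b \<bullet> (s - x) = 0" if "s \<in> S" for s
        using a(4)[OF that] b(4)[OF that] c by (auto simp: mult_le_0_iff)
      then have "\<forall>s\<in>S. \<forall>y\<in>S. b \<bullet> s = b \<bullet> y" by (simp add: inner_diff_right)
      then show False using flat b(1,2) unfolding flat_mod_def by blast
    qed
    moreover have "e \<bullet> (s - x) \<le> 0" if "s \<in> S" for s
    proof -
      have "(b \<bullet> v) * (a \<bullet> (s - x)) \<le> 0" "(a \<bullet> v) * (b \<bullet> (s - x)) \<ge> 0"
        using 3 a(4)[OF that] b(4)[OF that] by (auto intro: mult_nonneg_nonpos mult_nonpos_nonpos)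
      then show ?thesis by (simp add: e_def inner_diff_left)
    qed
    moreover have "e \<bullet> w = 0" if "w \<in> insert v I" for w
      using that a(2) b(2) by (auto simp: e_def inner_diff_left)
    ultimately show ?thesis by (intro in_halfspaceI[of e]) auto
  qed
qed

text \<open>If \<open>x\<close> and its twin \<open>x + \<epsilon> v\<close> are both exposed, a combination of the two functionals is
  orthogonal to \<open>v\<close> and still exposes \<open>x\<close>; so the doubled points are exposed modulo \<open>v\<close> as well.\<close>

lemma exposed_mod_twin:
  fixes v :: "'a::euclidean_space"
  assumes M: "finite M" and \<sigma>: "\<sigma> \<subseteq> M \<times> UNIV"
    and flat: "\<And>S. S \<subseteq> M \<Longrightarrow> flat_mod I S \<Longrightarrow> 2 * card S \<le> B + C"
    and B: "\<And>S. S \<subseteq> M \<Longrightarrow> exposed_mod I S \<Longrightarrow> card S \<le> B"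
    and C: "\<And>S. S \<subseteq> M \<Longrightarrow> exposed_mod (insert v I) S \<Longrightarrow> card S \<le> C"
  shows "\<forall>\<^sub>F \<epsilon> in at_right 0. exposed_mod I (twin v \<epsilon> ` \<sigma>) \<longrightarrow> card \<sigma> \<le> B + C"
proof -
  have fin: "finite \<sigma>" using M \<sigma> by (rule_tac finite_subset) auto
  have sub: "fst ` \<sigma> \<subseteq> M" using \<sigma> by auto
  \<comment> \<open>\<open>T\<close> collects the points both of whose twins occur. Hence \<sigma>
    has one element for each point of its projection and a second one for each point of
    \<open>T\<close>.\<close>
  define T where "T = {x. (x, False) \<in> \<sigma> \<and> (x, True) \<in> \<sigma>}"
  have T: "T \<subseteq> fst ` \<sigma>" by (force simp: T_def)
  have "\<sigma> \<subseteq> (\<lambda>x. (x, (x, True) \<in> \<sigma>)) ` (fst ` \<sigma>) \<union> (\<lambda>x. (x, False)) ` T"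
    by (force simp: T_def)
  then have "card \<sigma> \<le> card ((\<lambda>x. (x, (x, True) \<in> \<sigma>)) ` (fst ` \<sigma>) \<union> (\<lambda>x. (x, False)) ` T)"
    using fin T finite_subset[OF T] by (intro card_mono) auto
  also have "\<dots> \<le> card ((\<lambda>x. (x, (x, True) \<in> \<sigma>)) ` (fst ` \<sigma>)) + card ((\<lambda>x. (x, False)) ` T)"
    by (rule card_Un_le)
  also have "\<dots> \<le> card (fst ` \<sigma>) + card T"
    using fin T finite_subset[OF T] by (intro add_mono card_image_le) auto
  finally have card: "card \<sigma> \<le> card (fst ` \<sigma>) + card T" .
  \<comment> \<open>Cases 2 and 3 bound the cardinality outright; in cases 1 and 4 exposedness fails
    in the limit and hence for small \<epsilon>. The flat limit is treated apart because elimination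
    of \<open>v\<close> may break down there.\<close>
  consider "\<not> exposed_mod I (fst ` \<sigma>)" | "flat_mod I (fst ` \<sigma>)"
    | "exposed_mod I (fst ` \<sigma>)" "exposed_mod (insert v I) T"
    | "\<not> flat_mod I (fst ` \<sigma>)" "\<not> exposed_mod (insert v I) T" by blast
  then show ?thesis
  proof cases
    case 1
    then obtain j where j: "j \<in> \<sigma>" "\<not> in_halfspace I ((\<lambda>s. s - fst j) ` (fst ` \<sigma>))"
      unfolding exposed_mod_def by blast
    have "\<forall>\<^sub>F \<epsilon> in at_right 0. \<not> in_halfspace I ((\<lambda>i. twin v \<epsilon> i - twin v \<epsilon> j) ` \<sigma>)"
      by (rule eventually_not_in_halfspace[where w="\<lambda>i. fst i - fst j"])
        (use fin j(2) in \<open>auto intro!: tendsto_intros twin_tendsto simp: image_image\<close>)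
    then show ?thesis
      by eventually_elim (use j(1) in \<open>auto simp: exposed_mod_def image_image\<close>)
  next
    case 2
    then show ?thesis using flat[OF sub] card_le_twice_card_fst[OF fin] by simp
  next
    case 3
    then have "card \<sigma> \<le> B + C" using B[OF sub] C[of T] T sub card by fastforce
    then show ?thesis by simp
  next
    case 4
    then obtain x where x: "x \<in> T" "\<not> in_halfspace (insert v I) ((\<lambda>s. s - x) ` T)"
      unfolding exposed_mod_def by blast
    have "\<not> in_halfspace (insert v I) ((\<lambda>s. s - x) ` (fst ` \<sigma>))"
      using x(2) T unfolding in_halfspace_def by blast
    then have "\<not> in_halfspace I (insert v ((\<lambda>s. s - x) ` (fst ` \<sigma>))) \<or>
               \<not> in_halfspace I (insert (- v) ((\<lambda>s. s - x) ` (fst ` \<sigma>)))"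
      using in_halfspace_combine 4(1) by blast
    then obtain b where b: "\<not> in_halfspace I (insert (if b then - v else v) ((\<lambda>s. s - x) ` (fst ` \<sigma>)))"
      by (metis (full_types))
    have xb: "(x, b) \<in> \<sigma>" "(x, \<not> b) \<in> \<sigma>" using x(1) by (cases b; simp add: T_def)+
    \<comment> \<open>In the limit the difference of the two twins of \<open>x\<close> vanishes. The
      entry \<open>None\<close> retains its direction, which is the difference divided by
      \<epsilon>.\<close>
    define w where "w = (\<lambda>\<epsilon>. case_option (if b then - v else v) (\<lambda>i. twin v \<epsilon> i - twin v \<epsilon> (x, b)))"
    have "\<forall>\<^sub>F \<epsilon> in at_right 0. \<not> in_halfspace I (w \<epsilon> ` insert None (Some ` \<sigma>))"
    proof (rule eventually_not_in_halfspace[where w="case_option (if b then - v else v) (\<lambda>i. fst i - x)"])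
      show "finite (insert None (Some ` \<sigma>))" using fin by simp
      show "\<not> in_halfspace I (case_option (if b then - v else v) (\<lambda>i. fst i - x) ` insert None (Some ` \<sigma>))"
        using b by (simp add: image_image)
      show "((\<lambda>\<epsilon>. w \<epsilon> i) \<longlongrightarrow> case_option (if b then - v else v) (\<lambda>i. fst i - x) i) (at_right 0)" for i
        using tendsto_diff[OF twin_tendsto twin_tendsto[of v "(x, b)"]]
        by (cases i) (auto simp: w_def)
    qed
    moreover have "\<forall>\<^sub>F \<epsilon> in at_right 0. \<epsilon> > (0::real)" by (rule eventually_at_right_less)
    ultimately show ?thesis
    proof eventually_elim
      case (elim \<epsilon>)
      have "\<not> exposed_mod I (twin v \<epsilon> ` \<sigma>)"
      proof
        assume "exposed_mod I (twin v \<epsilon> ` \<sigma>)"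
        then obtain a where a: "a \<noteq> 0" "\<And>w. w \<in> I \<Longrightarrow> a \<bullet> w = 0"
          "\<And>i. i \<in> \<sigma> \<Longrightarrow> a \<bullet> (twin v \<epsilon> i - twin v \<epsilon> (x, b)) \<le> 0"
          using xb(1) unfolding exposed_mod_def in_halfspace_def by (auto simp: image_image)
        have "a \<bullet> (twin v \<epsilon> (x, \<not> b) - twin v \<epsilon> (x, b)) \<le> 0" using a(3) xb(2) by blast
        then have "a \<bullet> (if b then - v else v) \<le> 0"
          using elim(2) by (cases b) (auto simp: twin_def mult_le_0_iff zero_le_mult_iff)
        then have "in_halfspace I (w \<epsilon> ` insert None (Some ` \<sigma>))"
          using a by (intro in_halfspaceI[of a]) (auto simp: w_def)
        then show False using elim(1) by blast
      qed
      then show ?case by blast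
    qed
  qed
qed

text \<open>The directions \<open>D\<close> of later projections are fixed in advance, and the
  induction hypothesis is used with the doubling direction added to them. Let r = d - 1 - |I|.
  Doubling gives bound(l + 1, r) \<le> bound(l, r) + bound(l, r - 1) for exposed sets, a Pascal
  recursion satisfied by 2^d (l + 1)^r. The factor 2^d absorbs the flat sets, of size at most 2^r,
  and the two extreme points that occur for r = 0.\<close>

lemma ex_set_few_exposed:
  fixes D :: "'a::euclidean_space set"
  assumes "finite D" "linear_general_position D"
  shows "\<exists>M::'a set. finite M \<and> card M = 2 ^ l \<and>
    (\<forall>I S. I \<subseteq> D \<and> card I < DIM('a) \<and> S \<subseteq> M \<longrightarrow>
       (flat_mod I S \<longrightarrow> card S \<le> 2 ^ (DIM('a) - 1 - card I)) \<and>
       (exposed_mod I S \<longrightarrow> card S \<le> 2 ^ DIM('a) * (l + 1) ^ (DIM('a) - 1 - card I)))"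
  using assms
proof (induction l arbitrary: D)
  case 0
  have "card S \<le> 1" if "S \<subseteq> {0::'a}" for S using card_mono[OF _ that] by simp
  then have "card S \<le> m" if "S \<subseteq> {0::'a}" "1 \<le> m" for S m using that by (meson order.trans)
  then show ?case by (intro exI[of _ "{0}"]) auto
next
  case (Suc l)
  let ?d = "DIM('a)"
  obtain v where v: "v \<notin> D" "linear_general_position (insert v D)"
    using linear_general_position_insert[OF Suc.prems] by blast
  obtain M where M: "finite M" "card M = 2 ^ l" and
    bd: "\<And>I S. I \<subseteq> insert v D \<Longrightarrow> card I < ?d \<Longrightarrow> S \<subseteq> M \<Longrightarrow> flat_mod I S \<Longrightarrow> card S \<le> 2 ^ (?d - 1 - card I)"
    "\<And>I S. I \<subseteq> insert v D \<Longrightarrow> card I < ?d \<Longrightarrow> S \<subseteq> M \<Longrightarrow> exposed_mod I S \<Longrightarrow> card S \<le> 2 ^ ?d * (l + 1) ^ (?d - 1 - card I)"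
    using Suc.IH[of "insert v D"] Suc.prems(1) v(2) by (auto; blast)
  have "independent {v}"
    by (rule linear_general_positionD[OF v(2)]) auto
  then have v0: "v \<noteq> 0" using dependent_zero by blast
  have fI: "finite I" "card (insert v I) = Suc (card I)" if "I \<subseteq> D" for I
    using that Suc.prems(1) v(1) by (auto intro: finite_subset simp: finite_subset subset_iff card_insert_if)
  \<comment> \<open>Exposed sets in codimension 1 are left out: one more direction would leave no
    functional for the recursion. \<open>exposed_mod_codim1_card_le\<close> settles them at the
    end.\<close>
  define good where "good \<epsilon> I \<sigma> \<longleftrightarrow>
      (flat_mod I (twin v \<epsilon> ` \<sigma>) \<longrightarrow> card \<sigma> \<le> 2 ^ (?d - 1 - card I)) \<and>
      (card I + 1 < ?d \<longrightarrow> exposed_mod I (twin v \<epsilon> ` \<sigma>) \<longrightarrow>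
         card \<sigma> \<le> 2 ^ ?d * (l + 2) ^ (?d - 1 - card I))" for \<epsilon> I \<sigma>
  have "\<forall>\<^sub>F \<epsilon> in at_right 0. good \<epsilon> I \<sigma>"
    if I: "I \<subseteq> D" "card I < ?d" and \<sigma>: "\<sigma> \<subseteq> M \<times> UNIV" for I \<sigma>
  proof -
    have "\<forall>\<^sub>F \<epsilon> in at_right 0. flat_mod I (twin v \<epsilon> ` \<sigma>) \<longrightarrow> card \<sigma> \<le> 2 ^ (?d - 1 - card I)"
    proof (rule flat_mod_twin[OF M(1) \<sigma>])
      fix S assume S: "S \<subseteq> M"
      show "card S \<le> 2 ^ (?d - 1 - card I)" if "flat_mod I S"
        using bd(1)[of I S] I S that by auto
      show "2 * card S \<le> 2 ^ (?d - 1 - card I)" if flat: "flat_mod (insert v I) S"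
      proof (cases "card I + 1 < ?d")
        case True
        then have "card S \<le> 2 ^ (?d - 1 - Suc (card I))"
          using bd(1)[of "insert v I" S] I S flat fI[OF I(1)] by auto
        moreover have "?d - 1 - card I = Suc (?d - 1 - Suc (card I))" using True by linarith
        ultimately show ?thesis by simp
      next
        case False
        \<comment> \<open>Modulo d independent directions no nonzero functional is left, so nothing
          is flat.\<close>
        then have "card (insert v I) = ?d" using I(2) fI[OF I(1)] by simp
        moreover have "independent (insert v I)"
          using I fI[OF I(1)] by (intro linear_general_positionD[OF v(2)]) auto
        ultimately show ?thesis
          using flat orthogonal_to_independent_eq_0[of "insert v I"] by (metis flat_modE order_refl)
      qed
    qed
    moreover have "\<forall>\<^sub>F \<epsilon> in at_right 0. card I + 1 < ?d \<longrightarrow> exposed_mod I (twin v \<epsilon> ` \<sigma>) \<longrightarrow>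
         card \<sigma> \<le> 2 ^ ?d * (l + 2) ^ (?d - 1 - card I)"
    proof (cases "card I + 1 < ?d")
      case True
      define r where "r = ?d - 1 - Suc (card I)"
      have r: "?d - 1 - card I = Suc r" using True by (simp add: r_def)
      let ?B = "2 ^ ?d * (l + 1) ^ Suc r" and ?C = "2 ^ ?d * (l + 1) ^ r"
      have "\<forall>\<^sub>F \<epsilon> in at_right 0. exposed_mod I (twin v \<epsilon> ` \<sigma>) \<longrightarrow> card \<sigma> \<le> ?B + ?C"
      proof (rule exposed_mod_twin[OF M(1) \<sigma>])
        fix S assume S: "S \<subseteq> M"
        show "card S \<le> ?B" if "exposed_mod I S"
          using bd(2)[of I S] I S that unfolding r by auto
        show "card S \<le> ?C" if "exposed_mod (insert v I) S"
          using bd(2)[of "insert v I" S] I S that fI[OF I(1)] True unfolding r_def by auto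
        show "2 * card S \<le> ?B + ?C" if "flat_mod I S"
        proof -
          have "card S \<le> 2 ^ Suc r" using bd(1)[of I S] I S that unfolding r by auto
          also have "\<dots> \<le> 2 ^ ?d" using r by (intro power_increasing) auto
          also have "\<dots> \<le> 2 ^ ?d * (l + 1) ^ r" by simp
          finally have "card S \<le> ?C" .
          moreover have "?C \<le> ?B" by simp
          ultimately show ?thesis by linarith
        qed
      qed
      moreover have "?B + ?C \<le> 2 ^ ?d * (l + 2) ^ Suc r"
      proof -
        have "(l + 1) ^ Suc r + (l + 1) ^ r = (l + 2) * (l + 1) ^ r" by (simp add: algebra_simps)
        also have "\<dots> \<le> (l + 2) * (l + 2) ^ r" by (intro mult_left_mono power_mono) auto
        finally have "(l + 1) ^ Suc r + (l + 1) ^ r \<le> (l + 2) ^ Suc r" by simp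
        then have "2 ^ ?d * ((l + 1) ^ Suc r + (l + 1) ^ r) \<le> 2 ^ ?d * (l + 2) ^ Suc r"
          by (rule mult_left_mono) simp
        then show ?thesis by (simp only: distrib_left)
      qed
      ultimately show ?thesis unfolding r by (auto elim!: eventually_mono)
    qed auto
    ultimately show ?thesis unfolding good_def by eventually_elim blast
  qed
  then have "\<forall>\<^sub>F \<epsilon> in at_right 0. \<forall>(I, \<sigma>)\<in>{I. I \<subseteq> D \<and> card I < ?d} \<times> Pow (M \<times> UNIV). good \<epsilon> I \<sigma>"
    using Suc.prems(1) M(1) by (intro eventually_ball_finite) auto
  moreover have "\<forall>\<^sub>F \<epsilon> in at_right 0. inj_on (twin v \<epsilon>) (M \<times> UNIV)"
  proof -
    have "\<forall>\<^sub>F \<epsilon> in at_right 0. fst i \<noteq> fst j \<longrightarrow> twin v \<epsilon> i - twin v \<epsilon> j \<noteq> 0" for i j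
    proof (cases "fst i = fst j")
      case False
      then have "\<forall>\<^sub>F \<epsilon> in at_right 0. twin v \<epsilon> i - twin v \<epsilon> j \<noteq> 0"
        by (intro tendsto_imp_eventually_ne[OF tendsto_diff[OF twin_tendsto twin_tendsto]]) simp
      then show ?thesis by eventually_elim simp
    qed simp
    then have "\<forall>\<^sub>F \<epsilon> in at_right 0. \<forall>i\<in>M \<times> UNIV. \<forall>j\<in>M \<times> UNIV. fst i \<noteq> fst j \<longrightarrow> twin v \<epsilon> i - twin v \<epsilon> j \<noteq> 0"
      using M(1) by (intro eventually_ball_finite ballI) auto
    moreover have "\<forall>\<^sub>F \<epsilon> in at_right 0. \<epsilon> > (0::real)" by (rule eventually_at_right_less)
    ultimately show ?thesis
    proof eventually_elim
      case (elim \<epsilon>)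
      show ?case
      proof (rule inj_onI)
        fix i j assume ij: "i \<in> M \<times> UNIV" "j \<in> M \<times> UNIV" "twin v \<epsilon> i = twin v \<epsilon> j"
        have "fst i = fst j"
        proof (rule ccontr)
          assume "fst i \<noteq> fst j"
          then have "twin v \<epsilon> i - twin v \<epsilon> j \<noteq> 0" using elim(1) ij(1,2) by blast
          then show False using ij(3) by simp
        qed
        moreover from this have "snd i = snd j"
          using ij(3) elim(2) v0 by (auto simp: twin_def split: if_splits)
        ultimately show "i = j" by (rule prod_eqI)
      qed
    qed
  qed
  ultimately have "\<forall>\<^sub>F \<epsilon> in at_right (0::real). (\<forall>(I, \<sigma>)\<in>{I. I \<subseteq> D \<and> card I < ?d} \<times> Pow (M \<times> UNIV). good \<epsilon> I \<sigma>) \<and>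
     inj_on (twin v \<epsilon>) (M \<times> UNIV)" by eventually_elim blast
  then have "\<exists>\<epsilon>. (\<forall>(I, \<sigma>)\<in>{I. I \<subseteq> D \<and> card I < ?d} \<times> Pow (M \<times> UNIV). good \<epsilon> I \<sigma>) \<and>
     inj_on (twin v \<epsilon>) (M \<times> UNIV)"
    by (rule eventually_happens'[OF trivial_limit_at_right_real])
  then obtain \<epsilon> where \<epsilon>: "\<forall>(I, \<sigma>)\<in>{I. I \<subseteq> D \<and> card I < ?d} \<times> Pow (M \<times> UNIV). good \<epsilon> I \<sigma>"
    and inj: "inj_on (twin v \<epsilon>) (M \<times> UNIV)" by (elim exE conjE)
  have good: "good \<epsilon> I \<sigma>" if "I \<subseteq> D" "card I < ?d" "\<sigma> \<subseteq> M \<times> UNIV" for I \<sigma>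
    using bspec[OF \<epsilon>, of "(I, \<sigma>)"] that by simp
  define M' where "M' = twin v \<epsilon> ` (M \<times> UNIV)"
  have fM': "finite M'" using M(1) by (simp add: M'_def)
  have *: "\<exists>\<sigma>. \<sigma> \<subseteq> M \<times> UNIV \<and> S = twin v \<epsilon> ` \<sigma> \<and> card S \<le> card \<sigma>" if S: "S \<subseteq> M'" for S
  proof -
    obtain \<sigma> where \<sigma>: "\<sigma> \<subseteq> M \<times> UNIV" "S = twin v \<epsilon> ` \<sigma>"
      using S unfolding M'_def by (meson subset_imageE)
    moreover have "finite \<sigma>" using \<sigma>(1) M(1) by (rule_tac finite_subset) auto
    ultimately show ?thesis using card_image_le by blast
  qed
  have flat: "card S \<le> 2 ^ (?d - 1 - card I)"
    if "I \<subseteq> D" "card I < ?d" "S \<subseteq> M'" "flat_mod I S" for I S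
    using *[OF that(3)] good[OF that(1,2)] that(4) unfolding good_def by (metis order.trans)
  have "card S \<le> 2 ^ ?d * (Suc l + 1) ^ (?d - 1 - card I)"
    if I: "I \<subseteq> D" "card I < ?d" and S: "S \<subseteq> M'" "exposed_mod I S" for I S
  proof (cases "card I + 1 < ?d")
    case True
    then show ?thesis using *[OF S(1)] good[OF I] S(2) unfolding good_def
      by (metis order.trans add_2_eq_Suc' add_Suc_right One_nat_def add.right_neutral add_Suc)
  next
    case False
    then have eq: "card I + 1 = ?d" using I(2) by linarith
    have "card S \<le> 2"
    proof (rule exposed_mod_codim1_card_le[OF _ _ eq S(2)])
      show "finite S" using S(1) fM' finite_subset by blast
      show "independent I" using I fI[OF I(1)] by (intro linear_general_positionD[OF Suc.prems(2)]) auto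
      show "card T \<le> 1" if "T \<subseteq> S" "flat_mod I T" for T
        using flat[of I T] I S(1) that eq by auto
    qed
    also have "2 \<le> (2::nat) ^ ?d" using DIM_positive[where 'a='a] by (cases ?d) auto
    finally have "card S \<le> 2 ^ ?d" .
    moreover have "?d - 1 - card I = 0" using eq by simp
    ultimately show ?thesis by simp
  qed
  moreover have "card M' = 2 ^ Suc l"
    unfolding M'_def card_image[OF inj] by (simp add: card_cartesian_product M(2))
  ultimately show ?case using fM' flat by (intro exI[of _ M']) auto
qed

section \<open>Configurations and their separated pairs\<close>

text \<open>Hereditary form of general position that speaks about all small subsets, whatever the
  size of \<open>X\<close>; it can therefore be maintained while points are added one at a
  time.\<close>

definition affine_general_position :: "'a::euclidean_space set \<Rightarrow> bool" where
  "affine_general_position X \<longleftrightarrow>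
     (\<forall>S\<subseteq>X. finite S \<and> card S \<le> DIM('a) + 1 \<longrightarrow> \<not> affine_dependent S)"

lemma affine_general_position_imp_general_position:
  fixes X :: "'a::euclidean_space set"
  assumes "affine_general_position X"
  shows "general_position X"
  unfolding general_position_def
proof (intro conjI allI impI notI)
  fix S assume S: "S \<subseteq> X" "card S = DIM('a) + 1"
    and "\<exists>H. affine H \<and> aff_dim H = int DIM('a) - 1 \<and> S \<subseteq> H"
  then obtain H where "aff_dim H = int DIM('a) - 1" "S \<subseteq> H" by blast
  then have "aff_dim S \<le> int DIM('a) - 1" using aff_dim_subset by metis
  moreover have "finite S" using S(2) by (metis add_is_0 card.infinite one_neq_zero)
  then have "\<not> affine_dependent S" using assms S by (simp add: affine_general_position_def)
  then have "int (card S) = aff_dim S + 1" by (rule aff_dim_affine_independent)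
  ultimately show False using S(2) by simp
next
  assume "finite X \<and> card X \<le> DIM('a)" "affine_dependent X"
  then show False using assms by (simp add: affine_general_position_def)
qed

lemma affine_general_position_insert:
  fixes Y :: "'a::euclidean_space set"
  assumes fin: "finite Y" and Y: "affine_general_position Y" and O: "open O'" "O' \<noteq> {}"
  shows "\<exists>x\<in>O'. x \<notin> Y \<and> affine_general_position (insert x Y)"
proof -
  let ?\<A> = "{S. S \<subseteq> Y \<and> card S \<le> DIM('a)}"
  have "aff_dim S < int DIM('a)" if "S \<in> ?\<A>" for S
  proof -
    have "finite S" using that finite_subset[OF _ fin] by blast
    then have "aff_dim S \<le> int (card S) - 1" by (rule aff_dim_le_card)
    moreover have "card S \<le> DIM('a)" using that by blast
    ultimately show ?thesis by linarith
  qed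
  moreover have "finite ?\<A>" using fin by simp
  ultimately have "\<exists>x\<in>O'. \<forall>A\<in>?\<A>. x \<notin> affine hull A"
    by (intro ex_not_in_Union_lowdim O)
  then obtain x where x: "x \<in> O'" "\<forall>A\<in>?\<A>. x \<notin> affine hull A" by (elim bexE)
  have "x \<notin> Y"
  proof
    assume "x \<in> Y"
    then have "{x} \<in> ?\<A>" using DIM_positive[where 'a='a] by (simp add: Suc_leI)
    then have "x \<notin> affine hull {x}" by (rule bspec[OF x(2)])
    then show False by (simp add: hull_inc)
  qed
  moreover have "affine_general_position (insert x Y)"
    unfolding affine_general_position_def
  proof (intro allI impI)
    fix S assume S: "S \<subseteq> insert x Y" "finite S \<and> card S \<le> DIM('a) + 1"
    show "\<not> affine_dependent S"
    proof (cases "x \<in> S")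
      case True
      let ?S = "S - {x}"
      have sub: "?S \<subseteq> Y" "card ?S \<le> DIM('a)" using S True by auto
      then have "\<not> affine_dependent ?S"
        using Y S(2) by (simp add: affine_general_position_def)
      moreover have "x \<notin> affine hull ?S" using x(2) sub by blast
      ultimately have "\<not> affine_dependent (insert x ?S)"
        by (rule affine_independent_insert)
      then show ?thesis using True by (simp add: insert_absorb)
    next
      case False
      then have "S \<subseteq> Y" using S(1) by blast
      then show ?thesis using Y S(2) by (simp add: affine_general_position_def)
    qed
  qed
  ultimately show ?thesis using x(1) by blast
qed

lemma affine_general_position_empty: "affine_general_position {}"
  by (simp add: affine_general_position_def affine_dependent_def)

lemma affine_general_position_extend:
  fixes Y :: "'a::euclidean_space set"
  assumes "finite Y" "affine_general_position Y"
  shows "\<exists>X. finite X \<and> Y \<subseteq> X \<and> card X = card Y + m \<and> affine_general_position X"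
proof (induction m)
  case 0
  then show ?case using assms by (intro exI[of _ Y]) auto
next
  case (Suc m)
  then obtain X where X: "finite X" "Y \<subseteq> X" "card X = card Y + m" "affine_general_position X" by blast
  obtain x where "x \<notin> X" "affine_general_position (insert x X)"
    using affine_general_position_insert[OF X(1,4) open_UNIV] by blast
  then have "finite (insert x X) \<and> Y \<subseteq> insert x X \<and> card (insert x X) = card Y + Suc m \<and>
      affine_general_position (insert x X)"
    using X(1-3) by (simp add: subset_insertI2)
  then show ?case by (rule exI)
qed

lemma affine_general_position_perturb:
  fixes c :: "'i \<Rightarrow> 'a::euclidean_space"
  assumes "finite \<iota>" and \<delta>: "\<delta> > 0"
  shows "\<exists>c'. (\<forall>i\<in>\<iota>. dist (c' i) (c i) < \<delta>) \<and> inj_on c' \<iota> \<and> affine_general_position (c' ` \<iota>)"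
  using assms(1)
proof induction
  case empty
  then show ?case by (simp add: affine_general_position_empty)
next
  case (insert i \<iota>)
  then obtain c' where c': "\<forall>i\<in>\<iota>. dist (c' i) (c i) < \<delta>" "inj_on c' \<iota>" "affine_general_position (c' ` \<iota>)"
    by blast
  obtain x where x: "x \<in> ball (c i) \<delta>" "x \<notin> c' ` \<iota>" "affine_general_position (insert x (c' ` \<iota>))"
    using affine_general_position_insert[of "c' ` \<iota>" "ball (c i) \<delta>"] insert.hyps(1) c'(3) \<delta> by auto
  let ?c = "c'(i := x)"
  have agree: "\<And>j. j \<in> \<iota> \<Longrightarrow> ?c j = c' j" using insert.hyps(2) by auto
  then have im: "?c ` insert i \<iota> = insert x (c' ` \<iota>)" by force
  have "inj_on ?c (insert i \<iota>)"
    using c'(2) x(2) insert.hyps(2) agree inj_on_cong[of \<iota> ?c c'] by auto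
  moreover have "\<forall>j\<in>insert i \<iota>. dist (?c j) (c j) < \<delta>"
    using c'(1) x(1) by (simp add: dist_commute)
  ultimately show ?case using x(3) unfolding im[symmetric] by blast
qed

section \<open>Traces of convex sets and double counting of separated pairs\<close>

definition cut_off :: "('i \<Rightarrow> 'a::euclidean_space) \<Rightarrow> 'a set \<Rightarrow> 'i set \<Rightarrow> 'i set \<Rightarrow> 'i set \<Rightarrow> bool" where
  "cut_off c Z U A B \<longleftrightarrow> A \<subseteq> U \<and> (\<exists>b\<in>B - U. in_halfspace Z ((\<lambda>a. c a - c b) ` U))"

text \<open>\<open>U\<close> plays the trace of a convex set on the configuration \<open>c\<close>. Separation is weakened from
  non-membership in the convex hull to the existence of a supporting functional, which is a closed
  condition and hence survives small perturbations of \<open>c\<close>. The functionals are required to vanish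
  on \<open>Z\<close>, i.e. the configuration is considered modulo \<open>Z\<close>.\<close>

definition separations_bounded ::
  "('i \<Rightarrow> 'a::euclidean_space) \<Rightarrow> 'a set \<Rightarrow> 'i set \<Rightarrow> 'e set \<Rightarrow> ('e \<Rightarrow> 'i set) \<Rightarrow> ('e \<Rightarrow> 'i set) \<Rightarrow> nat \<Rightarrow> bool"
  where "separations_bounded c Z \<iota> E A B s \<longleftrightarrow>
    (\<forall>U\<subseteq>\<iota>. card {e\<in>E. cut_off c Z U (A e) (B e) \<or> cut_off c Z U (B e) (A e)} \<le> s)"

lemma separations_bounded_transfer:
  assumes bd: "separations_bounded c Z \<iota> E A B s" and E: "finite E"
    and sub: "\<And>e. e \<in> E \<Longrightarrow> A e \<subseteq> \<iota> \<and> B e \<subseteq> \<iota>"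
    and tr: "\<And>U b. U \<subseteq> \<iota> \<Longrightarrow> b \<in> \<iota> \<Longrightarrow> in_halfspace Z' ((\<lambda>a. c' a - c' b) ` U) \<Longrightarrow>
                in_halfspace Z ((\<lambda>a. c a - c b) ` U)"
  shows "separations_bounded c' Z' \<iota> E A B s"
  unfolding separations_bounded_def
proof (intro allI impI)
  fix U assume U: "U \<subseteq> \<iota>"
  have "card {e\<in>E. cut_off c' Z' U (A e) (B e) \<or> cut_off c' Z' U (B e) (A e)}
      \<le> card {e\<in>E. cut_off c Z U (A e) (B e) \<or> cut_off c Z U (B e) (A e)}"
    using E sub tr[OF U] by (intro card_mono) (fastforce simp: cut_off_def)+
  then show "card {e\<in>E. cut_off c' Z' U (A e) (B e) \<or> cut_off c' Z' U (B e) (A e)} \<le> s"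
    using bd U unfolding separations_bounded_def by (meson order.trans)
qed

text \<open>There are only finitely many pairs (U, b), so closedness for each of them gives one
  range of parameters that serves all.\<close>

lemma eventually_subset_transfer:
  assumes \<iota>: "finite \<iota>"
    and ev: "\<And>U b. U \<subseteq> \<iota> \<Longrightarrow> b \<in> \<iota> \<Longrightarrow> \<not> Q U b \<Longrightarrow> \<forall>\<^sub>F p in F. \<not> R p U b"
  shows "\<forall>\<^sub>F p in F. \<forall>U b. U \<subseteq> \<iota> \<longrightarrow> b \<in> \<iota> \<longrightarrow> R p U b \<longrightarrow> Q U b"
proof -
  have "\<forall>\<^sub>F p in F. R p U b \<longrightarrow> Q U b" if "U \<in> Pow \<iota>" "b \<in> \<iota>" for U b
  proof (cases "Q U b")
    case False
    then have "\<forall>\<^sub>F p in F. \<not> R p U b" using ev that by blast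
    then show ?thesis by eventually_elim simp
  qed simp
  then have "\<forall>\<^sub>F p in F. \<forall>U\<in>Pow \<iota>. \<forall>b\<in>\<iota>. R p U b \<longrightarrow> Q U b"
    using \<iota> by (intro eventually_ball_finite ballI) auto
  then show ?thesis by eventually_elim blast
qed

text \<open>Being cut off is a closed condition, so configurations close enough to the limit have no
  separations that the limit does not have.\<close>

lemma eventually_separations_bounded:
  fixes c :: "'i \<Rightarrow> 'a::euclidean_space" and c' :: "'p \<Rightarrow> 'i \<Rightarrow> 'a"
  assumes \<iota>: "finite \<iota>" and E: "finite E" and sub: "\<And>e. e \<in> E \<Longrightarrow> A e \<subseteq> \<iota> \<and> B e \<subseteq> \<iota>"
    and bd: "separations_bounded c Z \<iota> E A B s"
    and lim: "\<And>i. i \<in> \<iota> \<Longrightarrow> ((\<lambda>p. c' p i) \<longlongrightarrow> c i) F"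
  shows "\<forall>\<^sub>F p in F. separations_bounded (c' p) Z \<iota> E A B s"
proof -
  have "\<forall>\<^sub>F p in F. \<not> in_halfspace Z ((\<lambda>a. c' p a - c' p b) ` U)"
    if "U \<subseteq> \<iota>" "b \<in> \<iota>" "\<not> in_halfspace Z ((\<lambda>a. c a - c b) ` U)" for U b
    by (rule eventually_not_in_halfspace[OF finite_subset[OF that(1) \<iota>] _ that(3)])
      (use that in \<open>auto intro!: tendsto_diff lim\<close>)
  then have "\<forall>\<^sub>F p in F. \<forall>U b. U \<subseteq> \<iota> \<longrightarrow> b \<in> \<iota> \<longrightarrow> in_halfspace Z ((\<lambda>a. c' p a - c' p b) ` U) \<longrightarrow>
      in_halfspace Z ((\<lambda>a. c a - c b) ` U)"
    by (intro eventually_subset_transfer[OF \<iota>])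
  then show ?thesis
    by eventually_elim (use separations_bounded_transfer[OF bd E sub] in blast)
qed

lemma convex_trace_in_halfspace:
  fixes c :: "'i \<Rightarrow> 'a::euclidean_space"
  assumes F: "convex F" and b: "c b \<notin> F" and U: "c ` U \<subseteq> F"
  shows "in_halfspace {} ((\<lambda>a. c a - c b) ` U)"
proof (cases "U = {}")
  case True
  obtain e :: 'a where "e \<in> Basis" using nonempty_Basis by blast
  then show ?thesis using True by (intro in_halfspaceI[of e]) auto
next
  case False
  then have "F \<noteq> {}" using U by auto
  then obtain a t where "a \<noteq> 0" "\<forall>x\<in>F. a \<bullet> x \<le> t" "\<forall>x\<in>{c b}. a \<bullet> x \<ge> t"
    using separating_hyperplane_sets[of F "{c b}"] F b by auto
  then show ?thesis using U
    by (intro in_halfspaceI[of a]) (force simp: inner_diff_right)+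
qed

text \<open>Double counting after a perturbation into general position: every pair in
  \<open>E\<close> needs a member of the separator, and the trace of a member on the configuration
  separates at most \<open>s\<close> pairs. Injectivity of the perturbation keeps the two sets of
  each pair distinct.\<close>

lemma separator_card_lower:
  fixes c :: "'i \<Rightarrow> 'a::euclidean_space"
  assumes \<iota>: "finite \<iota>" "card \<iota> \<le> n" and E: "finite E"
    and AB: "\<And>e. e \<in> E \<Longrightarrow> A e \<subseteq> \<iota> \<and> B e \<subseteq> \<iota> \<and> card (A e) = k \<and> card (B e) = k \<and> A e \<noteq> B e"
    and bd: "separations_bounded c {} \<iota> E A B s"
  shows "\<exists>X::'a set. finite X \<and> card X = n \<and> general_position X \<and>
    (\<forall>\<F>. finite \<F> \<and> (\<forall>F\<in>\<F>. convex F) \<and> containment_separator k X \<F> \<longrightarrow> card E \<le> s * card \<F>)"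
proof -
  have "\<exists>c'. (\<forall>i\<in>\<iota>. dist (c' i) (c i) < inverse (real (Suc p))) \<and> inj_on c' \<iota> \<and> affine_general_position (c' ` \<iota>)" for p
    by (rule affine_general_position_perturb[OF \<iota>(1)]) simp
  then obtain c' where c': "\<And>p i. i \<in> \<iota> \<Longrightarrow> dist (c' p i) (c i) < inverse (real (Suc p))"
    "\<And>p. inj_on (c' p) \<iota>" "\<And>p. affine_general_position (c' p ` \<iota>)"
    by metis
  have "(\<lambda>p. c' p i) \<longlonglongrightarrow> c i" if "i \<in> \<iota>" for i
    by (rule metric_tendsto_imp_tendsto[OF LIMSEQ_inverse_real_of_nat])
      (use c'(1)[OF that] in \<open>auto intro!: always_eventually less_imp_le simp: dist_norm[of _ 0]\<close>)
  then have "\<forall>\<^sub>F p in sequentially. separations_bounded (c' p) {} \<iota> E A B s"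
    using AB by (intro eventually_separations_bounded[OF \<iota>(1) E _ bd]) auto
  then obtain p where p: "separations_bounded (c' p) {} \<iota> E A B s"
    by (meson eventually_happens' sequentially_bot)
  define g where "g = c' p"
  have g: "inj_on g \<iota>" "affine_general_position (g ` \<iota>)" "separations_bounded g {} \<iota> E A B s"
    using c' p by (auto simp: g_def)
  \<comment> \<open>The additional points lie outside the configuration and only raise the number of
    points to \<open>n\<close>.\<close>
  obtain X where X: "finite X" "g ` \<iota> \<subseteq> X" "card X = card (g ` \<iota>) + (n - card \<iota>)" "affine_general_position X"
    using affine_general_position_extend[OF _ g(2)] \<iota>(1) by blast
  have "card X = n" using X(3) \<iota>(2) card_image[OF g(1)] by simp
  moreover have "card E \<le> s * card \<F>"
    if \<F>: "finite \<F>" "\<forall>F\<in>\<F>. convex F" "containment_separator k X \<F>" for \<F>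
  proof -
    define S where "S F = {e\<in>E. containment_separates F (g ` A e) (g ` B e)}" for F
    have S_le: "card (S F) \<le> s" if F: "F \<in> \<F>" for F
    proof -
      define U where "U = {i\<in>\<iota>. g i \<in> F}"
      have cut: "cut_off g {} U A' B'"
        if A': "A' \<subseteq> \<iota>" "g ` A' \<subseteq> F" and B': "\<not> g ` B' \<subseteq> F" for A' B'
      proof -
        obtain b where b: "b \<in> B'" "g b \<notin> F" using B' by blast
        have "g ` U \<subseteq> F" by (auto simp: U_def)
        then have "in_halfspace {} ((\<lambda>a. g a - g b) ` U)"
          using F \<F>(2) b(2) by (intro convex_trace_in_halfspace[of F]) auto
        then show ?thesis using A' b unfolding cut_off_def U_def by blast
      qed
      have "S F \<subseteq> {e\<in>E. cut_off g {} U (A e) (B e) \<or> cut_off g {} U (B e) (A e)}"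
      proof
        fix e assume "e \<in> S F"
        then have e: "e \<in> E" "containment_separates F (g ` A e) (g ` B e)" by (simp_all add: S_def)
        then have "cut_off g {} U (A e) (B e) \<or> cut_off g {} U (B e) (A e)"
          using cut[of "A e" "B e"] cut[of "B e" "A e"] AB[OF e(1)] by (auto simp: containment_separates_def)
        then show "e \<in> {e\<in>E. cut_off g {} U (A e) (B e) \<or> cut_off g {} U (B e) (A e)}" using e(1) by simp
      qed
      then have "card (S F) \<le> card {e\<in>E. cut_off g {} U (A e) (B e) \<or> cut_off g {} U (B e) (A e)}"
        by (rule card_mono[rotated]) (simp add: E)
      also have "U \<subseteq> \<iota>" by (auto simp: U_def)
      then have "card {e\<in>E. cut_off g {} U (A e) (B e) \<or> cut_off g {} U (B e) (A e)} \<le> s"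
        using g(3) unfolding separations_bounded_def by blast
      finally show ?thesis .
    qed
    have "E \<subseteq> (\<Union>F\<in>\<F>. S F)"
    proof
      fix e assume e: "e \<in> E"
      have "card (g ` A e) = k" "card (g ` B e) = k" "g ` A e \<noteq> g ` B e"
        using AB[OF e] g(1) by (simp_all add: card_image inj_on_subset inj_on_image_eq_iff)
      moreover have "g ` A e \<subseteq> X" "g ` B e \<subseteq> X" using AB[OF e] X(2) by blast+
      ultimately obtain F where "F \<in> \<F>" "containment_separates F (g ` A e) (g ` B e)"
        using \<F>(3) unfolding containment_separator_def by blast
      then show "e \<in> (\<Union>F\<in>\<F>. S F)" using e by (auto simp: S_def)
    qed
    then have "card E \<le> card (\<Union>F\<in>\<F>. S F)"
      using E \<F>(1) by (intro card_mono) (auto simp: S_def)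
    also have "\<dots> \<le> (\<Sum>F\<in>\<F>. card (S F))" using \<F>(1) by (rule card_UN_le)
    also have "\<dots> \<le> (\<Sum>F\<in>\<F>. s)" by (intro sum_mono S_le)
    finally show ?thesis by (simp add: mult.commute)
  qed
  ultimately show ?thesis
    using X(1,4) affine_general_position_imp_general_position by blast
qed

section \<open>Lifting to a paraboloid\<close>

definition proj :: "'a::euclidean_space \<Rightarrow> 'a \<Rightarrow> 'a" where
  "proj u x = x - (x \<bullet> u) *\<^sub>R u"

definition lift :: "'a::euclidean_space \<Rightarrow> 'a \<Rightarrow> 'a" where
  "lift u x = proj u x + (norm (proj u x))\<^sup>2 *\<^sub>R u"

text \<open>Write x_a for the projection of \<open>c a\<close>. Since |x_a|^2 - |x_b|^2 = 2 x_b
  \<bullet> (x_a - x_b) + |x_a - x_b|^2, the functional \<beta> is \<alpha> with the paraboloid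
  replaced by its tangent hyperplane at b. The error is t |x_a - x_b|^2, and the point in direction
  \<open>- u\<close> makes t \<ge> 0, which is the favourable sign.\<close>

lemma in_halfspace_lift:
  fixes c :: "'i \<Rightarrow> 'a::euclidean_space"
  assumes u: "norm u = 1" and dim: "2 \<le> DIM('a)"
    and h: "in_halfspace {} (insert (- u) ((\<lambda>a. lift u (c a) - lift u (c b)) ` U))"
  shows "in_halfspace {u} ((\<lambda>a. c a - c b) ` U)"
proof -
  have uu: "u \<bullet> u = 1" using u by (simp add: norm_eq_1)
  let ?x = "\<lambda>a. proj u (c a)"
  have px': "proj u y \<bullet> u = 0" for y by (simp add: proj_def inner_diff_left uu)
  then have px: "u \<bullet> proj u y = 0" for y by (subst inner_commute)
  obtain \<alpha> where \<alpha>: "\<alpha> \<noteq> 0" "\<alpha> \<bullet> (- u) \<le> 0" "\<And>a. a \<in> U \<Longrightarrow> \<alpha> \<bullet> (lift u (c a) - lift u (c b)) \<le> 0"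
    using h unfolding in_halfspace_def by auto
  define t where "t = \<alpha> \<bullet> u"
  have t: "t \<ge> 0" using \<alpha>(2) by (simp add: t_def)
  define \<beta> where "\<beta> = \<alpha> - t *\<^sub>R u + (2 * t) *\<^sub>R ?x b"
  have \<beta>u: "\<beta> \<bullet> u = 0"
    by (simp add: \<beta>_def inner_add_left inner_diff_left uu t_def px')
  have dec: "\<gamma> \<bullet> (c a - c b) = \<gamma> \<bullet> (?x a - ?x b)" if "\<gamma> \<bullet> u = 0" for \<gamma> a
    using that by (simp add: proj_def inner_diff_right inner_diff_left)
  have eq: "\<beta> \<bullet> (c a - c b) = \<alpha> \<bullet> (lift u (c a) - lift u (c b)) - t * (norm (?x a - ?x b))\<^sup>2" for a
  proof -
    have "\<beta> \<bullet> (c a - c b) = \<alpha> \<bullet> (?x a - ?x b) + 2 * t * (?x b \<bullet> (?x a - ?x b))"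
      unfolding dec[OF \<beta>u] using px by (simp add: \<beta>_def inner_add_left inner_diff_left inner_diff_right right_diff_distrib)
    also have "\<dots> = \<alpha> \<bullet> (lift u (c a) - lift u (c b)) - t * (norm (?x a - ?x b))\<^sup>2"
      by (simp add: lift_def t_def power2_norm_eq_inner inner_add_right inner_diff_right inner_diff_left
          inner_commute algebra_simps)
    finally show ?thesis .
  qed
  show ?thesis
  proof (cases "\<beta> = 0")
    case False
    have "\<beta> \<bullet> (c a - c b) \<le> 0" if "a \<in> U" for a
    proof -
      have "t * (norm (?x a - ?x b))\<^sup>2 \<ge> 0" using t by simp
      then show ?thesis using eq[of a] \<alpha>(3)[OF that] by linarith
    qed
    then show ?thesis using False \<beta>u by (intro in_halfspaceI[of \<beta>]) auto
  next
    case True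
    \<comment> \<open>If \<beta> vanishes, the error term forces all points of \<open>U\<close> to
      have the same projection as b. Then any nonzero functional orthogonal to u will do, and one
      exists because the dimension is at least 2.\<close>
    have "t \<noteq> 0" using True \<alpha>(1) by (auto simp: \<beta>_def)
    then have tpos: "t > 0" using t by simp
    have x: "?x a = ?x b" if "a \<in> U" for a
    proof -
      have "t * (norm (?x a - ?x b))\<^sup>2 \<le> 0" using eq[of a] \<alpha>(3)[OF that] True by simp
      then show ?thesis using tpos by (simp add: mult_le_0_iff)
    qed
    obtain y where y: "y \<noteq> 0" "orthogonal u y" using orthogonal_to_vector_exists[OF dim] by blast
    then have yu: "y \<bullet> u = 0" by (simp add: orthogonal_def inner_commute)
    show ?thesis using y(1) yu x dec[OF yu] by (intro in_halfspaceI[of y]) auto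
  qed
qed

text \<open>Lifting to a paraboloid with apex direction \<open>u\<close> and adding a point far away in direction
  \<open>-u\<close>: a convex set containing that point cuts the lifted points like a convex set of the
  projection along \<open>u\<close>.\<close>

lemma separations_bounded_lift:
  fixes c :: "'i \<Rightarrow> 'a::euclidean_space"
  assumes u: "norm u = 1" and dim: "2 \<le> DIM('a)" and \<iota>: "finite \<iota>" and E: "finite E"
    and sub: "\<And>e. e \<in> E \<Longrightarrow> A e \<subseteq> \<iota> \<and> B e \<subseteq> \<iota>"
    and bd: "separations_bounded c {u} \<iota> E A B s"
  shows "\<exists>c' :: 'i option \<Rightarrow> 'a. separations_bounded c' {} (insert None (Some ` \<iota>)) E
           (\<lambda>e. insert None (Some ` A e)) (\<lambda>e. insert None (Some ` B e)) s"
proof -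
  define c' where "c' \<rho> = case_option (- (1 / \<rho>) *\<^sub>R u) (\<lambda>i. lift u (c i))" for \<rho>
  define h where "h \<rho> U b = (\<lambda>a. c' \<rho> a - c' \<rho> (Some b)) ` insert None (Some ` U)" for \<rho> U b
  have "\<forall>\<^sub>F \<rho> in at_right 0. \<not> in_halfspace {} (h \<rho> U b)"
    if U: "U \<subseteq> \<iota>" "b \<in> \<iota>" and not: "\<not> in_halfspace {u} ((\<lambda>a. c a - c b) ` U)" for U b
  proof -
    \<comment> \<open>The vector towards the distant point is multiplied by \<rho>: this keeps its
      sign under every functional and makes it converge, to \<open>- u\<close>.\<close>
    define w where "w \<rho> = case_option (- u - \<rho> *\<^sub>R lift u (c b)) (\<lambda>i. lift u (c i) - lift u (c b))" for \<rho> :: real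
    have "\<forall>\<^sub>F \<rho> in at_right 0. \<not> in_halfspace {} (w \<rho> ` insert None (Some ` U))"
    proof (rule eventually_not_in_halfspace[where w="w 0"])
      show "finite (insert None (Some ` U))" using finite_subset[OF U(1) \<iota>] by simp
      have "((\<lambda>\<rho>. - u - \<rho> *\<^sub>R lift u (c b)) \<longlongrightarrow> - u - 0 *\<^sub>R lift u (c b)) (at_right 0)"
        by (intro tendsto_intros)
      then show "((\<lambda>\<rho>. w \<rho> i) \<longlongrightarrow> w 0 i) (at_right 0)" for i by (cases i) (auto simp: w_def)
      show "\<not> in_halfspace {} (w 0 ` insert None (Some ` U))"
        using not in_halfspace_lift[OF u dim, of c b U] by (auto simp: w_def image_image)
    qed
    moreover have "\<forall>\<^sub>F \<rho> in at_right 0. \<rho> > (0::real)" by (rule eventually_at_right_less)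
    ultimately show ?thesis
    proof eventually_elim
      case (elim \<rho>)
      show ?case
      proof
        assume "in_halfspace {} (h \<rho> U b)"
        then obtain \<alpha> where \<alpha>: "\<alpha> \<noteq> 0" "\<alpha> \<bullet> (- (1 / \<rho>) *\<^sub>R u - lift u (c b)) \<le> 0"
          "\<And>a. a \<in> U \<Longrightarrow> \<alpha> \<bullet> (lift u (c a) - lift u (c b)) \<le> 0"
          unfolding h_def in_halfspace_def by (auto simp: c'_def)
        have "\<rho> * (\<alpha> \<bullet> (- (1 / \<rho>) *\<^sub>R u - lift u (c b))) \<le> 0"
          using \<alpha>(2) elim(2) by (simp add: mult_le_0_iff)
        then have "\<alpha> \<bullet> w \<rho> None \<le> 0"
          using elim(2) by (simp add: w_def inner_diff_right algebra_simps)
        then have "in_halfspace {} (w \<rho> ` insert None (Some ` U))"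
          using \<alpha> by (intro in_halfspaceI[of \<alpha>]) (auto simp: w_def)
        then show False using elim(1) by blast
      qed
    qed
  qed
  then have "\<forall>\<^sub>F \<rho> in at_right 0. \<forall>U b. U \<subseteq> \<iota> \<longrightarrow> b \<in> \<iota> \<longrightarrow> in_halfspace {} (h \<rho> U b) \<longrightarrow>
      in_halfspace {u} ((\<lambda>a. c a - c b) ` U)"
    by (rule eventually_subset_transfer[OF \<iota>])
  then obtain \<rho> :: real where \<rho>: "\<And>U b. U \<subseteq> \<iota> \<Longrightarrow> b \<in> \<iota> \<Longrightarrow> in_halfspace {} (h \<rho> U b) \<Longrightarrow>
      in_halfspace {u} ((\<lambda>a. c a - c b) ` U)"
    using eventually_happens'[OF trivial_limit_at_right_real] by blast
  have cut: "cut_off c {u} (Some -` U) A' B'"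
    if U: "U \<subseteq> insert None (Some ` \<iota>)" "B' \<subseteq> \<iota>"
    and cut: "cut_off (c' \<rho>) {} U (insert None (Some ` A')) (insert None (Some ` B'))" for U A' B'
  proof -
    have N: "None \<in> U" "Some ` A' \<subseteq> U" using cut by (auto simp: cut_off_def)
    then obtain b where b: "b \<in> B'" "Some b \<notin> U" "in_halfspace {} ((\<lambda>a. c' \<rho> a - c' \<rho> (Some b)) ` U)"
      using cut by (auto simp: cut_off_def)
    have "U = insert None (Some ` (Some -` U))"
    proof
      show "U \<subseteq> insert None (Some ` (Some -` U))"
      proof
        fix x assume "x \<in> U"
        then show "x \<in> insert None (Some ` (Some -` U))" by (cases x) auto
      qed
    qed (use N in auto)
    then have "in_halfspace {} (h \<rho> (Some -` U) b)" using b(3) by (simp add: h_def)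
    moreover have "Some -` U \<subseteq> \<iota>" using U(1) by auto
    ultimately have "in_halfspace {u} ((\<lambda>a. c a - c b) ` (Some -` U))"
      using \<rho> U(2) b(1) by blast
    then show ?thesis using b(1,2) N unfolding cut_off_def by blast
  qed
  have "separations_bounded (c' \<rho>) {} (insert None (Some ` \<iota>)) E
          (\<lambda>e. insert None (Some ` A e)) (\<lambda>e. insert None (Some ` B e)) s"
    unfolding separations_bounded_def
  proof (intro allI impI)
    fix U assume U: "U \<subseteq> insert None (Some ` \<iota>)"
    let ?U = "Some -` U"
    have "{e \<in> E. cut_off (c' \<rho>) {} U (insert None (Some ` A e)) (insert None (Some ` B e)) \<or>
                 cut_off (c' \<rho>) {} U (insert None (Some ` B e)) (insert None (Some ` A e))}
      \<subseteq> {e \<in> E. cut_off c {u} ?U (A e) (B e) \<or> cut_off c {u} ?U (B e) (A e)}" (is "?L \<subseteq> ?R")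
    proof
      fix e assume e: "e \<in> ?L"
      then have "A e \<subseteq> \<iota>" "B e \<subseteq> \<iota>" using sub by auto
      then show "e \<in> ?R" using e cut[OF U] by blast
    qed
    then have "card ?L \<le> card ?R" by (rule card_mono[rotated]) (simp add: E)
    also have "?U \<subseteq> \<iota>" using U by auto
    then have "card ?R \<le> s" using bd unfolding separations_bounded_def by blast
    finally show "card ?L \<le> s" .
  qed
  then show ?thesis by (rule exI[of _ "c' \<rho>"])
qed

text \<open>As \<open>\<rho>\<close> tends to \<open>0\<close>, a functional bounded on both \<open>g / \<rho>\<close> and \<open>- g / \<rho>\<close> is forced to vanish on \<open>g\<close>,
  and since \<open>0\<close> lies between them it cannot be negative at the exposed point.\<close>

definition pair_config :: "('p \<Rightarrow> 'a::euclidean_space) \<Rightarrow> real \<Rightarrow> 'p + 'a \<times> bool \<Rightarrow> 'a" where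
  "pair_config x \<rho> = case_sum x (\<lambda>(g, b). (if b then 1 / \<rho> else - (1 / \<rho>)) *\<^sub>R g)"

definition full_pairs :: "('p + 'a \<times> bool) set \<Rightarrow> 'a set" where
  "full_pairs U = {g. Inr (g, True) \<in> U \<and> Inr (g, False) \<in> U}"

lemma pair_config_limit:
  fixes x :: "'p \<Rightarrow> 'a::euclidean_space"
  assumes \<iota>: "finite \<iota>"
  shows "\<forall>\<^sub>F \<rho> in at_right 0. \<forall>U p. U \<subseteq> \<iota> \<longrightarrow> Inl p \<in> \<iota> \<longrightarrow>
    in_halfspace Z ((\<lambda>i. pair_config x \<rho> i - x p) ` U) \<longrightarrow>
    (\<exists>a. a \<noteq> 0 \<and> (\<forall>w\<in>Z. a \<bullet> w = 0) \<and> (\<forall>q. Inl q \<in> U \<longrightarrow> a \<bullet> x q \<le> a \<bullet> x p) \<and>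
         (\<forall>g\<in>full_pairs U. a \<bullet> g = 0 \<and> a \<bullet> x p \<ge> 0))"
proof -
  define Q where "Q U p \<longleftrightarrow> (\<exists>a. a \<noteq> 0 \<and> (\<forall>w\<in>Z. a \<bullet> w = 0) \<and> (\<forall>q. Inl q \<in> U \<longrightarrow> a \<bullet> x q \<le> a \<bullet> x p) \<and>
         (\<forall>g\<in>full_pairs U. a \<bullet> g = 0 \<and> a \<bullet> x p \<ge> 0))" for U p
  have "\<forall>\<^sub>F \<rho> in at_right 0. \<forall>U b. U \<subseteq> \<iota> \<longrightarrow> b \<in> \<iota> \<longrightarrow>
     in_halfspace Z ((\<lambda>i. pair_config x \<rho> i - x (projl b)) ` U) \<longrightarrow> Q U (projl b)"
  proof (rule eventually_subset_transfer[OF \<iota>])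
    fix U b assume U: "U \<subseteq> \<iota>" and not: "\<not> Q U (projl b)"
    define p where "p = projl b"
    \<comment> \<open>Far vectors are rescaled by \<rho>, so their limits are g and -g and only give
      a \<bullet> g = 0. The sign of a \<bullet> x p follows for \<rho> > 0 by adding the
      inequalities for g and -g, but it is lost in the limit; the index \<open>None\<close>,
      standing for \<open>- x p\<close>, records it.\<close>
    define J where "J = Some ` U \<union> (if full_pairs U = {} then {} else {None})"
    define w where "w \<rho> = case_option (- x p) (case_sum (\<lambda>q. x q - x p)
        (\<lambda>(g, b). (if b then g else - g) - \<rho> *\<^sub>R x p))" for \<rho> :: real
    have "\<forall>\<^sub>F \<rho> in at_right 0. \<not> in_halfspace Z (w \<rho> ` J)"
    proof (rule eventually_not_in_halfspace[where w="w 0"])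
      show "finite J" using finite_subset[OF U \<iota>] by (simp add: J_def)
      show "((\<lambda>\<rho>. w \<rho> i) \<longlongrightarrow> w 0 i) (at_right 0)" for i
      proof -
        have "((\<lambda>\<rho>. y - \<rho> *\<^sub>R x p) \<longlongrightarrow> y - 0 *\<^sub>R x p) (at_right 0)" for y :: 'a
          by (intro tendsto_intros)
        then show ?thesis by (auto simp: w_def split: option.split sum.split)
      qed
      show "\<not> in_halfspace Z (w 0 ` J)"
      proof
        assume "in_halfspace Z (w 0 ` J)"
        then obtain a where a: "a \<noteq> 0" "\<forall>w\<in>Z. a \<bullet> w = 0" "\<forall>i\<in>J. a \<bullet> w 0 i \<le> 0"
          unfolding in_halfspace_def by auto
        have "a \<bullet> x q \<le> a \<bullet> x p" if "Inl q \<in> U" for q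
          using bspec[OF a(3), of "Some (Inl q)"] that by (simp add: J_def w_def inner_diff_right)
        moreover have "a \<bullet> g = 0 \<and> a \<bullet> x p \<ge> 0" if g: "g \<in> full_pairs U" for g
        proof -
          have "full_pairs U \<noteq> {}" using g by auto
          then show ?thesis
            using g bspec[OF a(3), of "Some (Inr (g, True))"] bspec[OF a(3), of "Some (Inr (g, False))"]
              bspec[OF a(3), of None]
            by (simp add: J_def w_def full_pairs_def)
        qed
        ultimately have "Q U p" unfolding Q_def using a(1,2) by blast
        then show False using not by (simp add: p_def)
      qed
    qed
    moreover have "\<forall>\<^sub>F \<rho> in at_right 0. \<rho> > (0::real)" by (rule eventually_at_right_less)
    ultimately show "\<forall>\<^sub>F \<rho> in at_right 0. \<not> in_halfspace Z ((\<lambda>i. pair_config x \<rho> i - x (projl b)) ` U)"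
      unfolding p_def[symmetric]
    proof eventually_elim
      case (elim \<rho>)
      show ?case
      proof
        assume "in_halfspace Z ((\<lambda>i. pair_config x \<rho> i - x p) ` U)"
        then obtain a where a: "a \<noteq> 0" "\<forall>w\<in>Z. a \<bullet> w = 0" "\<forall>i\<in>U. a \<bullet> (pair_config x \<rho> i - x p) \<le> 0"
          unfolding in_halfspace_def by auto
        have pair: "a \<bullet> ((if b then g else - g) - \<rho> *\<^sub>R x p) \<le> 0" if "Inr (g, b) \<in> U" for g b
        proof -
          have "a \<bullet> (pair_config x \<rho> (Inr (g, b)) - x p) \<le> 0" using a(3) that by blast
          then have "a \<bullet> (\<rho> *\<^sub>R (pair_config x \<rho> (Inr (g, b)) - x p)) \<le> 0"
            using elim(2) by (simp add: mult_le_0_iff)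
          moreover have "\<rho> *\<^sub>R (pair_config x \<rho> (Inr (g, b)) - x p) = (if b then g else - g) - \<rho> *\<^sub>R x p"
            using elim(2) by (simp add: pair_config_def scaleR_diff_right)
          ultimately show ?thesis by simp
        qed
        have "a \<bullet> w \<rho> i \<le> 0" if iJ: "i \<in> J" for i
        proof (cases i)
          case None
          then obtain g where g: "Inr (g, True) \<in> U" "Inr (g, False) \<in> U"
            using iJ by (auto simp: J_def full_pairs_def split: if_splits)
          have "\<rho> * (a \<bullet> x p) \<ge> 0"
            using pair[OF g(1)] pair[OF g(2)] by (simp add: inner_diff_right)
          then show ?thesis using None elim(2) by (simp add: w_def zero_le_mult_iff)
        next
          case (Some k)
          then have k: "k \<in> U" using iJ by (auto simp: J_def split: if_splits)
          show ?thesis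
          proof (cases k)
            case (Inl q)
            then show ?thesis using k Some a(3) by (force simp: w_def pair_config_def)
          next
            case (Inr gb)
            then show ?thesis using k Some pair[of "fst gb" "snd gb"] by (cases gb) (auto simp: w_def)
          qed
        qed
        then have "in_halfspace Z (w \<rho> ` J)" using a by (intro in_halfspaceI[of a]) auto
        then show False using elim(1) by blast
      qed
    qed
  qed
  then show ?thesis unfolding Q_def[symmetric]
    by eventually_elim (metis sum.sel(1))
qed

lemma ex_pair_config:
  fixes x :: "'p \<Rightarrow> 'a::euclidean_space"
  assumes "finite \<iota>"
  obtains c :: "'p + 'a \<times> bool \<Rightarrow> 'a" where "\<And>p. c (Inl p) = x p"
    and "\<And>U p. U \<subseteq> \<iota> \<Longrightarrow> Inl p \<in> \<iota> \<Longrightarrow> in_halfspace Z ((\<lambda>i. c i - c (Inl p)) ` U) \<Longrightarrow>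
      \<exists>a. a \<noteq> 0 \<and> (\<forall>w\<in>Z. a \<bullet> w = 0) \<and> (\<forall>q. Inl q \<in> U \<longrightarrow> a \<bullet> x q \<le> a \<bullet> x p) \<and>
         (\<forall>g\<in>full_pairs U. a \<bullet> g = 0 \<and> a \<bullet> x p \<ge> 0)"
proof -
  have "\<exists>\<rho>. \<forall>U p. U \<subseteq> \<iota> \<longrightarrow> Inl p \<in> \<iota> \<longrightarrow>
    in_halfspace Z ((\<lambda>i. pair_config x \<rho> i - x p) ` U) \<longrightarrow>
    (\<exists>a. a \<noteq> 0 \<and> (\<forall>w\<in>Z. a \<bullet> w = 0) \<and> (\<forall>q. Inl q \<in> U \<longrightarrow> a \<bullet> x q \<le> a \<bullet> x p) \<and>
         (\<forall>g\<in>full_pairs U. a \<bullet> g = 0 \<and> a \<bullet> x p \<ge> 0))"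
    by (rule eventually_happens'[OF trivial_limit_at_right_real pair_config_limit[OF assms]])
  then obtain \<rho> where \<rho>: "\<forall>U p. U \<subseteq> \<iota> \<longrightarrow> Inl p \<in> \<iota> \<longrightarrow>
    in_halfspace Z ((\<lambda>i. pair_config x \<rho> i - x p) ` U) \<longrightarrow>
    (\<exists>a. a \<noteq> 0 \<and> (\<forall>w\<in>Z. a \<bullet> w = 0) \<and> (\<forall>q. Inl q \<in> U \<longrightarrow> a \<bullet> x q \<le> a \<bullet> x p) \<and>
         (\<forall>g\<in>full_pairs U. a \<bullet> g = 0 \<and> a \<bullet> x p \<ge> 0))" ..
  have inl: "pair_config x \<rho> (Inl p) = x p" for p by (simp add: pair_config_def)
  show ?thesis
    by (rule that[of "pair_config x \<rho>", OF inl]) (use \<rho> in \<open>simp add: inl\<close>)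
qed

text \<open>The twins of \<open>y\<close> coincide in this limit configuration; the later perturbation into general position
  tells them apart.\<close>

lemma ex_pairs_separations_bounded:
  fixes Z G M :: "'a::euclidean_space set" and j l :: nat
  defines "\<iota> \<equiv> Inl ` (M \<times> (UNIV::bool set)) \<union> Inr ` (G \<times> UNIV)"
    and "E \<equiv> {H. H \<subseteq> G \<and> card H = j} \<times> M"
    and "P \<equiv> (\<lambda>b (H, y). insert (Inl (y, b)) (Inr ` (H \<times> UNIV)))"
  assumes fin: "finite Z" "finite G" "finite M" and disj: "Z \<inter> G = {}"
    and lgp: "linear_general_position (Z \<union> G)"
    and M: "\<And>I S. I \<subseteq> Z \<union> G \<Longrightarrow> card I < DIM('a) \<Longrightarrow> S \<subseteq> M \<Longrightarrow> exposed_mod I S \<Longrightarrow>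
        card S \<le> 2 ^ DIM('a) * (l + 1) ^ (DIM('a) - 1 - card I)"
  shows "\<exists>c :: 'a \<times> bool + 'a \<times> bool \<Rightarrow> 'a. separations_bounded c Z \<iota> E (P True) (P False)
           (2 ^ DIM('a) * (2 ^ DIM('a) * (l + 1) ^ (DIM('a) - 1 - card Z - j)))"
proof -
  let ?d = "DIM('a)"
  have fin\<iota>: "finite \<iota>" using fin by (simp add: \<iota>_def)
  obtain c :: "'a \<times> bool + 'a \<times> bool \<Rightarrow> 'a" where c: "\<And>p. c (Inl p) = fst p"
    and lim: "\<And>U p. U \<subseteq> \<iota> \<Longrightarrow> Inl p \<in> \<iota> \<Longrightarrow> in_halfspace Z ((\<lambda>i. c i - c (Inl p)) ` U) \<Longrightarrow>
      \<exists>a. a \<noteq> 0 \<and> (\<forall>w\<in>Z. a \<bullet> w = 0) \<and> (\<forall>q. Inl q \<in> U \<longrightarrow> a \<bullet> fst q \<le> a \<bullet> fst p) \<and>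
         (\<forall>g\<in>full_pairs U. a \<bullet> g = 0 \<and> a \<bullet> fst p \<ge> 0)"
    using ex_pair_config[OF fin\<iota>, where x=fst and Z=Z] by blast
  have "card {e \<in> E. cut_off c Z U (P True e) (P False e) \<or> cut_off c Z U (P False e) (P True e)}
      \<le> 2 ^ ?d * (2 ^ ?d * (l + 1) ^ (?d - 1 - card Z - j))" (is "card ?L \<le> ?s") if U: "U \<subseteq> \<iota>" for U
  proof -
    \<comment> \<open>\<open>Q\<close> consists of the antipodal pairs contained in
      \<open>U\<close>, and \<open>S\<close> of the points with one twin in \<open>U\<close> and one
      twin that can be supported. A separated pair (H, y) has H in \<open>Q\<close> and y in
      \<open>S\<close>, so it suffices to count the j-subsets of \<open>Q\<close> and the points of
      \<open>S\<close>.\<close>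
    define Q where "Q = full_pairs U"
    define S where "S = {y\<in>M. (\<exists>b. Inl (y, b) \<in> U) \<and> (\<exists>b. in_halfspace Z ((\<lambda>i. c i - c (Inl (y, b))) ` U))}"
    have Q: "Q \<subseteq> G" using U by (auto simp: Q_def full_pairs_def \<iota>_def)
    then have finQ: "finite Q" using fin finite_subset by blast
    have S: "S \<subseteq> M" by (auto simp: S_def)
    have cut: "H \<subseteq> Q \<and> y \<in> S" if y: "y \<in> M" and cut: "cut_off c Z U (P b (H, y)) (P b' (H, y))" for H y b b'
    proof -
      have sub: "Inl (y, b) \<in> U" "Inr ` (H \<times> UNIV) \<subseteq> U" using cut by (auto simp: cut_off_def P_def)
      then have "H \<subseteq> Q" unfolding Q_def full_pairs_def by blast
      moreover have "in_halfspace Z ((\<lambda>i. c i - c (Inl (y, b'))) ` U)"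
        using cut sub(2) by (auto simp: cut_off_def P_def)
      ultimately show ?thesis using y sub(1) by (auto simp: S_def)
    qed
    have "?L \<subseteq> {H. H \<subseteq> Q \<and> card H = j} \<times> S"
    proof
      fix e assume e: "e \<in> ?L"
      obtain H y where Hy: "e = (H, y)" by (cases e)
      have "y \<in> M" "card H = j" using e by (auto simp: Hy E_def)
      moreover have "H \<subseteq> Q \<and> y \<in> S" using e \<open>y \<in> M\<close> cut[of y] by (auto simp only: Hy)
      ultimately show "e \<in> {H. H \<subseteq> Q \<and> card H = j} \<times> S" by (simp add: Hy)
    qed
    moreover have finHS: "finite ({H. H \<subseteq> Q \<and> card H = j} \<times> S)"
      using finQ finite_subset[OF S fin(3)] by simp
    ultimately have L: "card ?L \<le> card {H. H \<subseteq> Q \<and> card H = j} * card S"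
      using card_mono[OF finHS] by (simp add: card_cartesian_product)
    have ex: "\<exists>a. a \<noteq> 0 \<and> (\<forall>w\<in>Z \<union> Q. a \<bullet> w = 0) \<and> (\<forall>s\<in>S. a \<bullet> s \<le> a \<bullet> y)" if "y \<in> S" for y
    proof -
      from that obtain b where b: "y \<in> M" "in_halfspace Z ((\<lambda>i. c i - c (Inl (y, b))) ` U)"
        by (auto simp: S_def)
      have "Inl (y, b) \<in> \<iota>" using b(1) by (auto simp: \<iota>_def)
      from lim[OF U this b(2)] obtain a where a: "a \<noteq> 0" "\<forall>w\<in>Z. a \<bullet> w = 0"
        "\<forall>q. Inl q \<in> U \<longrightarrow> a \<bullet> fst q \<le> a \<bullet> y" "\<forall>g\<in>Q. a \<bullet> g = 0" by (auto simp: Q_def)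
      have "a \<bullet> s \<le> a \<bullet> y" if s: "s \<in> S" for s
      proof -
        obtain b' where "Inl (s, b') \<in> U" using s by (auto simp: S_def)
        then show ?thesis using a(3) by force
      qed
      then show ?thesis using a by blast
    qed
    have cardZQ: "card (Z \<union> Q) = card Z + card Q"
      using fin(1) finQ disj Q by (intro card_Un_disjoint) auto
    show ?thesis
    proof (cases "j \<le> card Q \<and> S \<noteq> {}")
      case False
      have "card {H. H \<subseteq> Q \<and> card H = j} * card S = 0"
      proof (cases "S = {}")
        case False
        then have "card Q < j" using \<open>\<not> (j \<le> card Q \<and> S \<noteq> {})\<close> by simp
        then have "\<not> (H \<subseteq> Q \<and> card H = j)" for H using card_mono[OF finQ, of H] by linarith
        then have "{H. H \<subseteq> Q \<and> card H = j} = {}" by blast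
        then show ?thesis by (simp only: card.empty mult_0)
      qed simp
      then show ?thesis using L by linarith
    next
      case True
      \<comment> \<open>A nonzero functional vanishes on all of Z and Q, which by genericity
        excludes d of these directions.\<close>
      have small: "card (Z \<union> Q) < ?d"
      proof (rule ccontr)
        assume "\<not> card (Z \<union> Q) < ?d"
        then obtain I where I: "I \<subseteq> Z \<union> Q" "card I = ?d" "finite I"
          by (metis not_less obtain_subset_with_card_n)
        then have "independent I" using Q by (intro linear_general_positionD[OF lgp]) auto
        moreover obtain a where "a \<noteq> 0" "\<forall>w\<in>Z \<union> Q. a \<bullet> w = 0" using ex True by blast
        ultimately show False using orthogonal_to_independent_eq_0[of I a] I by auto
      qed
      have "exposed_mod (Z \<union> Q) S"
        unfolding exposed_mod_def
      proof
        fix y assume "y \<in> S"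
        then obtain a where "a \<noteq> 0" "\<forall>w\<in>Z \<union> Q. a \<bullet> w = 0" "\<forall>s\<in>S. a \<bullet> s \<le> a \<bullet> y"
          using ex by blast
        then show "in_halfspace (Z \<union> Q) ((\<lambda>s. s - y) ` S)"
          by (intro in_halfspaceI[of a]) (auto simp: inner_diff_right)
      qed
      then have "card S \<le> 2 ^ ?d * (l + 1) ^ (?d - 1 - card (Z \<union> Q))"
        using Q S small by (intro M) auto
      \<comment> \<open>At least j pairs lie in \<open>Q\<close>, and each one lowers the exponent
        by 1.\<close>
      also have "\<dots> \<le> 2 ^ ?d * (l + 1) ^ (?d - 1 - card Z - j)"
        using True cardZQ by (intro mult_left_mono power_increasing) auto
      finally have cS: "card S \<le> 2 ^ ?d * (l + 1) ^ (?d - 1 - card Z - j)" .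
      \<comment> \<open>The j-subsets are counted crudely as all subsets of a set with fewer than d
        elements; this is the outer factor 2^d.\<close>
      have "card {H. H \<subseteq> Q \<and> card H = j} \<le> card (Pow Q)"
        using finQ by (intro card_mono) auto
      also have "\<dots> = 2 ^ card Q" using finQ by (rule card_Pow)
      also have "(2::nat) ^ card Q \<le> 2 ^ ?d" using small cardZQ by (intro power_increasing) auto
      finally show ?thesis using L cS by (meson mult_le_mono order.trans)
    qed
  qed
  then show ?thesis unfolding separations_bounded_def by blast
qed

section \<open>Chains of collinear points, for the bounds with explicit constants\<close>

lemma chain_separations_bounded:
  fixes u v :: "'a::euclidean_space"
  assumes uv: "\<And>a. a \<bullet> u = 0 \<Longrightarrow> a \<noteq> 0 \<Longrightarrow> a \<bullet> v \<noteq> 0"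
  shows "separations_bounded (\<lambda>t. real t *\<^sub>R v) {u} {1..N} {1..<N} (\<lambda>t. {t}) (\<lambda>t. {Suc t}) 2"
  unfolding separations_bounded_def
proof (intro allI impI)
  let ?c = "\<lambda>t. real t *\<^sub>R v"
  fix U assume U: "U \<subseteq> {1..N}"
  then have fin: "finite U" using finite_subset by blast
  have *: "\<exists>r. r \<noteq> 0 \<and> (\<forall>q\<in>U. real q * r \<le> real b * r)"
    if h: "in_halfspace {u} ((\<lambda>a. ?c a - ?c b) ` U)" for b
  proof -
    obtain a where a: "a \<noteq> 0" "a \<bullet> u = 0" "\<forall>q\<in>U. a \<bullet> (?c q - ?c b) \<le> 0"
      using h unfolding in_halfspace_def by auto
    then show ?thesis using uv[of a] by (intro exI[of _ "a \<bullet> v"]) (auto simp: inner_diff_right)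
  qed
  \<comment> \<open>Modulo u the chain lies on a line, where a supporting functional bounds U from
    above or from below. So the only consecutive points that can be separated are those at which U
    ends or begins.\<close>
  have "{e \<in> {1..<N}. cut_off ?c {u} U {e} {Suc e} \<or> cut_off ?c {u} U {Suc e} {e}} \<subseteq> {Max U, Min U - 1}"
  proof
    fix t assume "t \<in> {e \<in> {1..<N}. cut_off ?c {u} U {e} {Suc e} \<or> cut_off ?c {u} U {Suc e} {e}}"
    then consider "t \<in> U" "Suc t \<notin> U" "in_halfspace {u} ((\<lambda>a. ?c a - ?c (Suc t)) ` U)"
      | "Suc t \<in> U" "t \<notin> U" "in_halfspace {u} ((\<lambda>a. ?c a - ?c t) ` U)"
      by (auto simp: cut_off_def)
    then show "t \<in> {Max U, Min U - 1}"
    proof cases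
      case 1
      then obtain r where r: "r \<noteq> 0" "\<forall>q\<in>U. real q * r \<le> real (Suc t) * r" using * by blast
      have "real t * r \<le> real (Suc t) * r" using r(2) 1(1) by blast
      then have "r > 0" using r(1) by (simp add: algebra_simps)
      then have "q \<le> t" if "q \<in> U" for q
      proof -
        have "real q * r \<le> real (Suc t) * r" using r(2) that by blast
        then have "q \<le> Suc t" using \<open>r > 0\<close> by (simp only: mult_le_cancel_right_pos of_nat_le_iff)
        then show ?thesis using 1(2) that by (metis le_Suc_eq)
      qed
      then have "Max U = t" using fin 1(1) by (intro Max_eqI)
      then show ?thesis by simp
    next
      case 2
      then obtain r where r: "r \<noteq> 0" "\<forall>q\<in>U. real q * r \<le> real t * r" using * by blast
      have "real (Suc t) * r \<le> real t * r" using r(2) 2(1) by blast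
      then have "r < 0" using r(1) by (simp add: algebra_simps)
      then have "Suc t \<le> q" if "q \<in> U" for q
      proof -
        have "t \<le> q" using r(2) that \<open>r < 0\<close> by simp
        then show ?thesis using 2(2) that by (metis le_eq_less_or_eq Suc_leI)
      qed
      then have "Min U = Suc t" using fin 2(1) by (simp add: Min_eqI)
      then show ?thesis by simp
    qed
  qed
  then have "card {e \<in> {1..<N}. cut_off ?c {u} U {e} {Suc e} \<or> cut_off ?c {u} U {Suc e} {e}} \<le> card {Max U, Min U - 1}"
    by (rule card_mono[rotated]) simp
  also have "\<dots> \<le> 2" by (simp add: card_insert_le_m1)
  finally show "card {e \<in> {1..<N}. cut_off ?c {u} U {e} {Suc e} \<or> cut_off ?c {u} U {Suc e} {e}} \<le> 2" .
qed

text \<open>The pairs {1, j}, {1, j + 1} and {i, n}, {i + 1, n} are chosen so that the trace of an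
  interval determines the one it separates. In the first family the trace contains 1 and ends at j <
  n; in the second it contains n and begins at i + 1. The remaining alternatives would need a
  supported point strictly between two points of the trace. There are n - 2 pairs in each family,
  hence 2n - 4 altogether.\<close>

lemma line_separations_bounded:
  fixes v :: "'a::euclidean_space"
  assumes v: "\<And>a. a \<noteq> 0 \<Longrightarrow> a \<bullet> v \<noteq> 0"
  shows "separations_bounded (\<lambda>t. real t *\<^sub>R v) {} {1..n} (Inl ` {2..<n} \<union> Inr ` {1..<n - 1})
    (case_sum (\<lambda>j. {1, j}) (\<lambda>i. {i, n})) (case_sum (\<lambda>j. {1, Suc j}) (\<lambda>i. {Suc i, n})) 1"
    (is "separations_bounded ?c {} _ ?E ?A ?B 1")
  unfolding separations_bounded_def
proof (intro allI impI)
  fix U assume U: "U \<subseteq> {1..n}"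
  then have fin: "finite U" using finite_subset by blast
  have *: "\<exists>r. r \<noteq> 0 \<and> (\<forall>q\<in>U. real q * r \<le> real b * r)"
    if h: "in_halfspace {} ((\<lambda>a. ?c a - ?c b) ` U)" for b
  proof -
    obtain a where a: "a \<noteq> 0" "\<forall>q\<in>U. a \<bullet> (?c q - ?c b) \<le> 0"
      using h unfolding in_halfspace_def by auto
    then show ?thesis using v[of a] by (intro exI[of _ "a \<bullet> v"]) (auto simp: inner_diff_right)
  qed
  have "{e \<in> ?E. cut_off ?c {} U (?A e) (?B e) \<or> cut_off ?c {} U (?B e) (?A e)} \<subseteq>
     {if Max U = n then Inr (Min U - 1) else Inl (Max U)}"
  proof
    fix e assume "e \<in> {e \<in> ?E. cut_off ?c {} U (?A e) (?B e) \<or> cut_off ?c {} U (?B e) (?A e)}"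
    then have e: "e \<in> ?E" "cut_off ?c {} U (?A e) (?B e) \<or> cut_off ?c {} U (?B e) (?A e)" by auto
    from e(1) show "e \<in> {if Max U = n then Inr (Min U - 1) else Inl (Max U)}"
    proof
      assume "e \<in> Inl ` {2..<n}"
      then obtain j where j: "e = Inl j" "2 \<le> j" "j < n" by auto
      then consider "1 \<in> U" "j \<in> U" "Suc j \<notin> U" "in_halfspace {} ((\<lambda>a. ?c a - ?c (Suc j)) ` U)"
        | "1 \<in> U" "Suc j \<in> U" "in_halfspace {} ((\<lambda>a. ?c a - ?c j) ` U)"
        using e(2) by (auto simp: cut_off_def)
      then show ?thesis
      proof cases
        case 1
        then obtain r where r: "r \<noteq> 0" "\<forall>q\<in>U. real q * r \<le> real (Suc j) * r" using * by blast
        have "real j * r \<le> real (Suc j) * r" using r(2) 1(2) by blast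
        then have "r > 0" using r(1) by (simp add: algebra_simps)
        then have "q \<le> j" if "q \<in> U" for q
        proof -
          have "real q * r \<le> real (Suc j) * r" using r(2) that by blast
          then have "q \<le> Suc j" using \<open>r > 0\<close> by (simp only: mult_le_cancel_right_pos of_nat_le_iff)
          then show ?thesis using 1(3) that by (metis le_Suc_eq)
        qed
        then have "Max U = j" using fin 1(2) by (simp add: Max_eqI)
        then show ?thesis using j by simp
      next
        case 2
        then obtain r where r: "r \<noteq> 0" "\<forall>q\<in>U. real q * r \<le> real j * r" using * by blast
        have "real 1 * r \<le> real j * r" "real (Suc j) * r \<le> real j * r" using r(2) 2 by blast+
        then have "(real j - 1) * r \<ge> 0" "r \<le> 0" by (simp_all add: algebra_simps)
        then show ?thesis using j r(1) by (auto simp: zero_le_mult_iff)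
      qed
    next
      assume "e \<in> Inr ` {1..<n - 1}"
      then obtain i where i: "e = Inr i" "1 \<le> i" "i < n - 1" by auto
      then consider "n \<in> U" "i \<in> U" "in_halfspace {} ((\<lambda>a. ?c a - ?c (Suc i)) ` U)"
        | "n \<in> U" "Suc i \<in> U" "i \<notin> U" "in_halfspace {} ((\<lambda>a. ?c a - ?c i) ` U)"
        using e(2) by (auto simp: cut_off_def)
      then show ?thesis
      proof cases
        case 1
        then obtain r where r: "r \<noteq> 0" "\<forall>q\<in>U. real q * r \<le> real (Suc i) * r" using * by blast
        have "real i * r \<le> real (Suc i) * r" "real n * r \<le> real (Suc i) * r" using r(2) 1 by blast+
        then have "r \<ge> 0" "(real n - real (Suc i)) * r \<le> 0" by (simp_all add: algebra_simps)
        then show ?thesis using i r(1) by (auto simp: mult_le_0_iff)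
      next
        case 2
        then obtain r where r: "r \<noteq> 0" "\<forall>q\<in>U. real q * r \<le> real i * r" using * by blast
        have "real (Suc i) * r \<le> real i * r" using r(2) 2(2) by blast
        then have "r < 0" using r(1) by (simp add: algebra_simps)
        then have "Suc i \<le> q" if "q \<in> U" for q
        proof -
          have "i \<le> q" using r(2) that \<open>r < 0\<close> by simp
          then show ?thesis using 2(3) that by (metis le_eq_less_or_eq Suc_leI)
        qed
        then have "Min U = Suc i" using fin 2(2) by (simp add: Min_eqI)
        moreover have "Max U = n" using fin 2(1) U by (intro Max_eqI) auto
        ultimately show ?thesis using i by simp
      qed
    qed
  qed
  from card_mono[OF _ this]
  show "card {e \<in> ?E. cut_off ?c {} U (?A e) (?B e) \<or> cut_off ?c {} U (?B e) (?A e)} \<le> 1" by simp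
qed

text \<open>A full pair \<plusminus>g makes the functional orthogonal to g, and in the plane two
  different g would make it zero, so g is determined. The sign condition at the point p v, with p
  \<ge> 1, then gives a \<bullet> v > 0, so only the upper end of the trace on the chain can
  separate. This yields the bound 1 where a bare chain has 2.\<close>

lemma ex_chain_pairs_separations_bounded:
  fixes v :: "'a::euclidean_space" and G :: "'a set" and N :: nat
  defines "\<iota> \<equiv> Inl ` {1..N} \<union> Inr ` (G \<times> (UNIV :: bool set))"
    and "A \<equiv> \<lambda>(g, t). {Inr (g, True), Inr (g, False), Inl t}"
    and "B \<equiv> \<lambda>(g, t). {Inr (g, True), Inr (g, False), Inl (Suc t)}"
  assumes G: "finite G"
    and gv: "\<And>g a. g \<in> G \<Longrightarrow> a \<bullet> g = 0 \<Longrightarrow> a \<noteq> 0 \<Longrightarrow> a \<bullet> v \<noteq> 0"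
    and gg: "\<And>g g' a. g \<in> G \<Longrightarrow> g' \<in> G \<Longrightarrow> g \<noteq> g' \<Longrightarrow> a \<bullet> g = 0 \<Longrightarrow> a \<bullet> g' = 0 \<Longrightarrow> a = 0"
  shows "\<exists>c :: nat + 'a \<times> bool \<Rightarrow> 'a. separations_bounded c {} \<iota> (G \<times> {1..<N}) A B 1"
proof -
  have fin\<iota>: "finite \<iota>" using G by (simp add: \<iota>_def)
  obtain c :: "nat + 'a \<times> bool \<Rightarrow> 'a" where c: "\<And>p. c (Inl p) = real p *\<^sub>R v"
    and lim: "\<And>U p. U \<subseteq> \<iota> \<Longrightarrow> Inl p \<in> \<iota> \<Longrightarrow> in_halfspace {} ((\<lambda>i. c i - c (Inl p)) ` U) \<Longrightarrow>
      \<exists>a. a \<noteq> 0 \<and> (\<forall>w\<in>{}. a \<bullet> w = 0) \<and> (\<forall>q. Inl q \<in> U \<longrightarrow> a \<bullet> (real q *\<^sub>R v) \<le> a \<bullet> (real p *\<^sub>R v)) \<and>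
         (\<forall>g\<in>full_pairs U. a \<bullet> g = 0 \<and> a \<bullet> (real p *\<^sub>R v) \<ge> 0)"
    using ex_pair_config[OF fin\<iota>, where x="\<lambda>p. real p *\<^sub>R v" and Z="{}"] by blast
  have "card {e \<in> G \<times> {1..<N}. cut_off c {} U (A e) (B e) \<or> cut_off c {} U (B e) (A e)} \<le> 1"
    (is "card ?L \<le> 1") if U: "U \<subseteq> \<iota>" for U
  proof -
    have ex: "\<exists>a. a \<noteq> 0 \<and> a \<bullet> v > 0 \<and> (\<forall>q. Inl q \<in> U \<longrightarrow> q \<le> p) \<and> (\<forall>g\<in>full_pairs U. a \<bullet> g = 0)"
      if p: "1 \<le> p" "p \<le> N" and g: "g \<in> full_pairs U" and h: "in_halfspace {} ((\<lambda>i. c i - c (Inl p)) ` U)"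
      for p g
    proof -
      have "Inl p \<in> \<iota>" using p by (simp add: \<iota>_def)
      from lim[OF U this h] obtain a where a: "a \<noteq> 0"
        "\<forall>q. Inl q \<in> U \<longrightarrow> a \<bullet> (real q *\<^sub>R v) \<le> a \<bullet> (real p *\<^sub>R v)"
        "\<forall>g\<in>full_pairs U. a \<bullet> g = 0 \<and> a \<bullet> (real p *\<^sub>R v) \<ge> 0" by auto
      have "g \<in> G" using g U by (auto simp: full_pairs_def \<iota>_def)
      then have "a \<bullet> v \<noteq> 0" using a(1,3) g by (intro gv) auto
      moreover have "a \<bullet> v \<ge> 0" using a(3) g p by (auto simp: zero_le_mult_iff)
      ultimately have pos: "a \<bullet> v > 0" by simp
      then have "\<forall>q. Inl q \<in> U \<longrightarrow> q \<le> p" using a(2) by auto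
      then show ?thesis using a(1,3) pos by blast
    qed
    define T where "T = {q. Inl q \<in> U}"
    have finT: "finite T"
    proof -
      have "T \<subseteq> {1..N}" using U by (auto simp: T_def \<iota>_def)
      then show ?thesis using finite_subset by blast
    qed
    have L: "g \<in> full_pairs U \<and> t = Max T \<and> (\<exists>a. a \<noteq> 0 \<and> (\<forall>g\<in>full_pairs U. a \<bullet> g = 0))"
      if e: "(g, t) \<in> ?L" for g t
    proof -
      have t: "g \<in> G" "1 \<le> t" "t < N" using e by auto
      from e consider "g \<in> full_pairs U" "Inl t \<in> U" "Inl (Suc t) \<notin> U" "in_halfspace {} ((\<lambda>i. c i - c (Inl (Suc t))) ` U)"
        | "g \<in> full_pairs U" "Inl (Suc t) \<in> U" "in_halfspace {} ((\<lambda>i. c i - c (Inl t)) ` U)"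
        by (auto simp: cut_off_def A_def B_def full_pairs_def)
      then show ?thesis
      proof cases
        case 1
        then obtain a where a: "a \<noteq> 0" "\<forall>q. Inl q \<in> U \<longrightarrow> q \<le> Suc t" "\<forall>g\<in>full_pairs U. a \<bullet> g = 0"
          using ex[of "Suc t" g] t by auto
        have "q \<le> t" if "q \<in> T" for q
          using a(2) that 1(3) by (metis T_def le_Suc_eq mem_Collect_eq)
        then have "t = Max T" using finT 1(2) by (intro Max_eqI[symmetric]) (auto simp: T_def)
        then show ?thesis using a 1(1) by blast
      next
        case 2
        then show ?thesis using ex[of t g] t by fastforce
      qed
    qed
    have "x = y" if "x \<in> ?L" "y \<in> ?L" for x y
    proof -
      obtain g t g' t' where xy: "x = (g, t)" "y = (g', t')" by (cases x, cases y) auto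
      have 1: "g \<in> full_pairs U" "t = Max T" "\<exists>a. a \<noteq> 0 \<and> (\<forall>g\<in>full_pairs U. a \<bullet> g = 0)"
        using L[of g t] that(1) xy by blast+
      have 2: "g' \<in> full_pairs U" "t' = Max T" using L[of g' t'] that(2) xy by blast+
      have "g \<in> G" "g' \<in> G" using that xy by auto
      then have "g = g'" using 1(1,3) 2(1) gg by blast
      then show ?thesis using 1 2 xy by simp
    qed
    moreover have "finite ?L" using G by simp
    ultimately show ?thesis by (simp add: card_le_Suc0_iff_eq)
  qed
  then show ?thesis unfolding separations_bounded_def by blast
qed

section \<open>Separators by halfspaces\<close>

lemma infinite_convex_sets: "infinite {F :: 'a::euclidean_space set. convex F}"
proof
  assume "finite {F :: 'a set. convex F}"
  then have "finite (range (\<lambda>x :: 'a. {x}))" by (rule rev_finite_subset) auto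
  then have "finite (UNIV :: 'a set)" by (rule finite_imageD) (simp add: inj_on_def)
  then show False using not_bounded_UNIV finite_imp_bounded by blast
qed

text \<open>\<open>convex_separation_number\<close> asks for exactly \<open>c\<close> sets.
  Supersets of separators are separators, so it is enough to provide at most \<open>c\<close> sets
  and to add arbitrary further convex ones.\<close>

lemma pad_separator:
  fixes \<F> :: "'a::euclidean_space set set"
  assumes "finite \<F>" "card \<F> \<le> c" "\<forall>F\<in>\<F>. convex F" "containment_separator k X \<F>"
  shows "\<exists>\<F>. finite \<F> \<and> card \<F> = c \<and> (\<forall>F\<in>\<F>. convex F) \<and> containment_separator k X \<F>"
proof -
  have "infinite ({F. convex F} - \<F>)"
    using infinite_convex_sets assms(1) by (rule Diff_infinite_finite[rotated])
  then obtain \<G> where \<G>: "finite \<G>" "card \<G> = c - card \<F>" "\<G> \<subseteq> {F. convex F} - \<F>"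
    using infinite_arbitrarily_large by metis
  have "card (\<F> \<union> \<G>) = c"
    using \<G> assms(1,2) by (subst card_Un_disjoint) auto
  moreover have "containment_separator k X (\<F> \<union> \<G>)"
    using assms(4) unfolding containment_separator_def by blast
  ultimately show ?thesis using assms(1,3) \<G> by (intro exI[of _ "\<F> \<union> \<G>"]) auto
qed

definition separable_by :: "'a::euclidean_space itself \<Rightarrow> nat \<Rightarrow> nat \<Rightarrow> nat \<Rightarrow> bool" where
  "separable_by T k n c \<longleftrightarrow> (\<forall>X :: 'a set. finite X \<and> card X = n \<and> general_position X \<longrightarrow>
     (\<exists>\<F>. finite \<F> \<and> card \<F> \<le> c \<and> (\<forall>F\<in>\<F>. convex F) \<and> containment_separator k X \<F>))"

lemma convex_separation_number_le:
  assumes "separable_by TYPE('a::euclidean_space) k n c"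
  shows "convex_separation_number TYPE('a) k n \<le> c"
  unfolding convex_separation_number_def
  by (rule Least_le) (use assms pad_separator in \<open>unfold separable_by_def, blast\<close>)

text \<open>\<open>LEAST\<close> carries information only if some number qualifies. The upper bound
  \<open>sep\<close> ensures this, so the minimum is attained and a lower bound for one point set
  applies to it.\<close>

lemma convex_separation_number_ge:
  fixes X :: "'a::euclidean_space set"
  assumes sep: "separable_by TYPE('a) k n c"
    and X: "finite X" "card X = n" "general_position X"
    and low: "\<And>\<F>. finite \<F> \<Longrightarrow> \<forall>F\<in>\<F>. convex F \<Longrightarrow> containment_separator k X \<F> \<Longrightarrow> m \<le> s * card \<F>"
  shows "m \<le> s * convex_separation_number TYPE('a) k n"
proof -
  let ?P = "\<lambda>c. \<forall>X :: 'a set. finite X \<and> card X = n \<and> general_position X \<longrightarrow>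
        (\<exists>\<F>. finite \<F> \<and> card \<F> = c \<and> (\<forall>F\<in>\<F>. convex F) \<and> containment_separator k X \<F>)"
  have "?P c" using sep pad_separator unfolding separable_by_def by blast
  then have "?P (convex_separation_number TYPE('a) k n)"
    unfolding convex_separation_number_def by (rule LeastI)
  then obtain \<F> where "finite \<F>" "card \<F> = convex_separation_number TYPE('a) k n"
    "\<forall>F\<in>\<F>. convex F" "containment_separator k X \<F>" using X by blast
  then show ?thesis using low by metis
qed

text \<open>\<open>S\<close> is enlarged to d + 1 points of \<open>X\<close>; if these were
  dependent, some hyperplane would contain them. When \<open>X\<close> has too few points for this,
  its own affine independence passes to \<open>S\<close>.\<close>

lemma general_position_affine_independent:
  fixes X :: "'a::euclidean_space set"
  assumes X: "finite X" "general_position X" and S: "S \<subseteq> X" "card S \<le> DIM('a) + 1"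
  shows "\<not> affine_dependent S"
proof (cases "card X \<le> DIM('a)")
  case True
  then have "\<not> affine_dependent X" using X by (simp add: general_position_def)
  then show ?thesis using S(1) affine_dependent_subset by blast
next
  case False
  obtain T where T: "S \<subseteq> T" "T \<subseteq> X" "card T = DIM('a) + 1"
    using exists_subset_between[OF S(2) _ S(1) X(1)] False by auto
  have "\<not> affine_dependent T"
  proof
    assume "affine_dependent T"
    have "finite T" using T(2) X(1) finite_subset by blast
    then have "aff_dim T < int (card T) - 1"
      using aff_dim_le_card[of T] affine_independent_iff_card[of T] \<open>affine_dependent T\<close> by linarith
    then have "aff_dim T < int DIM('a)" using T(3) by simp
    then obtain a b where ab: "a \<noteq> 0" "T \<subseteq> {x. a \<bullet> x = b}"
      using aff_lowdim_subset_hyperplane by blast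
    have "affine {x. a \<bullet> x = b}" by (rule affine_hyperplane)
    moreover have "aff_dim {x. a \<bullet> x = b} = int DIM('a) - 1"
      using aff_dim_hyperplane[OF ab(1)] DIM_positive[where 'a='a] by (simp add: of_nat_diff Suc_leI)
    ultimately show False using X(2) T(2,3) ab(2) unfolding general_position_def by blast
  qed
  then show ?thesis using T(1) affine_dependent_subset by blast
qed

lemma ex_injective_functional:
  fixes X :: "'a::euclidean_space set"
  assumes "finite X"
  shows "\<exists>a. \<forall>x\<in>X. \<forall>y\<in>X. a \<bullet> x = a \<bullet> y \<longrightarrow> x = y"
proof -
  let ?\<A> = "(\<lambda>(x, y). {a. (x - y) \<bullet> a = 0}) ` {(x, y) \<in> X \<times> X. x \<noteq> y}"
  have "finite {(x, y) \<in> X \<times> X. x \<noteq> y}"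
    by (rule finite_subset[of _ "X \<times> X"]) (use assms in auto)
  then have "finite ?\<A>" by (rule finite_imageI)
  moreover have "aff_dim A < int DIM('a)" if A: "A \<in> ?\<A>" for A
  proof -
    obtain x y where "A = {a. (x - y) \<bullet> a = 0}" "x - y \<noteq> 0" using A by auto
    then show ?thesis using aff_dim_hyperplane[of "x - y" 0] DIM_positive[where 'a='a] by simp
  qed
  ultimately have "\<exists>a\<in>UNIV. \<forall>A\<in>?\<A>. a \<notin> affine hull A"
    by (intro ex_not_in_Union_lowdim) auto
  then obtain a where a: "\<forall>A\<in>?\<A>. a \<notin> affine hull A" by blast
  have "x = y" if xy: "x \<in> X" "y \<in> X" "a \<bullet> x = a \<bullet> y" for x y
  proof (rule ccontr)
    assume "x \<noteq> y"
    then have "{a. (x - y) \<bullet> a = 0} \<in> ?\<A>" using xy by (intro image_eqI[of _ _ "(x, y)"]) auto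
    then have "a \<notin> affine hull {a. (x - y) \<bullet> a = 0}" by (rule bspec[OF a])
    moreover have "a \<in> {a. (x - y) \<bullet> a = 0}"
      using xy(3) by (simp add: inner_diff_left inner_commute[of x a] inner_commute[of y a])
    ultimately show False by (simp only: hull_inc not_True_eq_False)
  qed
  then show ?thesis by blast
qed

text \<open>A pair is determined by its upper and its lower element. If two pairs differ in their
  upper elements, the smaller of these lies above its partner and below the other upper element, so
  it is extreme in neither direction; dually for the lower elements. Hence two halfspaces at each of
  the at most n - 2 inner points suffice.\<close>

lemma separable_by_pairs:
  assumes "2 \<le> n"
  shows "separable_by TYPE('a::euclidean_space) 2 n (2 * n - 4)"
  unfolding separable_by_def
proof (intro allI impI)
  fix X :: "'a set" assume "finite X \<and> card X = n \<and> general_position X"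
  then have X: "finite X" "card X = n" by auto
  obtain a where a: "\<And>x y. x \<in> X \<Longrightarrow> y \<in> X \<Longrightarrow> a \<bullet> x = a \<bullet> y \<Longrightarrow> x = y"
    using ex_injective_functional[OF X(1)] by blast
  define I where "I = {p\<in>X. (\<exists>q\<in>X. a \<bullet> q < a \<bullet> p) \<and> (\<exists>q\<in>X. a \<bullet> p < a \<bullet> q)}"
  have "X \<noteq> {}" using X assms by auto
  then have f: "finite ((\<bullet>) a ` X)" "(\<bullet>) a ` X \<noteq> {}" using X(1) by auto
  obtain p where p: "p \<in> X" "a \<bullet> p = Min ((\<bullet>) a ` X)" using Min_in[OF f] by (metis imageE)
  obtain q where q: "q \<in> X" "a \<bullet> q = Max ((\<bullet>) a ` X)" using Max_in[OF f] by (metis imageE)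
  have pq: "p \<in> X" "q \<in> X" "\<And>x. x \<in> X \<Longrightarrow> a \<bullet> p \<le> a \<bullet> x" "\<And>x. x \<in> X \<Longrightarrow> a \<bullet> x \<le> a \<bullet> q"
    using p q Min_le[OF f(1)] Max_ge[OF f(1)] by auto
  have "p \<noteq> q"
  proof
    assume "p = q"
    then have "a \<bullet> x = a \<bullet> p" if "x \<in> X" for x using pq(3)[OF that] pq(4)[OF that] by simp
    then have "X \<subseteq> {p}" using a pq(1) by blast
    then have "card X \<le> 1" using card_mono[of "{p}" X] by simp
    then show False using X(2) assms by simp
  qed
  have "I \<subseteq> X - {p, q}" unfolding I_def using pq by (auto simp: not_less[symmetric])
  then have "card I \<le> card (X - {p, q})" using X(1) by (intro card_mono) auto
  also have "\<dots> = n - 2" using pq(1,2) \<open>p \<noteq> q\<close> X by (subst card_Diff_subset) auto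
  finally have cardI: "card I \<le> n - 2" .
  have finI: "finite I" using X(1) by (simp add: I_def)
  define L where "L = (\<lambda>p. {x. a \<bullet> x \<le> a \<bullet> p}) ` I"
  define R where "R = (\<lambda>p. {x. a \<bullet> x \<ge> a \<bullet> p}) ` I"
  have fin: "finite (L \<union> R)" using finI by (simp add: L_def R_def)
  have "card (L \<union> R) \<le> card L + card R" by (rule card_Un_le)
  also have "\<dots> \<le> card I + card I" unfolding L_def R_def by (intro add_mono card_image_le finI)
  finally have card: "card (L \<union> R) \<le> 2 * n - 4" using cardI by linarith
  have conv: "\<forall>F\<in>L \<union> R. convex F"
    by (auto simp: L_def R_def convex_halfspace_le convex_halfspace_ge)
  have *: "\<exists>F\<in>L \<union> R. containment_separates F {x, y} {z, w}"
    if X': "x \<in> X" "y \<in> X" "z \<in> X" "w \<in> X" and lt: "a \<bullet> x < a \<bullet> y" "a \<bullet> z < a \<bullet> w" and ne: "{x, y} \<noteq> {z, w}" for x y z w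
  proof -
    consider "a \<bullet> y < a \<bullet> w" | "a \<bullet> w < a \<bullet> y" | "y = w" using a[OF X'(2,4)] by linarith
    then show ?thesis
    proof cases
      case 1
      have "y \<in> I" using X' lt 1 by (auto simp: I_def)
      then show ?thesis using lt 1
        by (intro bexI[of _ "{x. a \<bullet> x \<le> a \<bullet> y}"]) (auto simp: L_def containment_separates_def)
    next
      case 2
      have "w \<in> I" using X' lt 2 by (auto simp: I_def)
      then show ?thesis using lt 2
        by (intro bexI[of _ "{x. a \<bullet> x \<le> a \<bullet> w}"]) (auto simp: L_def containment_separates_def)
    next
      case 3
      then have "a \<bullet> x \<noteq> a \<bullet> z" using ne a[OF X'(1,3)] by auto
      then consider "a \<bullet> x < a \<bullet> z" | "a \<bullet> z < a \<bullet> x" by linarith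
      then show ?thesis
      proof cases
        case 1
        have "z \<in> I" using X' lt 1 by (auto simp: I_def)
        then show ?thesis using lt 1
          by (intro bexI[of _ "{x. a \<bullet> x \<ge> a \<bullet> z}"]) (auto simp: R_def containment_separates_def)
      next
        case 2
        have "x \<in> I" using X' lt 2 by (auto simp: I_def)
        then show ?thesis using lt 2
          by (intro bexI[of _ "{y. a \<bullet> y \<ge> a \<bullet> x}"]) (auto simp: R_def containment_separates_def)
      qed
    qed
  qed
  have pair: "\<exists>x y. A = {x, y} \<and> x \<in> X \<and> y \<in> X \<and> a \<bullet> x < a \<bullet> y" if A: "A \<subseteq> X" "card A = 2" for A
  proof -
    obtain x y where xy: "A = {x, y}" "x \<noteq> y" using A(2) by (auto simp: card_2_iff)
    then have "a \<bullet> x \<noteq> a \<bullet> y" using a A(1) by blast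
    then show ?thesis using xy A(1) by (metis insert_commute insert_subset linorder_neqE)
  qed
  have "containment_separator 2 X (L \<union> R)"
    unfolding containment_separator_def
  proof (intro allI impI)
    fix A B assume "A \<subseteq> X \<and> card A = 2 \<and> B \<subseteq> X \<and> card B = 2 \<and> A \<noteq> B"
    then show "\<exists>F\<in>L \<union> R. containment_separates F A B"
      using pair[of A] pair[of B] * by metis
  qed
  then show "\<exists>\<F>. finite \<F> \<and> card \<F> \<le> 2 * n - 4 \<and> (\<forall>F\<in>\<F>. convex F) \<and> containment_separator 2 X \<F>"
    using fin card conv by (intro exI[of _ "L \<union> R"]) simp
qed

section \<open>Simplices modulo a generic subspace\<close>

lemma dim_differences:
  fixes A :: "'a::euclidean_space set"
  assumes "\<not> affine_dependent A" "a0 \<in> A"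
  shows "dim ((\<lambda>a. a - a0) ` A) = card A - 1"
proof -
  have "int (card A) = aff_dim A + 1" using assms(1) by (rule aff_dim_affine_independent)
  moreover have "aff_dim A = int (dim ((\<lambda>a. a - a0) ` A))"
    using aff_dim_eq_dim_subtract[of a0 A] assms(2) hull_inc by metis
  ultimately show ?thesis by linarith
qed

text \<open>Used with i = d + 1 - k: together with the edge directions of any k-subset,
  \<open>W\<close> then spans the whole space, so all k-subsets stay nondegenerate simplices in one
  common quotient of dimension k - 1. One direction at a time is chosen outside the finitely many
  spans reached so far.\<close>

lemma ex_complementary_directions:
  fixes X :: "'a::euclidean_space set"
  assumes X: "finite X" and ind: "\<And>A. A \<subseteq> X \<Longrightarrow> card A = k \<Longrightarrow> \<not> affine_dependent A"
    and "1 \<le> k" "k - 1 + i \<le> DIM('a)"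
  shows "\<exists>W. finite W \<and> card W \<le> i \<and>
    (\<forall>A a0. A \<subseteq> X \<longrightarrow> card A = k \<longrightarrow> a0 \<in> A \<longrightarrow> dim ((\<lambda>a. a - a0) ` A \<union> W) = k - 1 + i)"
  using assms(4)
proof (induction i)
  case 0
  show ?case using ind dim_differences by (intro exI[of _ "{}"]) auto
next
  case (Suc i)
  then obtain W where W: "finite W" "card W \<le> i"
    "\<And>A a0. A \<subseteq> X \<Longrightarrow> card A = k \<Longrightarrow> a0 \<in> A \<Longrightarrow> dim ((\<lambda>a. a - a0) ` A \<union> W) = k - 1 + i" by auto
  let ?J = "{(A, a0). A \<subseteq> X \<and> a0 \<in> X \<and> card A = k \<and> a0 \<in> A}"
  let ?V = "\<lambda>(A, a0). insert 0 ((\<lambda>a. a - a0) ` A \<union> W)"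
  have "finite ?J" by (rule finite_subset[of _ "Pow X \<times> X"]) (use X in auto)
  then have "finite (?V ` ?J)" by simp
  moreover have "aff_dim V < int DIM('a)" if V: "V \<in> ?V ` ?J" for V
  proof -
    obtain A a0 where A: "V = insert 0 ((\<lambda>a. a - a0) ` A \<union> W)" "A \<subseteq> X" "card A = k" "a0 \<in> A"
      using V by auto
    have "aff_dim V = int (dim V)" unfolding A(1) by (rule aff_dim_zero) (simp add: hull_inc)
    also have "dim V = dim ((\<lambda>a. a - a0) ` A \<union> W)" unfolding A(1) by (metis dim_span span_insert_0)
    also have "\<dots> = k - 1 + i" using A by (intro W(3))
    finally show ?thesis using Suc.prems by linarith
  qed
  ultimately have "\<exists>w\<in>UNIV. \<forall>V\<in>?V ` ?J. w \<notin> affine hull V"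
    by (intro ex_not_in_Union_lowdim) auto
  then obtain w where w: "\<forall>V\<in>?V ` ?J. w \<notin> affine hull V" by blast
  have "dim ((\<lambda>a. a - a0) ` A \<union> insert w W) = k - 1 + Suc i"
    if A: "A \<subseteq> X" "card A = k" "a0 \<in> A" for A a0
  proof -
    let ?S = "(\<lambda>a. a - a0) ` A \<union> W"
    have "insert 0 ?S \<in> ?V ` ?J" using A by (intro image_eqI[of _ _ "(A, a0)"]) auto
    then have "w \<notin> affine hull (insert 0 ?S)" using w by blast
    then have "w \<notin> span ?S" by (simp add: affine_hull_insert_span_gen)
    then have "dim (insert w ?S) = Suc (dim ?S)" by (simp add: dim_insert)
    then show ?thesis using W(3)[OF A] by simp
  qed
  moreover have "card (insert w W) \<le> Suc i" using W(1,2) by (simp add: card_insert_if)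
  ultimately show ?case using W(1) by (intro exI[of _ "insert w W"]) auto
qed

text \<open>Modulo \<open>W\<close> the set \<open>A\<close> is a simplex whose facet opposite to \<open>a\<close> lies in \<open>u a \<bullet> x = c a\<close>.\<close>

lemma barycentric_coordinates:
  fixes A W :: "'a::euclidean_space set" and u :: "'a \<Rightarrow> 'a" and c :: "'a \<Rightarrow> real"
  assumes A: "finite A" "A \<noteq> {}" and nf: "\<not> flat_mod W A"
    and u: "\<And>a. a \<in> A \<Longrightarrow> u a \<noteq> 0" "\<And>a w. a \<in> A \<Longrightarrow> w \<in> W \<Longrightarrow> u a \<bullet> w = 0"
    and uc: "\<And>a b. a \<in> A \<Longrightarrow> b \<in> A \<Longrightarrow> b \<noteq> a \<Longrightarrow> u a \<bullet> b = c a"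
  shows "a \<in> A \<Longrightarrow> u a \<bullet> a \<noteq> c a"
    and "(\<Sum>a\<in>A. (u a \<bullet> x - c a) / (u a \<bullet> a - c a)) = 1"
    and "(\<And>w. w \<in> W \<Longrightarrow> \<alpha> \<bullet> w = 0) \<Longrightarrow> \<alpha> \<bullet> x = (\<Sum>a\<in>A. (u a \<bullet> x - c a) / (u a \<bullet> a - c a) * (\<alpha> \<bullet> a))"
proof -
  show ne: "u a \<bullet> a \<noteq> c a" if "a \<in> A" for a
  proof
    assume "u a \<bullet> a = c a"
    then have "u a \<bullet> b = c a" if "b \<in> A" for b using uc[OF \<open>a \<in> A\<close> that] by (cases "b = a") auto
    then have "flat_mod W A" using u \<open>a \<in> A\<close> by (intro flat_modI[of "u a"]) auto
    then show False using nf by blast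
  qed
  have const: "\<beta> \<bullet> x = r" if "\<And>w. w \<in> W \<Longrightarrow> \<beta> \<bullet> w = 0" "\<And>a. a \<in> A \<Longrightarrow> \<beta> \<bullet> a = r" for \<beta> x r
  proof -
    have "\<beta> = 0" using nf flat_modI[of \<beta> W A] that by metis
    moreover obtain a where "a \<in> A" using A(2) by blast
    ultimately show ?thesis using that(2)[of a] by simp
  qed
  \<comment> \<open>Lagrange interpolation: both sides are affine functions modulo \<open>W\<close>
    that agree at the vertices of \<open>A\<close>, and \<beta> is the linear part of their
    difference. The constant 1 gives the sum of the coordinates, \<alpha> itself the representation
    of \<open>\<alpha> \<bullet> x\<close>.\<close>
  have interp: "(\<Sum>a\<in>A. (u a \<bullet> x - c a) / (u a \<bullet> a - c a) * f a) = \<alpha> \<bullet> x + r"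
    if \<alpha>: "\<And>w. w \<in> W \<Longrightarrow> \<alpha> \<bullet> w = 0" and f: "\<And>a. a \<in> A \<Longrightarrow> f a = \<alpha> \<bullet> a + r" for \<alpha> f r
  proof -
    define \<beta> where "\<beta> = (\<Sum>a\<in>A. (f a / (u a \<bullet> a - c a)) *\<^sub>R u a) - \<alpha>"
    define t where "t = (\<Sum>a\<in>A. f a * c a / (u a \<bullet> a - c a))"
    have \<beta>: "\<beta> \<bullet> y = (\<Sum>a\<in>A. (u a \<bullet> y - c a) / (u a \<bullet> a - c a) * f a) + t - \<alpha> \<bullet> y" for y
      by (simp add: \<beta>_def t_def inner_diff_left inner_sum_left sum.distrib[symmetric] diff_divide_distrib algebra_simps)
    have "\<beta> \<bullet> w = 0" if "w \<in> W" for w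
      using u(2) \<alpha> that by (simp add: \<beta>_def inner_diff_left inner_sum_left)
    moreover have "\<beta> \<bullet> b = t + r" if b: "b \<in> A" for b
    proof -
      have "(\<Sum>a\<in>A. (u a \<bullet> b - c a) / (u a \<bullet> a - c a) * f a) = (\<Sum>a\<in>A. if a = b then f a else 0)"
        using uc[OF _ b] ne by (intro sum.cong) auto
      then show ?thesis using f[OF b] A(1) b by (simp add: \<beta>)
    qed
    ultimately have "\<beta> \<bullet> x = t + r" by (rule const)
    then show ?thesis by (simp add: \<beta>)
  qed
  show "(\<Sum>a\<in>A. (u a \<bullet> x - c a) / (u a \<bullet> a - c a)) = 1"
    using interp[of 0 "\<lambda>_. 1" 1] by simp
  show "\<alpha> \<bullet> x = (\<Sum>a\<in>A. (u a \<bullet> x - c a) / (u a \<bullet> a - c a) * (\<alpha> \<bullet> a))"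
    if "\<And>w. w \<in> W \<Longrightarrow> \<alpha> \<bullet> w = 0"
    using interp[of \<alpha> "\<lambda>a. \<alpha> \<bullet> a" 0] that by simp
qed

text \<open>Two simplices that contain each other's vertices lead to a contradiction as follows. A
  vertex p of \<open>A\<close> outside \<open>B\<close> is a convex combination of vertices of
  \<open>B\<close>, all of which lie in the simplex of \<open>A\<close>. Since p is extreme there, a
  vertex b of positive weight agrees with p modulo \<open>W\<close>, and then b and a facet of
  \<open>A\<close> through p are k points in one hyperplane. Each facet is given by a (k - 1)-subset
  and contributes its two halfspaces.\<close>

lemma separable_by_facets:
  assumes k: "2 \<le> k" "k \<le> DIM('a::euclidean_space) + 1"
  shows "separable_by TYPE('a) k n (2 * (n choose (k - 1)))"
  unfolding separable_by_def
proof (intro allI impI)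
  fix X :: "'a set" assume "finite X \<and> card X = n \<and> general_position X"
  then have X: "finite X" "card X = n" "general_position X" by auto
  have ind: "\<not> affine_dependent A" if "A \<subseteq> X" "card A = k" for A
    using general_position_affine_independent[OF X(1,3)] that k by simp
  have "\<exists>W. finite W \<and> card W \<le> DIM('a) + 1 - k \<and>
    (\<forall>A a0. A \<subseteq> X \<longrightarrow> card A = k \<longrightarrow> a0 \<in> A \<longrightarrow>
       dim ((\<lambda>a. a - a0) ` A \<union> W) = k - 1 + (DIM('a) + 1 - k))"
    by (rule ex_complementary_directions[OF X(1) ind]) (use k in simp_all)
  then obtain W where W: "finite W" "card W \<le> DIM('a) + 1 - k"
    "\<And>A a0. A \<subseteq> X \<Longrightarrow> card A = k \<Longrightarrow> a0 \<in> A \<Longrightarrow> dim ((\<lambda>a. a - a0) ` A \<union> W) = k - 1 + (DIM('a) + 1 - k)"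
    by blast
  have nf: "\<not> flat_mod W A" if A: "A \<subseteq> X" "card A = k" for A
  proof
    assume "flat_mod W A"
    then obtain a where a: "a \<noteq> 0" "\<forall>w\<in>W. a \<bullet> w = 0" "\<forall>s\<in>A. \<forall>x\<in>A. a \<bullet> s = a \<bullet> x"
      unfolding flat_mod_def by blast
    obtain a0 where a0: "a0 \<in> A" using A(2) k by (metis card.empty equals0I not_numeral_le_zero)
    \<comment> \<open>The dimensions add up: (k - 1) + (d + 1 - k) = d.\<close>
    have "dim ((\<lambda>a. a - a0) ` A \<union> W) = DIM('a)" using W(3)[OF A a0] k by simp
    then have "a \<in> span ((\<lambda>a. a - a0) ` A \<union> W)" by (simp add: dim_eq_full)
    moreover have "orthogonal a y" if y: "y \<in> (\<lambda>a. a - a0) ` A \<union> W" for y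
    proof (cases "y \<in> W")
      case True
      then show ?thesis using a(2) by (simp add: orthogonal_def)
    next
      case False
      then obtain b where b: "b \<in> A" "y = b - a0" using y by blast
      have "a \<bullet> b = a \<bullet> a0" using a(3) b(1) a0 by blast
      then show ?thesis by (simp add: b(2) orthogonal_def inner_diff_right)
    qed
    ultimately have "orthogonal a a" by (metis orthogonal_to_span)
    then show False using a(1) by (simp add: orthogonal_def)
  qed
  have "\<exists>uc. fst uc \<noteq> 0 \<and> (\<forall>w\<in>W. fst uc \<bullet> w = 0) \<and> (\<forall>s\<in>S. fst uc \<bullet> s = snd uc)"
    if S: "S \<subseteq> X" "card S = k - 1" for S
  proof -
    have finS: "finite S" using S(1) X(1) finite_subset by blast
    obtain s0 where s0: "s0 \<in> S" using S(2) k by (metis card.empty equals0I diff_is_0_eq not_less_eq_eq numeral_2_eq_2 One_nat_def)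
    let ?V = "(\<lambda>a. a - s0) ` (S - {s0}) \<union> W"
    have "dim ?V \<le> card ?V" using finS W(1) by (intro dim_le_card') auto
    also have "\<dots> \<le> card ((\<lambda>a. a - s0) ` (S - {s0})) + card W" by (rule card_Un_le)
    also have "\<dots> \<le> card (S - {s0}) + card W" using finS by (intro add_right_mono card_image_le) auto
    \<comment> \<open>A facet has k - 2 independent edge directions, and (k - 2) + (d + 1 - k) = d -
      1 leaves room for a hyperplane parallel to \<open>W\<close> through the facet.\<close>
    also have "\<dots> < DIM('a)" using finS s0 S(2) W(2) k by simp
    finally obtain u where u: "u \<noteq> 0" "span ?V \<subseteq> {x. u \<bullet> x = 0}"
      using lowdim_subset_hyperplane by blast
    have uV: "u \<bullet> y = 0" if "y \<in> ?V" for y using u(2) span_base[OF that] by blast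
    have "u \<bullet> s = u \<bullet> s0" if "s \<in> S" for s
      using uV[of "s - s0"] that by (cases "s = s0") (auto simp: inner_diff_right)
    then show ?thesis using u(1) uV by (intro exI[of _ "(u, u \<bullet> s0)"]) auto
  qed
  then obtain uc where uc: "\<And>S. S \<subseteq> X \<Longrightarrow> card S = k - 1 \<Longrightarrow>
      fst (uc S) \<noteq> 0 \<and> (\<forall>w\<in>W. fst (uc S) \<bullet> w = 0) \<and> (\<forall>s\<in>S. fst (uc S) \<bullet> s = snd (uc S))"
    by metis
  define u c where "u S = fst (uc S)" and "c S = snd (uc S)" for S
  have u: "u S \<noteq> 0" "\<And>w. w \<in> W \<Longrightarrow> u S \<bullet> w = 0" "\<And>s. s \<in> S \<Longrightarrow> u S \<bullet> s = c S"
    if "S \<subseteq> X" "card S = k - 1" for S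
    using uc[OF that] by (auto simp: u_def c_def)
  define \<S> where "\<S> = {S. S \<subseteq> X \<and> card S = k - 1}"
  have \<S>: "finite \<S>" "card \<S> = n choose (k - 1)"
    using X by (simp_all add: \<S>_def n_subsets)
  define L where "L = (\<lambda>S. {x. u S \<bullet> x \<le> c S}) ` \<S>"
  define R where "R = (\<lambda>S. {x. u S \<bullet> x \<ge> c S}) ` \<S>"
  have fin: "finite (L \<union> R)" using \<S> by (simp add: L_def R_def)
  have "card (L \<union> R) \<le> card L + card R" by (rule card_Un_le)
  also have "\<dots> \<le> card \<S> + card \<S>" unfolding L_def R_def by (intro add_mono card_image_le \<S>)
  finally have card: "card (L \<union> R) \<le> 2 * (n choose (k - 1))" using \<S> by linarith
  have conv: "\<forall>F\<in>L \<union> R. convex F"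
    by (auto simp: L_def R_def convex_halfspace_le convex_halfspace_ge)
  define lam where "lam A a x = (u (A - {a}) \<bullet> x - c (A - {a})) / (u (A - {a}) \<bullet> a - c (A - {a}))" for A a x
  have bary: "\<And>a. a \<in> A \<Longrightarrow> u (A - {a}) \<bullet> a \<noteq> c (A - {a})" "\<And>x. (\<Sum>a\<in>A. lam A a x) = 1"
    "\<And>\<alpha> x. (\<And>w. w \<in> W \<Longrightarrow> \<alpha> \<bullet> w = 0) \<Longrightarrow> \<alpha> \<bullet> x = (\<Sum>a\<in>A. lam A a x * (\<alpha> \<bullet> a))"
    and finA: "finite A" and facet: "\<And>a. a \<in> A \<Longrightarrow> A - {a} \<subseteq> X \<and> card (A - {a}) = k - 1"
    if A: "A \<subseteq> X" "card A = k" for A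
  proof -
    show finA: "finite A" using A(1) X(1) finite_subset by blast
    have ne: "A \<noteq> {}" using A(2) k by auto
    show facet: "A - {a} \<subseteq> X \<and> card (A - {a}) = k - 1" if "a \<in> A" for a
      using A that finA by auto
    note b = barycentric_coordinates[OF finA ne nf[OF A], of "\<lambda>a. u (A - {a})" "\<lambda>a. c (A - {a})"]
    have h1: "u (A - {a}) \<noteq> 0" if "a \<in> A" for a
      using facet[OF that] by (intro u(1)) auto
    have h2: "u (A - {a}) \<bullet> w = 0" if "a \<in> A" "w \<in> W" for a w
      using facet[OF that(1)] that(2) by (intro u(2)) auto
    have h3: "u (A - {a}) \<bullet> b = c (A - {a})" if "a \<in> A" "b \<in> A" "b \<noteq> a" for a b
      using facet[OF that(1)] that(2,3) by (intro u(3)) auto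
    note h = h1 h2 h3
    show "\<And>a. a \<in> A \<Longrightarrow> u (A - {a}) \<bullet> a \<noteq> c (A - {a})" by (rule b(1)[OF h])
    show "\<And>x. (\<Sum>a\<in>A. lam A a x) = 1" unfolding lam_def by (rule b(2)[OF h])
    show "\<And>\<alpha> x. (\<And>w. w \<in> W \<Longrightarrow> \<alpha> \<bullet> w = 0) \<Longrightarrow> \<alpha> \<bullet> x = (\<Sum>a\<in>A. lam A a x * (\<alpha> \<bullet> a))"
      unfolding lam_def by (rule b(3)[OF h])
  qed
  \<comment> \<open>The halfspace at the facet opposite to \<open>a\<close> that contains
    \<open>A\<close> must also contain \<open>B\<close>. Over all \<open>a\<close> this places
    \<open>B\<close> inside the simplex of \<open>A\<close> modulo \<open>W\<close>.\<close>
  have side: "lam A a x \<ge> 0"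
    if A: "A \<subseteq> X" "card A = k" "a \<in> A" and x: "x \<in> B" and ns: "\<And>F. F \<in> L \<union> R \<Longrightarrow> A \<subseteq> F \<Longrightarrow> B \<subseteq> F" for A B a x
  proof -
    let ?S = "A - {a}"
    have S: "?S \<in> \<S>" using facet[OF A] by (simp add: \<S>_def)
    have eq: "u ?S \<bullet> b = c ?S" if "b \<in> ?S" for b using u(3)[of ?S b] facet[OF A] that by blast
    consider "u ?S \<bullet> a < c ?S" | "u ?S \<bullet> a > c ?S" using bary(1)[OF A] by linarith
    then show ?thesis
    proof cases
      case 1
      have "u ?S \<bullet> b \<le> c ?S" if "b \<in> A" for b using eq[of b] 1 that by (cases "b = a") auto
      then have "A \<subseteq> {x. u ?S \<bullet> x \<le> c ?S}" by blast
      then have "B \<subseteq> {x. u ?S \<bullet> x \<le> c ?S}" using S by (intro ns) (auto simp: L_def)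
      then show ?thesis using 1 x by (auto simp: lam_def intro!: divide_nonpos_nonpos)
    next
      case 2
      have "u ?S \<bullet> b \<ge> c ?S" if "b \<in> A" for b using eq[of b] 2 that by (cases "b = a") auto
      then have "A \<subseteq> {x. u ?S \<bullet> x \<ge> c ?S}" by blast
      then have "B \<subseteq> {x. u ?S \<bullet> x \<ge> c ?S}" using S by (intro ns) (auto simp: R_def)
      then show ?thesis using 2 x by (auto simp: lam_def intro!: divide_nonneg_nonneg)
    qed
  qed
  have "containment_separator k X (L \<union> R)"
    unfolding containment_separator_def
  proof (intro allI impI, elim conjE, rule ccontr)
    fix A B assume A: "A \<subseteq> X" "card A = k" and B: "B \<subseteq> X" "card B = k" and "A \<noteq> B"
      and ns: "\<not> (\<exists>F\<in>L \<union> R. containment_separates F A B)"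
    have AB: "A \<subseteq> F \<longleftrightarrow> B \<subseteq> F" if "F \<in> L \<union> R" for F
      using ns that unfolding containment_separates_def by blast
    have "\<not> A \<subseteq> B" using \<open>A \<noteq> B\<close> A B finA[OF B] card_subset_eq by metis
    then obtain p where p: "p \<in> A" "p \<notin> B" by blast
    have lamB: "lam B b p \<ge> 0" if "b \<in> B" for b using side[OF B that p(1)] AB by blast
    have lamA: "lam A a b \<ge> 0" if "a \<in> A" "b \<in> B" for a b using side[OF A that] AB by blast
    obtain b where b: "b \<in> B" "lam B b p > 0"
    proof (rule ccontr)
      assume "\<not> thesis"
      then have "lam B b p = 0" if "b \<in> B" for b using that lamB[OF that] \<open>\<And>b. b \<in> B \<Longrightarrow> lam B b p > 0 \<Longrightarrow> thesis\<close> by fastforce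
      then have "(\<Sum>b\<in>B. lam B b p) = 0" by simp
      then show False using bary(2)[OF B, of p] by simp
    qed
    \<comment> \<open>The coordinate of p at a vertex a other than p is 0. It is also the average,
      with the weights \<open>lam B b p\<close>, of the nonnegative a-coordinates of the points of
      \<open>B\<close>, so it vanishes at each b of positive weight.\<close>
    have z: "lam A a b = 0" if a: "a \<in> A" "a \<noteq> p" for a
    proof -
      let ?S = "A - {a}"
      have S: "?S \<subseteq> X" "card ?S = k - 1" using facet[OF A a(1)] by auto
      have "u ?S \<bullet> p = (\<Sum>b\<in>B. lam B b p * (u ?S \<bullet> b))"
        using u(2)[OF S] by (intro bary(3)[OF B])
      moreover have "u ?S \<bullet> p = c ?S" using u(3)[OF S, of p] p a by blast
      ultimately have "(\<Sum>b\<in>B. lam B b p * (u ?S \<bullet> b)) = c ?S * (\<Sum>b\<in>B. lam B b p)"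
        using bary(2)[OF B, of p] by simp
      then have "(\<Sum>b\<in>B. lam B b p * (u ?S \<bullet> b - c ?S)) = 0"
        by (simp add: sum_distrib_left right_diff_distrib sum_subtractf mult.commute)
      then have "(\<Sum>b\<in>B. lam B b p * (u ?S \<bullet> b - c ?S)) / (u ?S \<bullet> a - c ?S) = 0" by simp
      then have "(\<Sum>b\<in>B. lam B b p * lam A a b) = 0"
        by (simp add: sum_divide_distrib lam_def[of A])
      moreover have "lam B b p * lam A a b \<ge> 0" if "b \<in> B" for b using lamB lamA a that by simp
      ultimately have "\<forall>b\<in>B. lam B b p * lam A a b = 0"
        using sum_nonneg_eq_0_iff[OF finA[OF B], of "\<lambda>b. lam B b p * lam A a b"] by blast
      then have "lam B b p * lam A a b = 0" using b(1) by blast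
      then show ?thesis using b(2) by simp
    qed
    \<comment> \<open>As a vertex of \<open>A\<close>, b would have coordinate 1 at itself, although
      only its coordinate at p can be nonzero and p is not in \<open>B\<close>.\<close>
    have "b \<notin> A"
    proof
      assume bA: "b \<in> A"
      then have "lam A b b = 1" using bary(1)[OF A bA] by (simp add: lam_def)
      then show False using z[OF bA] p b(1) by auto
    qed
    have eq: "\<alpha> \<bullet> b = \<alpha> \<bullet> p" if \<alpha>: "\<And>w. w \<in> W \<Longrightarrow> \<alpha> \<bullet> w = 0" for \<alpha>
    proof -
      have "(\<Sum>a\<in>A. lam A a b * f a) = lam A p b * f p" for f
        using z p(1) finA[OF A] by (subst sum.remove[of A p]) auto
      from this[of "\<lambda>_. 1"] this[of "\<lambda>a. \<alpha> \<bullet> a"] show ?thesis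
        using bary(2)[OF A, of b] bary(3)[OF A, of \<alpha> b] \<alpha> by simp
    qed
    have "\<exists>a'. a' \<in> A \<and> a' \<noteq> p"
    proof (rule ccontr)
      assume "\<not> ?thesis"
      then have "A \<subseteq> {p}" by blast
      then have "card A \<le> 1" using card_mono[of "{p}" A] by simp
      then show False using A(2) k by simp
    qed
    then obtain a' where a': "a' \<in> A" "a' \<noteq> p" by blast
    let ?S = "A - {a'}"
    have S: "?S \<subseteq> X" "card ?S = k - 1" using facet[OF A a'(1)] by auto
    \<comment> \<open>b agrees with p modulo \<open>W\<close>, so it lies in the hyperplane of every
      facet through p. Together with the k - 1 vertices of such a facet it gives k points that are
      flat modulo \<open>W\<close>.\<close>
    have "u ?S \<bullet> b = u ?S \<bullet> p" using u(2)[OF S] by (rule eq)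
    also have "\<dots> = c ?S" using p(1) a' by (intro u(3)[OF S]) auto
    finally have "u ?S \<bullet> x = c ?S" if "x \<in> insert b ?S" for x using that u(3)[OF S] by auto
    then have "flat_mod W (insert b ?S)"
      using u(1,2)[OF S] by (intro flat_modI[of "u ?S"]) auto
    moreover have "insert b ?S \<subseteq> X" using b(1) B(1) S(1) by blast
    moreover have "card (insert b ?S) = k"
      using \<open>b \<notin> A\<close> finA[OF A] S(2) k by (simp add: card_insert_if)
    ultimately show False using nf by blast
  qed
  then show "\<exists>\<F>. finite \<F> \<and> card \<F> \<le> 2 * (n choose (k - 1)) \<and> (\<forall>F\<in>\<F>. convex F) \<and> containment_separator k X \<F>"
    using fin card conv by (intro exI[of _ "L \<union> R"]) simp
qed

section \<open>Lower bounds\<close>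

lemma separated_pairs_lower_bound:
  fixes c :: "'i \<Rightarrow> 'a::euclidean_space"
  assumes sep: "separable_by TYPE('a) k n c0"
    and \<iota>: "finite \<iota>" "card \<iota> \<le> n" and E: "finite E"
    and AB: "\<And>e. e \<in> E \<Longrightarrow> A e \<subseteq> \<iota> \<and> B e \<subseteq> \<iota> \<and> card (A e) = k \<and> card (B e) = k \<and> A e \<noteq> B e"
    and bd: "separations_bounded c {} \<iota> E A B s"
  shows "card E \<le> s * convex_separation_number TYPE('a) k n"
proof -
  obtain X :: "'a set" where X: "finite X" "card X = n" "general_position X"
    "\<And>\<F>. finite \<F> \<and> (\<forall>F\<in>\<F>. convex F) \<and> containment_separator k X \<F> \<Longrightarrow> card E \<le> s * card \<F>"
    using separator_card_lower[OF \<iota> E AB bd] by blast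
  show ?thesis by (rule convex_separation_number_ge[OF sep X(1-3)]) (use X(4) in blast)
qed

text \<open>With a single pair in \<open>E\<close> the bound s = 1 holds for any configuration, even
  the constant one. This takes care of those n that are too small for the asymptotic
  estimate.\<close>

lemma convex_separation_number_pos:
  assumes sep: "separable_by TYPE('a::euclidean_space) k n c0" and k: "1 \<le> k" "k < n"
  shows "1 \<le> convex_separation_number TYPE('a) k n"
proof -
  have "card {()} \<le> 1 * convex_separation_number TYPE('a) k n"
  proof (rule separated_pairs_lower_bound[OF sep, where \<iota>="{1..Suc k}" and A="\<lambda>_. {1..k}" and B="\<lambda>_. {2..Suc k}"])
    show "separations_bounded (\<lambda>_. 0 :: 'a) {} {1..Suc k} {()} (\<lambda>_. {1..k}) (\<lambda>_. {2..Suc k}) 1"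
      unfolding separations_bounded_def using card_mono[of "{()}"] by (auto simp del: card_mono)
    show "{1..k} \<subseteq> {1..Suc k} \<and> {2..Suc k} \<subseteq> {1..Suc k} \<and> card {1..k} = k \<and> card {2..Suc k} = k \<and> {1..k} \<noteq> {2..Suc k}"
      using k by (auto simp: atLeastAtMost_iff set_eq_iff intro!: exI[of _ 1])
  qed (use k in auto)
  then show ?thesis by simp
qed

lemma convex_separation_number_line_ge:
  assumes d: "DIM('a::euclidean_space) = 1" and n: "3 \<le> n"
  shows "2 * n - 4 \<le> convex_separation_number TYPE('a) 2 n"
proof -
  obtain v :: 'a where v: "v \<in> Basis" using nonempty_Basis by blast
  then have v0: "v \<noteq> 0" by auto
  have "a \<bullet> v \<noteq> 0" if "a \<noteq> 0" for a :: 'a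
  proof
    assume "a \<bullet> v = 0"
    then have "a = 0" using d v0 by (intro orthogonal_to_independent_eq_0[of "{v}"]) auto
    then show False using that by simp
  qed
  note bd = line_separations_bounded[OF this, where n=n]
  let ?E = "Inl ` {2..<n} \<union> Inr ` {1..<n - 1} :: (nat + nat) set"
  have "card ?E \<le> 1 * convex_separation_number TYPE('a) 2 n"
  proof (rule separated_pairs_lower_bound[OF separable_by_pairs _ _ _ _ bd])
    fix e :: "nat + nat" assume "e \<in> ?E"
    then consider j where "e = Inl j" "2 \<le> j" "j < n" | i where "e = Inr i" "1 \<le> i" "i < n - 1" by auto
    then show "case_sum (\<lambda>j. {1, j}) (\<lambda>i. {i, n}) e \<subseteq> {1..n} \<and>
        case_sum (\<lambda>j. {1, Suc j}) (\<lambda>i. {Suc i, n}) e \<subseteq> {1..n} \<and>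
        card (case_sum (\<lambda>j. {1, j}) (\<lambda>i. {i, n}) e) = 2 \<and>
        card (case_sum (\<lambda>j. {1, Suc j}) (\<lambda>i. {Suc i, n}) e) = 2 \<and>
        case_sum (\<lambda>j. {1, j}) (\<lambda>i. {i, n}) e \<noteq> case_sum (\<lambda>j. {1, Suc j}) (\<lambda>i. {Suc i, n}) e"
      by cases (auto simp: doubleton_eq_iff)
  qed (use n in auto)
  moreover have "card ?E = (n - 2) + (n - 2)"
    by (subst card_Un_disjoint) (auto simp: card_image)
  ultimately show ?thesis by simp
qed

text \<open>The common element of all pairs is the far point of the lift. The other n - 1 points are
  a chain lifted to a parabola; its n - 2 steps are the pairs to be separated, and one convex set
  deals with at most 2 of them.\<close>

lemma convex_separation_number_pairs_ge:
  assumes d: "DIM('a::euclidean_space) = 2" and n: "2 \<le> n"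
  shows "n - 2 \<le> 2 * convex_separation_number TYPE('a) 2 n"
proof -
  obtain u :: 'a where u: "u \<in> Basis" using nonempty_Basis by blast
  then have nu: "norm u = 1" by simp
  obtain v where v: "v \<noteq> 0" "orthogonal u v" using orthogonal_to_vector_exists[of u] d by auto
  have ind: "independent {u, v}"
    using v nu by (intro pairwise_orthogonal_independent) (auto simp: pairwise_def orthogonal_commute)
  have "u \<noteq> v" using v nu by (auto simp: orthogonal_def)
  have "a \<bullet> v \<noteq> 0" if "a \<bullet> u = 0" "a \<noteq> 0" for a
  proof
    assume "a \<bullet> v = 0"
    then have "a = 0" using d that(1) \<open>u \<noteq> v\<close> by (intro orthogonal_to_independent_eq_0[OF ind]) auto
    then show False using that by simp
  qed
  note bd = chain_separations_bounded[OF this, where N="n - 1"]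
  obtain c where c: "separations_bounded (c :: nat option \<Rightarrow> 'a) {} (insert None (Some ` {1..n - 1})) {1..<n - 1}
      (\<lambda>e. insert None (Some ` {e})) (\<lambda>e. insert None (Some ` {Suc e})) 2"
    using separations_bounded_lift[OF nu _ _ _ _ bd] d by auto
  have "card {1..<n - 1} \<le> 2 * convex_separation_number TYPE('a) 2 n"
    by (rule separated_pairs_lower_bound[OF separable_by_pairs _ _ _ _ c])
      (use n in \<open>auto simp: doubleton_eq_iff card_insert_if card_image\<close>)
  then show ?thesis by simp
qed

text \<open>Each of the m antipodal pairs is combined with each of the N - 1 steps of the chain.
  Genericity of \<open>insert v G\<close> in the plane means that any two of these directions span
  it.\<close>

lemma convex_separation_number_triples_ge:
  assumes d: "DIM('a::euclidean_space) = 2" and n: "2 * m + N \<le> n"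
  shows "m * (N - 1) \<le> convex_separation_number TYPE('a) 3 n"
proof -
  obtain v :: 'a where v: "linear_general_position {v}"
    using linear_general_position_insert[of "{}"] linear_general_position_empty by auto
  obtain G where G: "finite G" "card G = m" "G \<inter> {v} = {}" "linear_general_position ({v} \<union> G)"
    using linear_general_position_extend[of "{v}" m] v by blast
  have two: "a = 0" if "x \<in> insert v G" "y \<in> insert v G" "x \<noteq> y" "a \<bullet> x = 0" "a \<bullet> y = 0" for x y a
  proof (rule orthogonal_to_independent_eq_0)
    show "independent {x, y}" using that d by (intro linear_general_positionD[OF G(4)]) (auto simp: card_insert_if)
  qed (use that d in auto)
  let ?\<iota> = "Inl ` {1..N} \<union> Inr ` (G \<times> (UNIV :: bool set)) :: (nat + 'a \<times> bool) set"
  let ?A = "\<lambda>(g, t). {Inr (g, True), Inr (g, False), Inl t} :: (nat + 'a \<times> bool) set"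
  let ?B = "\<lambda>(g, t). {Inr (g, True), Inr (g, False), Inl (Suc t)} :: (nat + 'a \<times> bool) set"
  obtain c :: "nat + 'a \<times> bool \<Rightarrow> 'a" where c: "separations_bounded c {} ?\<iota> (G \<times> {1..<N}) ?A ?B 1"
    using ex_chain_pairs_separations_bounded[OF G(1), of v N] two G(3) by blast
  have "card ?\<iota> = N + 2 * m"
    using G by (subst card_Un_disjoint) (auto simp: card_image card_cartesian_product)
  then have card: "card ?\<iota> \<le> n" using n by simp
  have "card (G \<times> {1..<N}) \<le> 1 * convex_separation_number TYPE('a) 3 n"
  proof (rule separated_pairs_lower_bound[OF separable_by_facets _ card _ _ c])
    fix e assume "e \<in> G \<times> {1..<N}"
    then obtain g t where e: "e = (g, t)" "g \<in> G" "1 \<le> t" "t < N" by auto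
    have "Inl t \<noteq> (Inl (Suc t) :: nat + 'a \<times> bool)" by simp
    then have "Inl t \<notin> ?B e" "Inl t \<in> ?A e" using e(1) by simp_all
    then have "?A e \<noteq> ?B e" by blast
    moreover have "?A e \<subseteq> ?\<iota>" "?B e \<subseteq> ?\<iota>" using e by auto
    moreover have "card (?A e) = 3" "card (?B e) = 3" using e(1) by simp_all
    ultimately show "?A e \<subseteq> ?\<iota> \<and> ?B e \<subseteq> ?\<iota> \<and> card (?A e) = 3 \<and> card (?B e) = 3 \<and> ?A e \<noteq> ?B e"
      by (intro conjI)
  qed (use G(1) d in auto)
  then show ?thesis using G by (simp add: card_cartesian_product)
qed

lemma quadratic_lower_bound:
  assumes "DIM('a::euclidean_space) = 2"
  shows "(real n ^ 2 - 2 * real n - 3) / 8 \<le> real (convex_separation_number TYPE('a) 3 n)"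
proof -
  \<comment> \<open>The product m (n - 2m - 1) is largest near m = (n - 1) / 4, and (n + 1) div 4 is
    a nearest integer. Then 8 m (n - 2m - 1) = n^2 - 2n - 3 + \<rho> (4 - \<rho>), so the constant
    -3 is the case \<rho> = 0.\<close>
  define m \<rho> where "m = (n + 1) div 4" and "\<rho> = (n + 1) mod 4"
  have n: "real n = 4 * real m + real \<rho> - 1"
  proof -
    have "n + 1 = 4 * m + \<rho>" by (simp add: m_def \<rho>_def)
    then show ?thesis by (metis add_diff_cancel_right' of_nat_1 of_nat_add of_nat_mult of_nat_numeral)
  qed
  have \<rho>: "\<rho> \<le> 3" by (simp add: \<rho>_def)
  show ?thesis
  proof (cases "m = 0")
    case True
    then have "real n \<le> 2" using n \<rho> by simp
    moreover have "real n ^ 2 - 2 * real n - 3 = (real n - 3) * (real n + 1)" by (simp add: power2_eq_square algebra_simps)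
    moreover have "(real n - 3) * (real n + 1) \<le> 0" using \<open>real n \<le> 2\<close> by (intro mult_nonpos_nonneg) auto
    ultimately show ?thesis by (simp add: order.trans[of _ 0])
  next
    case False
    have le: "2 * m \<le> n" unfolding m_def by linarith
    have le1: "1 \<le> n - 2 * m" using False unfolding m_def by linarith
    have "(real n ^ 2 - 2 * real n - 3) / 8 \<le> real (m * (n - 2 * m - 1))"
    proof -
      have "real (m * (n - 2 * m - 1)) = real m * (real n - 2 * real m - 1)"
        using le le1 by (simp add: of_nat_diff)
      also have "8 * \<dots> = real n ^ 2 - 2 * real n - 3 + real \<rho> * (4 - real \<rho>)"
        unfolding n by (simp add: power2_eq_square algebra_simps)
      finally have "8 * real (m * (n - 2 * m - 1)) = real n ^ 2 - 2 * real n - 3 + real \<rho> * (4 - real \<rho>)" .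
      moreover have "real \<rho> * (4 - real \<rho>) \<ge> 0" using \<rho> by (intro mult_nonneg_nonneg) auto
      moreover have "z / 8 \<le> y" if "8 * y = z + r" "0 \<le> r" for y z r :: real using that by linarith
      ultimately show ?thesis by blast
    qed
    also have "\<dots> \<le> real (convex_separation_number TYPE('a) 3 n)"
      using convex_separation_number_triples_ge[OF assms, of m "n - 2 * m" n] le by (simp only: of_nat_le_iff)
    finally show ?thesis .
  qed
qed

section \<open>The asymptotic lower bound\<close>

lemma ex_pairs_config:
  fixes Z :: "'a::euclidean_space set"
  assumes Z: "finite Z" "linear_general_position Z"
  shows "\<exists>(c :: 'a \<times> bool + 'a \<times> bool \<Rightarrow> 'a) \<iota> (E :: ('a set \<times> 'a) set) A B.
    finite \<iota> \<and> card \<iota> = 2 ^ Suc l + 2 * m \<and> finite E \<and> card E = (m choose j) * 2 ^ l \<and>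
    (\<forall>e\<in>E. A e \<subseteq> \<iota> \<and> B e \<subseteq> \<iota> \<and> card (A e) = 2 * j + 1 \<and> card (B e) = 2 * j + 1 \<and> A e \<noteq> B e) \<and>
    separations_bounded c Z \<iota> E A B (2 ^ DIM('a) * (2 ^ DIM('a) * (l + 1) ^ (DIM('a) - 1 - card Z - j)))"
proof -
  obtain G where G: "finite G" "card G = m" "G \<inter> Z = {}" "linear_general_position (Z \<union> G)"
    using linear_general_position_extend[OF Z, of m] by blast
  obtain M :: "'a set" where M: "finite M" "card M = 2 ^ l"
    "\<And>I S. I \<subseteq> Z \<union> G \<Longrightarrow> card I < DIM('a) \<Longrightarrow> S \<subseteq> M \<Longrightarrow> exposed_mod I S \<Longrightarrow>
        card S \<le> 2 ^ DIM('a) * (l + 1) ^ (DIM('a) - 1 - card I)"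
    using ex_set_few_exposed[OF _ G(4), of l] Z(1) G(1) by auto
  let ?\<iota> = "Inl ` (M \<times> (UNIV::bool set)) \<union> Inr ` (G \<times> UNIV) :: ('a \<times> bool + 'a \<times> bool) set"
  let ?E = "{H. H \<subseteq> G \<and> card H = j} \<times> M"
  let ?P = "\<lambda>b (H, y). insert (Inl (y, b)) (Inr ` (H \<times> UNIV)) :: ('a \<times> bool + 'a \<times> bool) set"
  obtain c :: "'a \<times> bool + 'a \<times> bool \<Rightarrow> 'a" where c: "separations_bounded c Z ?\<iota> ?E (?P True) (?P False)
      (2 ^ DIM('a) * (2 ^ DIM('a) * (l + 1) ^ (DIM('a) - 1 - card Z - j)))"
    using ex_pairs_separations_bounded[OF Z(1) G(1) M(1) _ G(4) M(3), of j] G(3) by blast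
  have P: "?P b e \<subseteq> ?\<iota> \<and> card (?P b e) = 2 * j + 1" if e: "e \<in> ?E" for b e
  proof -
    obtain H y where H: "e = (H, y)" "H \<subseteq> G" "card H = j" "y \<in> M" using e by auto
    then have "finite H" using G(1) finite_subset by blast
    then have "card (insert (Inl (y, b)) (Inr ` (H \<times> UNIV)) :: ('a \<times> bool + 'a \<times> bool) set) = Suc (card H * 2)"
      by (subst card_insert_disjoint) (auto simp: card_image card_cartesian_product)
    then show ?thesis using H by auto
  qed
  have ne: "?P True e \<noteq> ?P False e" for e
  proof -
    obtain H y where e: "e = (H, y)" by (cases e)
    have "Inl (y, True) \<in> ?P True e" "Inl (y, True) \<notin> ?P False e" unfolding e by auto
    then show ?thesis by blast
  qed
  have "card ?\<iota> = card M * 2 + card G * 2"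
    using G(1) M(1) by (subst card_Un_disjoint) (auto simp: card_image card_cartesian_product)
  then have card: "card ?\<iota> = 2 ^ Suc l + 2 * m" using M(2) G(2) by simp
  have "card ?E = (m choose j) * 2 ^ l"
    using G M by (simp add: card_cartesian_product n_subsets)
  moreover have "finite ?E" "finite ?\<iota>" using G(1) M(1) by simp_all
  moreover have "\<forall>e\<in>?E. ?P True e \<subseteq> ?\<iota> \<and> ?P False e \<subseteq> ?\<iota> \<and> card (?P True e) = 2 * j + 1 \<and>
      card (?P False e) = 2 * j + 1 \<and> ?P True e \<noteq> ?P False e"
    using P ne by simp
  ultimately show ?thesis using c card
    by (intro exI[of _ c] exI[of _ ?\<iota>] exI[of _ ?E] exI[of _ "?P True"] exI[of _ "?P False"] conjI)
qed

text \<open>For odd k a k-set is one twin and j antipodal pairs. For even k the configuration is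
  taken modulo a unit vector u, which uses up one dimension, and the lift supplies the missing
  element. The strict inequality on n leaves room for that one additional point.\<close>

lemma convex_separation_number_ge_binomial:
  assumes sep: "separable_by TYPE('a::euclidean_space) k n c0" and d: "2 \<le> DIM('a)" and k: "2 \<le> k"
    and n: "2 ^ Suc l + 2 * m < n"
  defines "j \<equiv> (k - 1) div 2"
  shows "(m choose j) * 2 ^ l \<le> 2 ^ DIM('a) * (2 ^ DIM('a) * (l + 1) ^ ((2 * DIM('a) - 1 - k) div 2)) *
           convex_separation_number TYPE('a) k n"
proof (cases "odd k")
  case True
  then have kj: "k = 2 * j + 1" using k unfolding j_def by (elim oddE) simp
  have ex: "(2 * DIM('a) - 1 - k) div 2 = DIM('a) - 1 - card ({} :: 'a set) - j" unfolding kj by simp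
  obtain c :: "'a \<times> bool + 'a \<times> bool \<Rightarrow> 'a" and \<iota> A B and E :: "('a set \<times> 'a) set" where
    c: "finite \<iota>" "card \<iota> = 2 ^ Suc l + 2 * m" "finite E" "card E = (m choose j) * 2 ^ l"
    "\<And>e. e \<in> E \<Longrightarrow> A e \<subseteq> \<iota> \<and> B e \<subseteq> \<iota> \<and> card (A e) = k \<and> card (B e) = k \<and> A e \<noteq> B e"
    "separations_bounded c {} \<iota> E A B (2 ^ DIM('a) * (2 ^ DIM('a) * (l + 1) ^ ((2 * DIM('a) - 1 - k) div 2)))"
    using ex_pairs_config[OF finite.emptyI linear_general_position_empty, where 'a='a and l=l and m=m and j=j]
    unfolding kj[symmetric] ex by metis
  have "card \<iota> \<le> n" using c(2) n by simp
  from separated_pairs_lower_bound[OF sep c(1) this c(3,5,6)] show ?thesis using c(4) by simp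
next
  case False
  then have kj: "k = 2 * j + 2" using k unfolding j_def by presburger
  obtain u :: 'a where u: "u \<in> Basis" using nonempty_Basis by blast
  then have nu: "norm u = 1" by simp
  have lu: "linear_general_position {u}"
    using nu by (auto simp: linear_general_position_def subset_singleton_iff independent_empty)
  have ex: "(2 * DIM('a) - 1 - k) div 2 = DIM('a) - 1 - card {u} - j" unfolding kj by simp
  obtain c :: "'a \<times> bool + 'a \<times> bool \<Rightarrow> 'a" and \<iota> A B and E :: "('a set \<times> 'a) set" where
    c: "finite \<iota>" "card \<iota> = 2 ^ Suc l + 2 * m" "finite E" "card E = (m choose j) * 2 ^ l"
    "\<And>e. e \<in> E \<Longrightarrow> A e \<subseteq> \<iota> \<and> B e \<subseteq> \<iota> \<and> card (A e) = 2 * j + 1 \<and> card (B e) = 2 * j + 1 \<and> A e \<noteq> B e"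
    "separations_bounded c {u} \<iota> E A B (2 ^ DIM('a) * (2 ^ DIM('a) * (l + 1) ^ ((2 * DIM('a) - 1 - k) div 2)))"
    using ex_pairs_config[OF _ lu, where l=l and m=m and j=j] unfolding ex by (metis finite.emptyI finite.insertI)
  have sub: "A e \<subseteq> \<iota> \<and> B e \<subseteq> \<iota>" if "e \<in> E" for e using c(5)[OF that] by blast
  obtain c' :: "('a \<times> bool + 'a \<times> bool) option \<Rightarrow> 'a" where
    c': "separations_bounded c' {} (insert None (Some ` \<iota>)) E
      (\<lambda>e. insert None (Some ` A e)) (\<lambda>e. insert None (Some ` B e))
      (2 ^ DIM('a) * (2 ^ DIM('a) * (l + 1) ^ ((2 * DIM('a) - 1 - k) div 2)))"
    using separations_bounded_lift[OF nu d c(1,3) sub c(6)] by blast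
  have "card (insert None (Some ` \<iota>)) \<le> n" using c(1,2) n by (simp add: card_image)
  moreover have "insert None (Some ` A e) \<subseteq> insert None (Some ` \<iota>) \<and> insert None (Some ` B e) \<subseteq> insert None (Some ` \<iota>) \<and>
     card (insert None (Some ` A e)) = k \<and> card (insert None (Some ` B e)) = k \<and>
     insert None (Some ` A e) \<noteq> insert None (Some ` B e)" if e: "e \<in> E" for e
  proof -
    have "finite (A e)" "finite (B e)" using c(1) sub[OF e] finite_subset by blast+
    moreover have "Some ` A e \<noteq> Some ` B e" using c(5)[OF e] by (simp add: inj_image_eq_iff)
    then have "insert None (Some ` A e) \<noteq> insert None (Some ` B e)" by (simp add: insert_ident)
    ultimately show ?thesis using c(5)[OF e] by (simp add: card_image kj image_mono subset_insertI2)
  qed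
  ultimately show ?thesis
    using separated_pairs_lower_bound[OF sep _ _ c(3) _ c'] c(1,4) by simp
qed

lemma asymptotic_lower_bound:
  assumes d: "2 \<le> DIM('a::euclidean_space)" and k: "2 \<le> k" "k \<le> DIM('a) + 1"
  shows "\<exists>C>0. \<forall>n>k + 1. C * (real n ^ ((k + 1) div 2) / ln (real n) ^ ((2 * DIM('a) - 1 - k) div 2))
    \<le> real (convex_separation_number TYPE('a) k n)"
proof -
  define j where "j = (k - 1) div 2"
  define e where "e = (2 * DIM('a) - 1 - k) div 2"
  have kj: "(k + 1) div 2 = Suc j" using k unfolding j_def by simp
  \<comment> \<open>From n0 on, m = n div 8 satisfies both j \<le> m and m \<ge> n / 16.\<close>
  define n0 where "n0 = 16 * Suc j"
  \<comment> \<open>The factors come from the binomial coefficient, from 2^l \<ge> n / 8, from the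
    two factors 2^d in the number of separations, and from l + 1 \<le> 2 ln n.\<close>
  define C1 :: real where "C1 = 1 / ((16 * real (Suc j)) ^ j * 8 * (2 ^ DIM('a) * 2 ^ DIM('a) * 2 ^ e))"
  \<comment> \<open>The second entry of the minimum makes the left side at most 1 for n < n0, where
    only positivity of the separation number is used.\<close>
  define C where "C = min C1 (1 / real n0 ^ Suc j)"
  have C1: "C1 > 0" by (simp add: C1_def)
  have C: "C > 0" using C1 by (simp add: C_def n0_def)
  have "C * (real n ^ Suc j / ln (real n) ^ e) \<le> real (convex_separation_number TYPE('a) k n)"
    if n: "n > k + 1" for n
  proof -
    let ?c = "convex_separation_number TYPE('a) k n"
    have n4: "n \<ge> 4" using n k by simp
    have "exp 1 \<le> real n" using exp_le n4 by linarith
    then have ln1: "ln (real n) \<ge> 1" using n4 by (simp add: ln_ge_iff)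
    then have lne: "ln (real n) ^ e \<ge> 1" by simp
    note sep = separable_by_facets[OF k, of n]
    show ?thesis
    proof (cases "n < n0")
      case True
      have "C * (real n ^ Suc j / ln (real n) ^ e) \<le> (1 / real n0 ^ Suc j) * (real n0 ^ Suc j / 1)"
        using C True lne by (intro mult_mono frac_le power_mono) (auto simp: C_def)
      also have "\<dots> = 1" by (simp add: n0_def)
      also have "1 \<le> real ?c"
        using convex_separation_number_pos[OF sep] k n by simp
      finally show ?thesis .
    next
      case False
      \<comment> \<open>The far points take at most n / 4 of the budget and, with 2^(l + 2) \<le> n,
        the twins at most n / 2.\<close>
      define m where "m = n div 8"
      obtain L where L: "2 ^ L \<le> n" "n < 2 ^ (L + 1)"
        using ex_power_ivl1[of 2 n] n4 by auto
      have "L \<ge> 2"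
      proof (rule ccontr)
        assume "\<not> L \<ge> 2"
        then have "(2::nat) ^ (L + 1) \<le> 2 ^ 2" by (intro power_increasing) auto
        then show False using L(2) n4 by simp
      qed
      then obtain l where l: "L = l + 2" by (metis add.commute le_Suc_ex)
      have l1: "4 * 2 ^ l \<le> n" "n < 8 * 2 ^ l" using L unfolding l by simp_all
      have mn: "2 ^ Suc l + 2 * m < n" using l1(1) n4 unfolding m_def by simp
      have mj: "j \<le> m" "real m \<ge> real n / 16"
      proof -
        have n0: "16 * Suc j \<le> n" using False by (simp add: n0_def)
        then have "8 * j \<le> n" by simp
        then show "j \<le> m" unfolding m_def by (simp add: less_eq_div_iff_mult_less_eq mult.commute)
        have "16 \<le> n" using n0 by simp
        moreover have "8 * m + n mod 8 = n" unfolding m_def by (rule mult_div_mod_eq)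
        moreover have "n mod 8 < 8" by simp
        ultimately have "n \<le> 16 * m" by linarith
        then have "real n \<le> real (16 * m)" by (simp only: of_nat_le_iff)
        then show "real m \<ge> real n / 16" by simp
      qed
      have "(real n / (16 * real (Suc j))) ^ j \<le> real (m choose j)"
      proof (cases "j = 0")
        case False
        have "(real n / (16 * real (Suc j))) ^ j \<le> (real m / real j) ^ j"
        proof (rule power_mono)
          have "real n / (16 * real (Suc j)) = (real n / 16) / real (Suc j)" by simp
          also have "\<dots> \<le> real m / real j" using mj(2) False by (intro frac_le) auto
          finally show "real n / (16 * real (Suc j)) \<le> real m / real j" .
        qed simp
        also have "\<dots> \<le> real (m choose j)" using mj(1) by (rule binomial_ge_n_over_k_pow_k)
        finally show ?thesis .
      qed simp
      moreover have "real n / 8 \<le> 2 ^ l"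
      proof -
        have "real n < real (8 * 2 ^ l)" using l1(2) by (simp only: of_nat_less_iff)
        then show ?thesis by simp
      qed
      ultimately have "(real n / (16 * real (Suc j))) ^ j * (real n / 8) \<le> real (m choose j) * 2 ^ l"
        by (intro mult_mono) auto
      also have "\<dots> = real ((m choose j) * 2 ^ l)" by simp
      also have "\<dots> \<le> real (2 ^ DIM('a) * (2 ^ DIM('a) * (l + 1) ^ e) * ?c)"
        using convex_separation_number_ge_binomial[OF sep d k(1) mn] unfolding e_def j_def by (simp only: of_nat_le_iff)
      also have "\<dots> = 2 ^ DIM('a) * (2 ^ DIM('a) * real (l + 1) ^ e) * real ?c" by simp
      also have "\<dots> \<le> 2 ^ DIM('a) * (2 ^ DIM('a) * (2 * ln (real n)) ^ e) * real ?c"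
      proof -
        \<comment> \<open>This follows from 2^(l + 2) \<le> n and ln 2 \<ge> 1 / 2.\<close>
        have "real (l + 1) \<le> 2 * ln (real n)"
        proof -
          have "(2::real) ^ (l + 2) \<le> real n" using l1(1) by (metis L(1) l of_nat_le_iff of_nat_numeral of_nat_power)
          then have "ln ((2::real) ^ (l + 2)) \<le> ln (real n)" using n4 by (subst ln_le_cancel_iff) auto
          moreover have "ln ((2::real) ^ (l + 2)) = real (l + 2) * ln 2" by (rule ln_realpow)
          ultimately have "real (l + 2) * ln 2 \<le> ln (real n)" by (simp only:)
          moreover have "ln (2::real) \<ge> 1 / 2" using ln_le_minus_one[of "1 / 2 :: real"] by (simp add: ln_div)
          then have "real (l + 2) * (1 / 2) \<le> real (l + 2) * ln 2" by (intro mult_left_mono) auto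
          ultimately have "real (l + 2) * (1 / 2) \<le> ln (real n)" by (meson order.trans)
          then show ?thesis by simp
        qed
        then show ?thesis by (intro mult_right_mono mult_left_mono power_mono) auto
      qed
      also have "\<dots> = (2 ^ DIM('a) * 2 ^ DIM('a) * 2 ^ e) * (ln (real n) ^ e * real ?c)"
        by (simp add: power_mult_distrib)
      finally have main: "(real n / (16 * real (Suc j))) ^ j * (real n / 8) \<le>
        (2 ^ DIM('a) * 2 ^ DIM('a) * 2 ^ e) * (ln (real n) ^ e * real ?c)" .
      have "C1 * real n ^ Suc j = ((real n / (16 * real (Suc j))) ^ j * (real n / 8)) / (2 ^ DIM('a) * 2 ^ DIM('a) * 2 ^ e)"
        by (simp add: C1_def power_divide)
      also have "\<dots> \<le> ln (real n) ^ e * real ?c"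
        using main by (simp add: pos_divide_le_eq mult.commute)
      finally have "C1 * real n ^ Suc j / ln (real n) ^ e \<le> real ?c"
        using lne by (simp add: pos_divide_le_eq mult.commute)
      moreover have "C * (real n ^ Suc j / ln (real n) ^ e) \<le> C1 * (real n ^ Suc j / ln (real n) ^ e)"
        using lne by (intro mult_right_mono) (auto simp: C_def)
      ultimately show ?thesis by simp
    qed
  qed
  then show ?thesis using C unfolding kj e_def by blast
qed

theorem theorem6:
  fixes d k :: nat
  assumes "d = CARD('d::finite)" and "2 \<le> d" and "2 \<le> k" and "k \<le> d + 1"
  shows "\<exists>C::real. C > 0 \<and> (\<forall>n::nat. n > k + 1 \<longrightarrow>
    convex_separation_number TYPE(real ^ 1) 2 n = 2 * n - 4 \<and>
    (n - 2) div 2 \<le> convex_separation_number TYPE(real ^ 2) 2 n \<and>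
    convex_separation_number TYPE(real ^ 2) 2 n \<le> 2 * n - 4 \<and>
    (real n ^ 2 - 2 * real n - 3) / 8 \<le> real (convex_separation_number TYPE(real ^ 2) 3 n) \<and>
    convex_separation_number TYPE(real ^ 2) 3 n \<le> n ^ 2 - n \<and>
    C * (real n ^ ((k + 1) div 2) / ln (real n) ^ ((2 * d - 1 - k) div 2))
      \<le> real (convex_separation_number TYPE(real ^ 'd) k n) \<and>
    convex_separation_number TYPE(real ^ 'd) k n \<le> 2 * (n choose (k - 1)))"
proof -
  have d: "DIM(real ^ 'd) = d" using assms(1) by simp
  obtain C :: real where C: "C > 0" "\<forall>n>k + 1. C * (real n ^ ((k + 1) div 2) / ln (real n) ^ ((2 * d - 1 - k) div 2))
    \<le> real (convex_separation_number TYPE(real ^ 'd) k n)"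
    using asymptotic_lower_bound[where 'a="real ^ 'd", of k] assms(2-4) unfolding d by blast
  show ?thesis
  proof (intro exI[of _ C] conjI allI impI)
    fix n assume n: "n > k + 1"
    then have n4: "4 \<le> n" using assms(3) by simp
    show "convex_separation_number TYPE(real ^ 1) 2 n = 2 * n - 4"
      using n4 convex_separation_number_line_ge[where 'a="real ^ 1", of n]
        convex_separation_number_le[OF separable_by_pairs, where 'a="real ^ 1", of n]
      by (intro order_antisym) auto
    show "(n - 2) div 2 \<le> convex_separation_number TYPE(real ^ 2) 2 n"
      using n4 convex_separation_number_pairs_ge[where 'a="real ^ 2", of n] by simp
    show "convex_separation_number TYPE(real ^ 2) 2 n \<le> 2 * n - 4"
      using n4 by (intro convex_separation_number_le separable_by_pairs) simp
    show "(real n ^ 2 - 2 * real n - 3) / 8 \<le> real (convex_separation_number TYPE(real ^ 2) 3 n)"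
      by (rule quadratic_lower_bound) simp
    have "convex_separation_number TYPE(real ^ 2) 3 n \<le> 2 * (n choose (3 - 1))"
      by (intro convex_separation_number_le separable_by_facets) auto
    also have "\<dots> = n ^ 2 - n"
      by (simp add: choose_two power2_eq_square right_diff_distrib')
    finally show "convex_separation_number TYPE(real ^ 2) 3 n \<le> n ^ 2 - n" .
    show "C * (real n ^ ((k + 1) div 2) / ln (real n) ^ ((2 * d - 1 - k) div 2))
      \<le> real (convex_separation_number TYPE(real ^ 'd) k n)"
      using C(2) n by blast
    show "convex_separation_number TYPE(real ^ 'd) k n \<le> 2 * (n choose (k - 1))"
      using assms d by (intro convex_separation_number_le separable_by_facets) auto
  qed (rule C(1))
qed

end
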